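(* Let $X$ be a compact metrizable space, and let $p \in [1, \infty) \setminus \{ 2 \}$. Then $C (X)$ has unique $L^p$ operator matrix norms. They are given as follows. Let $a \in M_n (C (X))$, and interpret $a$ as a continuous function $a \colon X \to M_n$, where $M_n = M_n^p$ is equipped with the norm $\| \cdot \|_p$ of $L(l_n^p)$. Then $\| a \|_n = \sup_{x \in X} \| a (x) \|_p$.
   Context: All algebras are over $\mathbb{C}$. $L(E)$ is the Banach algebra of bounded operators on a Banach space $E$; $l^p_n=l^p(\{1,\dots,n\})$; $C(X)$ has the supremum norm. An $L^p$ operator algebra is a Banach algebra isometrically isomorphic to a norm closed subalgebra of $L(L^p(X,\mu))$ for some measure space; an isometric representation of $A$ on $L^p(X,\mu)$ is an isometric homomorphism $A\to L(L^p(X,\mu))$. For a closed subalgebra $D\subset L(L^p(Y,\nu))$, $M_n(D)$ is normed as a subalgebra of $L\big(L^p(\{1,\dots,n\}\times Y,\ \kappa\times\nu)\big)$, with $\kappa$ counting measure. A separable $L^p$ operator algebra $A$ has unique $L^p$ operator matrix norms if for any isometric representations $\pi,\sigma$ of $A$ on separable $L^p$ spaces of $\sigma$-finite measure spaces, the map $\sigma\circ\pi^{-1}\colon\pi(A)\to\sigma(A)$ is completely isometric, i.e. entrywise isometric $M_n(\pi(A))\to M_n(\sigma(A))$ for every $n\in\mathbb{Z}_{>0}$. In that case "the" norm $\|a\|_n$ of $a\in M_n(A)$ is the norm in $M_n(\pi(A))$ of the matrix obtained by applying $\pi$ to each entry of $a$, for any such $\pi$. *)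

theory Defs
  imports "HOL-Analysis.Analysis"
begin

section \<open>Complex normed spaces and Banach algebras with explicit carriers\<close>

record 'a cnspace =
  carr :: "'a set"
  zero_of :: 'a
  add_of :: "'a \<Rightarrow> 'a \<Rightarrow> 'a"
  scale_of :: "complex \<Rightarrow> 'a \<Rightarrow> 'a"
  norm_of :: "'a \<Rightarrow> real"

record 'a cnalgebra = "'a cnspace" +
  mult_of :: "'a \<Rightarrow> 'a \<Rightarrow> 'a"

definition dist_of :: "('a, 'z) cnspace_scheme \<Rightarrow> 'a \<Rightarrow> 'a \<Rightarrow> real" where
  "dist_of E x y = norm_of E (add_of E x (scale_of E (-1) y))"

locale complex_normed_space =
  fixes E :: "('a, 'z) cnspace_scheme" (structure)
  assumes zero_closed: "zero_of E \<in> carr E"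
    and add_closed: "\<lbrakk>x \<in> carr E; y \<in> carr E\<rbrakk> \<Longrightarrow> add_of E x y \<in> carr E"
    and scale_closed: "x \<in> carr E \<Longrightarrow> scale_of E c x \<in> carr E"
    and add_assoc: "\<lbrakk>x \<in> carr E; y \<in> carr E; z \<in> carr E\<rbrakk> \<Longrightarrow>
          add_of E (add_of E x y) z = add_of E x (add_of E y z)"
    and add_commute: "\<lbrakk>x \<in> carr E; y \<in> carr E\<rbrakk> \<Longrightarrow> add_of E x y = add_of E y x"
    and add_zero: "x \<in> carr E \<Longrightarrow> add_of E x (zero_of E) = x"
    and add_minus: "x \<in> carr E \<Longrightarrow> add_of E x (scale_of E (-1) x) = zero_of E"
    and scale_one: "x \<in> carr E \<Longrightarrow> scale_of E 1 x = x"
    and scale_scale: "x \<in> carr E \<Longrightarrow> scale_of E b (scale_of E c x) = scale_of E (b * c) x"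
    and scale_add_left: "x \<in> carr E \<Longrightarrow>
          scale_of E (b + c) x = add_of E (scale_of E b x) (scale_of E c x)"
    and scale_add_right: "\<lbrakk>x \<in> carr E; y \<in> carr E\<rbrakk> \<Longrightarrow>
          scale_of E c (add_of E x y) = add_of E (scale_of E c x) (scale_of E c y)"
    and norm_nonneg: "x \<in> carr E \<Longrightarrow> 0 \<le> norm_of E x"
    and norm_eq_zero: "x \<in> carr E \<Longrightarrow> norm_of E x = 0 \<longleftrightarrow> x = zero_of E"
    and norm_scale: "x \<in> carr E \<Longrightarrow> norm_of E (scale_of E c x) = cmod c * norm_of E x"
    and norm_triangle: "\<lbrakk>x \<in> carr E; y \<in> carr E\<rbrakk> \<Longrightarrow>
          norm_of E (add_of E x y) \<le> norm_of E x + norm_of E y"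

locale complex_banach_space = complex_normed_space +
  assumes complete: "\<lbrakk>range s \<subseteq> carr E;
          \<And>e. 0 < e \<Longrightarrow> \<exists>N. \<forall>m\<ge>N. \<forall>n\<ge>N. dist_of E (s m) (s n) < e\<rbrakk> \<Longrightarrow>
          \<exists>l\<in>carr E. (\<lambda>n::nat. dist_of E (s n) l) \<longlonglongrightarrow> 0"

locale complex_banach_algebra = complex_banach_space A
  for A :: "('a, 'z) cnalgebra_scheme" (structure) +
  assumes mult_closed: "\<lbrakk>x \<in> carr A; y \<in> carr A\<rbrakk> \<Longrightarrow> mult_of A x y \<in> carr A"
    and mult_assoc: "\<lbrakk>x \<in> carr A; y \<in> carr A; z \<in> carr A\<rbrakk> \<Longrightarrow>
          mult_of A (mult_of A x y) z = mult_of A x (mult_of A y z)"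
    and mult_add_left: "\<lbrakk>x \<in> carr A; y \<in> carr A; z \<in> carr A\<rbrakk> \<Longrightarrow>
          mult_of A (add_of A x y) z = add_of A (mult_of A x z) (mult_of A y z)"
    and mult_add_right: "\<lbrakk>x \<in> carr A; y \<in> carr A; z \<in> carr A\<rbrakk> \<Longrightarrow>
          mult_of A x (add_of A y z) = add_of A (mult_of A x y) (mult_of A x z)"
    and mult_scale_left: "\<lbrakk>x \<in> carr A; y \<in> carr A\<rbrakk> \<Longrightarrow>
          mult_of A (scale_of A c x) y = scale_of A c (mult_of A x y)"
    and mult_scale_right: "\<lbrakk>x \<in> carr A; y \<in> carr A\<rbrakk> \<Longrightarrow>
          mult_of A x (scale_of A c y) = scale_of A c (mult_of A x y)"
    and norm_mult: "\<lbrakk>x \<in> carr A; y \<in> carr A\<rbrakk> \<Longrightarrow>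
          norm_of A (mult_of A x y) \<le> norm_of A x * norm_of A y"

definition separable :: "('a, 'z) cnspace_scheme \<Rightarrow> bool" where
  "separable E \<longleftrightarrow> (\<exists>D. countable D \<and> D \<subseteq> carr E \<and>
     (\<forall>x\<in>carr E. \<forall>e>0. \<exists>d\<in>D. dist_of E x d < e))"

definition closed_subalgebra :: "'a set \<Rightarrow> ('a, 'z) cnalgebra_scheme \<Rightarrow> bool" where
  "closed_subalgebra B A \<longleftrightarrow> B \<subseteq> carr A \<and> zero_of A \<in> B \<and>
     (\<forall>x\<in>B. \<forall>y\<in>B. add_of A x y \<in> B \<and> mult_of A x y \<in> B) \<and>
     (\<forall>c. \<forall>x\<in>B. scale_of A c x \<in> B) \<and>
     (\<forall>s l. range s \<subseteq> B \<and> l \<in> carr A \<and> (\<lambda>n::nat. dist_of A (s n) l) \<longlonglongrightarrow> 0 \<longrightarrow> l \<in> B)"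

text \<open>Homomorphisms are not required to preserve identity elements.\<close>

definition isometric_hom ::
  "('a, 'y) cnalgebra_scheme \<Rightarrow> ('b, 'z) cnalgebra_scheme \<Rightarrow> ('a \<Rightarrow> 'b) \<Rightarrow> bool" where
  "isometric_hom A B \<phi> \<longleftrightarrow> \<phi> \<in> carr A \<rightarrow> carr B \<and>
     (\<forall>x\<in>carr A. \<forall>y\<in>carr A. \<phi> (add_of A x y) = add_of B (\<phi> x) (\<phi> y)) \<and>
     (\<forall>x\<in>carr A. \<forall>c. \<phi> (scale_of A c x) = scale_of B c (\<phi> x)) \<and>
     (\<forall>x\<in>carr A. \<forall>y\<in>carr A. \<phi> (mult_of A x y) = mult_of B (\<phi> x) (\<phi> y)) \<and>
     (\<forall>x\<in>carr A. norm_of B (\<phi> x) = norm_of A x)"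

definition bounded_operators :: "('a, 'z) cnspace_scheme \<Rightarrow> ('a \<Rightarrow> 'a) cnalgebra" where
  "bounded_operators E =
     \<lparr>carr = {T \<in> carr E \<rightarrow>\<^sub>E carr E.
        (\<forall>x\<in>carr E. \<forall>y\<in>carr E. T (add_of E x y) = add_of E (T x) (T y)) \<and>
        (\<forall>x\<in>carr E. \<forall>c. T (scale_of E c x) = scale_of E c (T x)) \<and>
        (\<exists>K. \<forall>x\<in>carr E. norm_of E (T x) \<le> K * norm_of E x)},
      zero_of = (\<lambda>x\<in>carr E. zero_of E),
      add_of = (\<lambda>S T. \<lambda>x\<in>carr E. add_of E (S x) (T x)),
      scale_of = (\<lambda>c T. \<lambda>x\<in>carr E. scale_of E c (T x)),
      norm_of = (\<lambda>T. Sup {norm_of E (T x) | x. x \<in> carr E \<and> norm_of E x \<le> 1}),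
      mult_of = (\<lambda>S T. \<lambda>x\<in>carr E. S (T x))\<rparr>"


section \<open>The spaces $L^p(M)$\<close>

definition Lp_fun :: "real \<Rightarrow> 'm measure \<Rightarrow> ('m \<Rightarrow> complex) set" where
  "Lp_fun p M = {f \<in> borel_measurable M. integrable M (\<lambda>x. cmod (f x) powr p)}"

definition Lp_rel :: "real \<Rightarrow> 'm measure \<Rightarrow> ('m \<Rightarrow> complex) rel" where
  "Lp_rel p M = {(f, g). f \<in> Lp_fun p M \<and> g \<in> Lp_fun p M \<and> (AE x in M. f x = g x)}"

definition Lp_class :: "real \<Rightarrow> 'm measure \<Rightarrow> ('m \<Rightarrow> complex) \<Rightarrow> ('m \<Rightarrow> complex) set" where
  "Lp_class p M f = Lp_rel p M `` {f}"

definition Lp_rep :: "('m \<Rightarrow> complex) set \<Rightarrow> 'm \<Rightarrow> complex" where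
  "Lp_rep \<xi> = (SOME f. f \<in> \<xi>)"

definition Lp_space :: "real \<Rightarrow> 'm measure \<Rightarrow> ('m \<Rightarrow> complex) set cnspace" where
  "Lp_space p M =
     \<lparr>carr = Lp_fun p M // Lp_rel p M,
      zero_of = Lp_class p M (\<lambda>x. 0),
      add_of = (\<lambda>\<xi> \<eta>. Lp_class p M (\<lambda>x. Lp_rep \<xi> x + Lp_rep \<eta> x)),
      scale_of = (\<lambda>c \<xi>. Lp_class p M (\<lambda>x. c * Lp_rep \<xi> x)),
      norm_of = (\<lambda>\<xi>. (\<integral>x. cmod (Lp_rep \<xi> x) powr p \<partial>M) powr (1 / p))\<rparr>"

abbreviation Lp_operators ::
  "real \<Rightarrow> 'm measure \<Rightarrow> (('m \<Rightarrow> complex) set \<Rightarrow> ('m \<Rightarrow> complex) set) cnalgebra" where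
  "Lp_operators p M \<equiv> bounded_operators (Lp_space p M)"

abbreviation isometric_rep ::
  "real \<Rightarrow> 'm measure \<Rightarrow> ('a, 'z) cnalgebra_scheme \<Rightarrow>
   ('a \<Rightarrow> ('m \<Rightarrow> complex) set \<Rightarrow> ('m \<Rightarrow> complex) set) \<Rightarrow> bool" where
  "isometric_rep p M A \<pi> \<equiv> isometric_hom A (Lp_operators p M) \<pi>"

text \<open>HOL cannot quantify over types inside a formula, so the type of the points of the
  measure space is a parameter.\<close>

definition Lp_operator_algebra ::
  "'m itself \<Rightarrow> real \<Rightarrow> ('a, 'z) cnalgebra_scheme \<Rightarrow> bool" where
  "Lp_operator_algebra (_ :: 'm itself) p A \<longleftrightarrow> complex_banach_algebra A \<and>
     (\<exists>(M :: 'm measure) \<pi>. isometric_rep p M A \<pi> \<and>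
        closed_subalgebra (\<pi> ` carr A) (Lp_operators p M))"

definition separable_sigma_finite :: "real \<Rightarrow> 'm measure \<Rightarrow> bool" where
  "separable_sigma_finite p M \<longleftrightarrow> sigma_finite_measure M \<and> separable (Lp_space p M)"


section \<open>Matrix norms\<close>

text \<open>An element of $M_n(S)$ is a function of two indices; only its values on
  \<open>{1..n} \<times> {1..n}\<close> are relevant.\<close>

definition matrices :: "nat \<Rightarrow> 'a set \<Rightarrow> (nat \<Rightarrow> nat \<Rightarrow> 'a) set" where
  "matrices n S = {a. \<forall>i\<in>{1..n}. \<forall>j\<in>{1..n}. a i j \<in> S}"

text \<open>The operator on $L^p(\{1,\ldots,n\} \times Y)$ given by a matrix of operators on $L^p(Y)$:
  $(T\xi)(i, \cdot) = \sum_j T_{ij}\,(\xi(j, \cdot))$.\<close>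

definition matrix_operator ::
  "real \<Rightarrow> 'm measure \<Rightarrow> nat \<Rightarrow>
   (nat \<Rightarrow> nat \<Rightarrow> ('m \<Rightarrow> complex) set \<Rightarrow> ('m \<Rightarrow> complex) set) \<Rightarrow>
   (nat \<times> 'm \<Rightarrow> complex) set \<Rightarrow> (nat \<times> 'm \<Rightarrow> complex) set" where
  "matrix_operator p M n T =
     (\<lambda>\<xi>\<in>carr (Lp_space p (count_space {1..n} \<Otimes>\<^sub>M M)).
        Lp_class p (count_space {1..n} \<Otimes>\<^sub>M M)
          (\<lambda>(i, y). \<Sum>j=1..n. Lp_rep (T i j (Lp_class p M (\<lambda>z. Lp_rep \<xi> (j, z)))) y))"

definition matrix_norm ::
  "real \<Rightarrow> 'm measure \<Rightarrow> nat \<Rightarrow>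
   (nat \<Rightarrow> nat \<Rightarrow> ('m \<Rightarrow> complex) set \<Rightarrow> ('m \<Rightarrow> complex) set) \<Rightarrow> real" where
  "matrix_norm p M n T =
     norm_of (Lp_operators p (count_space {1..n} \<Otimes>\<^sub>M M)) (matrix_operator p M n T)"

definition completely_isometric ::
  "real \<Rightarrow> 'm measure \<Rightarrow> 'k measure \<Rightarrow> (('m \<Rightarrow> complex) set \<Rightarrow> ('m \<Rightarrow> complex) set) set \<Rightarrow>
   ((('m \<Rightarrow> complex) set \<Rightarrow> ('m \<Rightarrow> complex) set) \<Rightarrow>
    ('k \<Rightarrow> complex) set \<Rightarrow> ('k \<Rightarrow> complex) set) \<Rightarrow> bool" where
  "completely_isometric p M N D \<phi> \<longleftrightarrow>
     (\<forall>n>0. \<forall>d\<in>matrices n D. matrix_norm p N n (\<lambda>i j. \<phi> (d i j)) = matrix_norm p M n d)"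

text \<open>As before, the types of the points of the two measure spaces are parameters.\<close>

definition unique_Lp_matrix_norms ::
  "'m itself \<Rightarrow> 'k itself \<Rightarrow> real \<Rightarrow> ('a, 'z) cnalgebra_scheme \<Rightarrow> bool" where
  "unique_Lp_matrix_norms (_ :: 'm itself) (_ :: 'k itself) p A \<longleftrightarrow>
     (\<forall>(M :: 'm measure) (N :: 'k measure) \<pi> \<sigma>.
        separable_sigma_finite p M \<and> separable_sigma_finite p N \<and>
        isometric_rep p M A \<pi> \<and> isometric_rep p N A \<sigma> \<longrightarrow>
        completely_isometric p M N (\<pi> ` carr A) (\<sigma> \<circ> inv_into (carr A) \<pi>))"

text \<open>The norm of a scalar \<open>n \<times> n\<close> matrix in $L(l^p_n)$.\<close>

definition scalar_matrix_operator ::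
  "real \<Rightarrow> nat \<Rightarrow> (nat \<Rightarrow> nat \<Rightarrow> complex) \<Rightarrow> (nat \<Rightarrow> complex) set \<Rightarrow> (nat \<Rightarrow> complex) set" where
  "scalar_matrix_operator p n a =
     (\<lambda>\<xi>\<in>carr (Lp_space p (count_space {1..n})).
        Lp_class p (count_space {1..n}) (\<lambda>i. \<Sum>j=1..n. a i j * Lp_rep \<xi> j))"

definition scalar_matrix_norm :: "real \<Rightarrow> nat \<Rightarrow> (nat \<Rightarrow> nat \<Rightarrow> complex) \<Rightarrow> real" where
  "scalar_matrix_norm p n a =
     norm_of (Lp_operators p (count_space {1..n})) (scalar_matrix_operator p n a)"


section \<open>The algebra $C(X)$\<close>

text \<open>Supremum of a set of nonnegative reals, with the convention that the supremum of the
  empty set is \<open>0\<close>; this only matters when the space is empty.\<close>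

definition sup0 :: "real set \<Rightarrow> real" where
  "sup0 S = Sup (insert 0 S)"

definition C_algebra :: "'x topology \<Rightarrow> ('x \<Rightarrow> complex) cnalgebra" where
  "C_algebra X =
     \<lparr>carr = {f \<in> extensional (topspace X). continuous_map X euclidean f},
      zero_of = (\<lambda>x\<in>topspace X. 0),
      add_of = (\<lambda>f g. \<lambda>x\<in>topspace X. f x + g x),
      scale_of = (\<lambda>c f. \<lambda>x\<in>topspace X. c * f x),
      norm_of = (\<lambda>f. sup0 ((\<lambda>x. cmod (f x)) ` topspace X)),
      mult_of = (\<lambda>f g. \<lambda>x\<in>topspace X. f x * g x)\<rparr>"

end

theory Submission
  imports Defs
begin

text \<open>
  Let \<open>\<pi>\<close> represent \<open>C(X)\<close> isometrically on \<open>L\<^sup>p(M)\<close>. The matrix norm that \<open>\<pi>\<close> defines on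
  \<open>M\<^sub>n(C(X))\<close> is at least the supremum of the norms of the scalar matrices \<open>a(x)\<close>: near \<open>x\<close> the
  matrix \<open>a\<close> is almost constant, so on columns with entries \<open>c\<^sub>j \<zeta>\<close>, where \<open>\<zeta> = \<pi>(f) \<eta>\<close> and \<open>f\<close> is
  a function that peaks at \<open>x\<close>, it acts almost as \<open>a(x)\<close> does (\<open>matrix_action_lower\<close>).

  The reverse inequality rests on one fact (\<open>action_disjoint\<close>): if \<open>f g = 0\<close> in
  \<open>C(X)\<close>, then \<open>\<pi>(f) \<xi>\<close> and \<open>\<pi>(g) \<eta>\<close> have product \<open>0\<close> almost everywhere, for all \<open>\<xi>\<close> and
  \<open>\<eta>\<close>. When \<open>\<pi>(1)\<close> is the identity, Lamperti's theorem on isometries yields this.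
  In general \<open>\<pi>(1)\<close> is a contractive projection, and one could appeal to the
  theorem that its range is again an \<open>L\<^sup>p\<close> space. The proof below treats both
  cases at once, by means of the derivative of the norm. Let \<open>T\<^sub>1 = \<pi>(f\<^sub>1)\<close> and
  \<open>T\<^sub>2 = \<pi>(g\<^sub>1)\<close>, where \<open>f\<^sub>1\<close> and \<open>g\<^sub>1\<close> have product \<open>0\<close> and values in \<open>[0, 1]\<close>, and
  suppose that \<open>T\<^sub>1\<close> fixes \<open>u\<close> and kills \<open>w\<close>, while \<open>T\<^sub>2\<close> fixes \<open>w\<close> and kills \<open>u\<close>. For \<open>z\<close> of
  modulus \<open>1\<close> the operator \<open>T\<^sub>1 + z T\<^sub>2\<close> is a contraction that carries \<open>u + z\<^sup>* w\<close> to
  \<open>u + w\<close> without changing its norm. Comparing derivatives of the norm at these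
  two vectors gives \<open>\<integral> J(u + z\<^sup>* w) \<zeta> = \<integral> J(u + w) (T\<^sub>1 \<zeta> + z T\<^sub>2 \<zeta>)\<close>, where
  \<open>J(a) = \<bar>a\<bar>\<^bsup>p-2\<^esup> a\<^sup>*\<close>, for all directions \<open>\<zeta>\<close> that vanish where \<open>u + z\<^sup>* w\<close> does.
  The right-hand side is affine in \<open>z\<close>, so any linear relation that holds for
  affine functions of the fourth roots of unity \<open>z\<close> also holds for the functions
  \<open>J(u + z\<^sup>* w)\<close>, almost everywhere on the set where \<open>\<bar>u\<bar> \<noteq> \<bar>w\<bar>\<close>. For \<open>p \<noteq> 2\<close> the two
  independent relations force \<open>u w = 0\<close> there (\<open>fourth_roots_rigidity\<close>), and
  passing to \<open>2 w\<close> disposes of the rest; for \<open>p = 2\<close> the map \<open>J\<close> is conjugate linear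
  and they are void.

  Given disjointness, a pigeonhole argument produces functions \<open>h\<^sub>k\<close> with mutual products \<open>0\<close>, each
  supported where \<open>a\<close> is almost equal to some \<open>a(x\<^sub>k)\<close>, such that \<open>\<pi>(1 - \<Sum> h\<^sub>k)\<close> is small on
  finitely many prescribed vectors (\<open>almost_partition\<close>). Up to small errors \<open>a\<close> then acts on the
  vectors \<open>\<pi>(h\<^sub>k) \<xi>\<^sub>j\<close> as the scalar matrix \<open>a(x\<^sub>k)\<close>, and because different \<open>k\<close> live on disjoint
  sets the \<open>p\<close>-th powers of the norms add up (\<open>matrix_action_upper\<close>).

  The resulting formula does not mention \<open>\<pi>\<close>, which is uniqueness. Multiplication on \<open>l\<^sup>p\<close> of a
  countable dense subset of \<open>X\<close> is an isometric representation on a separable space.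
\<close>

section \<open>Functions with integrable \<open>p\<close>-th power\<close>

text \<open>Most arguments concern functions, not their classes modulo equality almost everywhere, so the
  norm is needed at that level.\<close>

definition Lp_norm :: "real \<Rightarrow> 'm measure \<Rightarrow> ('m \<Rightarrow> complex) \<Rightarrow> real" where
  "Lp_norm p M f = (\<integral>x. cmod (f x) powr p \<partial>M) powr (1 / p)"

lemma member_le_double_sum:
  fixes f :: "'i \<Rightarrow> 'j \<Rightarrow> real"
  assumes "finite I" "finite J" "i \<in> I" "j \<in> J" "\<And>i j. i \<in> I \<Longrightarrow> j \<in> J \<Longrightarrow> 0 \<le> f i j"
  shows "f i j \<le> (\<Sum>i\<in>I. \<Sum>j\<in>J. f i j)"
proof -
  have "f i j \<le> (\<Sum>j\<in>J. f i j)" by (rule member_le_sum) (use assms in auto)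
  also have "\<dots> \<le> (\<Sum>i\<in>I. \<Sum>j\<in>J. f i j)"
    by (rule member_le_sum[where f="\<lambda>i. \<Sum>j\<in>J. f i j"]) (use assms in \<open>auto intro: sum_nonneg\<close>)
  finally show ?thesis .
qed

locale Lp_exponent =
  fixes p :: real
  assumes p_ge_1: "1 \<le> p"
begin

abbreviation Lp :: "'m measure \<Rightarrow> ('m \<Rightarrow> complex) set" where "Lp M \<equiv> Lp_fun p M"

abbreviation cls :: "'m measure \<Rightarrow> ('m \<Rightarrow> complex) \<Rightarrow> ('m \<Rightarrow> complex) set" where "cls M \<equiv> Lp_class p M"

abbreviation nrm :: "'m measure \<Rightarrow> ('m \<Rightarrow> complex) \<Rightarrow> real" where "nrm M f \<equiv> Lp_norm p M f"

lemma p_pos: "0 < p" using p_ge_1 by linarith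

lemma powr_convex_combination:
  fixes x y :: real
  assumes "0 \<le> x" "0 \<le> y" "0 \<le> s" "0 \<le> t" "s + t = 1"
  shows "(s * x + t * y) powr p \<le> s * x powr p + t * y powr p"
proof -
  have le: "c powr p \<le> c" if "0 \<le> c" "c \<le> 1" for c :: real
    using powr_mono'[of 1 p c] that p_ge_1 by (cases "c = 0") auto
  have z: "(c * u) powr p \<le> c * u powr p" if "0 \<le> c" "c \<le> 1" "0 \<le> u" for c u :: real
    using le[of c] that by (simp add: powr_mult mult_right_mono)
  show ?thesis
  proof (cases "x = 0 \<or> y = 0")
    case True
    then show ?thesis using z[of s x] z[of t y] assms by auto
  next
    case False
    then have "x \<in> {0<..}" "y \<in> {0<..}" using assms by auto
    have "1 - t = s" using assms by simp
    with \<open>x \<in> {0<..}\<close> \<open>y \<in> {0<..}\<close> show ?thesis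
      using convex_onD[OF powr_convex[OF p_ge_1], of t x y] assms unfolding \<open>1 - t = s\<close> by simp
  qed
qed

lemma powr_tangent:
  fixes x y :: real
  assumes "0 < x" "0 \<le> y"
  shows "x powr p + p * x powr (p - 1) * (y - x) \<le> y powr p"
proof (cases "y = 0")
  case True
  have "x powr (p - 1) * x = x powr p" using assms powr_mult_base[of x "p - 1"] by (simp add: mult.commute)
  then have "x powr p + p * x powr (p - 1) * (y - x) = (1 - p) * x powr p"
    using True by (simp add: algebra_simps)
  also have "\<dots> \<le> 0" using p_ge_1 by (simp add: mult_nonpos_nonneg)
  finally show ?thesis using True by simp
next
  case False
  have "p * x powr (p - 1) * (y - x) \<le> y powr p - x powr p"
  proof (rule convex_on_imp_above_tangent[OF powr_convex[OF p_ge_1]])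
    show "((\<lambda>x. x powr p) has_field_derivative p * x powr (p - 1)) (at x within {0<..})"
      using assms by (auto intro!: derivative_eq_intros)
  qed (use assms False in \<open>auto simp: interior_open\<close>)
  then show ?thesis by simp
qed

lemma powr_sum_le:
  fixes x y :: real
  assumes "0 \<le> x" "0 \<le> y"
  shows "(x + y) powr p \<le> 2 powr p * (x powr p + y powr p)"
proof -
  have "(x + y) powr p \<le> (2 * max x y) powr p"
    using assms p_ge_1 by (intro powr_mono2) auto
  also have "\<dots> = 2 powr p * max x y powr p" using assms by (simp add: powr_mult)
  also have "max x y powr p \<le> x powr p + y powr p" by (auto simp: max_def)
  finally show ?thesis by simp
qed

lemma Lp_funD: "f \<in> Lp M \<Longrightarrow> f \<in> borel_measurable M"
  "f \<in> Lp M \<Longrightarrow> integrable M (\<lambda>x. cmod (f x) powr p)"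
  by (auto simp: Lp_fun_def)

lemma Lp_fun_dominated:
  assumes "g \<in> borel_measurable M" "f \<in> Lp M" "\<And>x. x \<in> space M \<Longrightarrow> cmod (g x) \<le> cmod (f x)"
  shows "g \<in> Lp M"
proof -
  have "integrable M (\<lambda>x. cmod (g x) powr p)"
  proof (rule Bochner_Integration.integrable_bound[OF Lp_funD(2)[OF assms(2)]])
    show "AE x in M. norm (cmod (g x) powr p) \<le> norm (cmod (f x) powr p)"
      using assms(3) p_ge_1 by (auto intro!: AE_I2 powr_mono2)
  qed (use assms(1) in measurable)
  with assms(1) show ?thesis by (simp add: Lp_fun_def)
qed

lemma Lp_fun_zero: "(\<lambda>x. 0) \<in> Lp M" by (simp add: Lp_fun_def)

lemma Lp_fun_scale: "f \<in> Lp M \<Longrightarrow> (\<lambda>x. c * f x) \<in> Lp M"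
  by (auto simp: Lp_fun_def norm_mult powr_mult)

lemma Lp_fun_add:
  assumes "f \<in> Lp M" "g \<in> Lp M"
  shows "(\<lambda>x. f x + g x) \<in> Lp M"
proof -
  note [measurable] = Lp_funD(1)[OF assms(1)] Lp_funD(1)[OF assms(2)]
  have "integrable M (\<lambda>x. cmod (f x + g x) powr p)"
  proof (rule Bochner_Integration.integrable_bound)
    show "integrable M (\<lambda>x. 2 powr p * (cmod (f x) powr p + cmod (g x) powr p))"
      using assms by (auto simp: Lp_fun_def)
    have "cmod (f x + g x) powr p \<le> 2 powr p * (cmod (f x) powr p + cmod (g x) powr p)" for x
      using p_ge_1 by (intro order_trans[OF powr_mono2[OF _ _ norm_triangle_ineq] powr_sum_le]) auto
    then show "AE x in M. norm (cmod (f x + g x) powr p) \<le>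
        norm (2 powr p * (cmod (f x) powr p + cmod (g x) powr p))"
      by (auto intro!: AE_I2 simp: abs_of_nonneg)
  qed measurable
  then show ?thesis by (simp add: Lp_fun_def)
qed

lemma Lp_fun_diff:
  "f \<in> Lp M \<Longrightarrow> g \<in> Lp M \<Longrightarrow> (\<lambda>x. f x - g x) \<in> Lp M"
  using Lp_fun_add[of f M "\<lambda>x. (-1) * g x"] Lp_fun_scale[of g M "-1"] by simp

lemma Lp_fun_sum:
  "(\<And>i. i \<in> I \<Longrightarrow> f i \<in> Lp M) \<Longrightarrow> (\<lambda>x. \<Sum>i\<in>I. f i x) \<in> Lp M"
  by (induction I rule: infinite_finite_induct) (auto intro: Lp_fun_add Lp_fun_zero)

lemma Lp_norm_nonneg: "0 \<le> nrm M f" by (simp add: Lp_norm_def)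

lemma Lp_norm_powr: "nrm M f powr p = (\<integral>x. cmod (f x) powr p \<partial>M)"
  using p_pos by (simp add: Lp_norm_def powr_powr)

lemma Lp_norm_le_iff:
  assumes "0 \<le> c"
  shows "nrm M f \<le> c \<longleftrightarrow> (\<integral>x. cmod (f x) powr p \<partial>M) \<le> c powr p"
  using assms p_pos Lp_norm_nonneg[of M f]
  unfolding Lp_norm_powr[symmetric]
  by (metis linorder_not_le powr_less_mono2 powr_mono2 less_imp_le)

lemma Lp_norm_zero: "nrm M (\<lambda>x. 0) = 0" by (simp add: Lp_norm_def)

lemma Lp_norm_scale: "nrm M (\<lambda>x. c * f x) = cmod c * nrm M f"
  using p_pos by (simp add: Lp_norm_def norm_mult powr_mult powr_powr)

lemma Lp_norm_cong_AE:
  assumes "f \<in> borel_measurable M" "g \<in> borel_measurable M" "AE x in M. f x = g x"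
  shows "nrm M f = nrm M g"
proof -
  have "(\<integral>x. cmod (f x) powr p \<partial>M) = (\<integral>x. cmod (g x) powr p \<partial>M)"
    using assms by (intro integral_cong_AE) auto
  then show ?thesis by (simp add: Lp_norm_def)
qed

lemma Lp_norm_mono:
  assumes "g \<in> borel_measurable M" "f \<in> Lp M" "AE x in M. cmod (g x) \<le> cmod (f x)"
  shows "nrm M g \<le> nrm M f"
proof -
  have "(\<integral>x. cmod (g x) powr p \<partial>M) \<le> (\<integral>x. cmod (f x) powr p \<partial>M)"
  proof (rule integral_mono_AE')
    show "AE x in M. cmod (g x) powr p \<le> cmod (f x) powr p"
      using assms(3) by eventually_elim (use p_ge_1 in \<open>auto intro: powr_mono2\<close>)
  qed (use Lp_funD[OF assms(2)] in auto)
  then show ?thesis by (simp add: Lp_norm_def powr_mono2 p_pos less_imp_le)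
qed

lemma Lp_norm_eq_0:
  assumes "f \<in> Lp M"
  shows "nrm M f = 0 \<longleftrightarrow> (AE x in M. f x = 0)"
proof -
  have "nrm M f = 0 \<longleftrightarrow> (\<integral>x. cmod (f x) powr p \<partial>M) = 0"
    by (simp add: Lp_norm_def)
  also have "\<dots> \<longleftrightarrow> (AE x in M. cmod (f x) powr p = 0)"
    using Lp_funD[OF assms] by (intro integral_nonneg_eq_0_iff_AE) auto
  finally show ?thesis by simp
qed

text \<open>Minkowski's inequality is the convexity of \<open>t \<mapsto> t\<^sup>p\<close>, applied to the convex
  combination of \<open>\<bar>f\<bar> / \<parallel>f\<parallel>\<close> and \<open>\<bar>g\<bar> / \<parallel>g\<parallel>\<close> with weights proportional to the norms.\<close>

lemma Lp_norm_triangle: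
  assumes f: "f \<in> Lp M" and g: "g \<in> Lp M"
  shows "nrm M (\<lambda>x. f x + g x) \<le> nrm M f + nrm M g"
proof -
  note [measurable] = Lp_funD(1)[OF f] Lp_funD(1)[OF g]
  define a b where "a = nrm M f" and "b = nrm M g"
  consider "a = 0" | "b = 0" | "0 < a" "0 < b"
    using Lp_norm_nonneg[of M f] Lp_norm_nonneg[of M g] unfolding a_def b_def by linarith
  then show ?thesis
  proof cases
    case 1
    then have "AE x in M. f x = 0" using Lp_norm_eq_0[OF f] a_def by simp
    then have "AE x in M. f x + g x = g x" by eventually_elim simp
    then have "nrm M (\<lambda>x. f x + g x) = nrm M g" by (intro Lp_norm_cong_AE) auto
    then show ?thesis using Lp_norm_nonneg[of M f] by simp
  next
    case 2
    then have "AE x in M. g x = 0" using Lp_norm_eq_0[OF g] b_def by simp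
    then have "AE x in M. f x + g x = f x" by eventually_elim simp
    then have "nrm M (\<lambda>x. f x + g x) = nrm M f" by (intro Lp_norm_cong_AE) auto
    then show ?thesis using Lp_norm_nonneg[of M g] by simp
  next
    case 3
    let ?s = "a / (a + b)" and ?t = "b / (a + b)"
    have st: "?s + ?t = 1" using 3 by (simp add: add_divide_distrib[symmetric])
    let ?h = "\<lambda>x. (a + b) powr p * (?s * (cmod (f x) powr p / a powr p) + ?t * (cmod (g x) powr p / b powr p))"
    have pt: "cmod (f x + g x) powr p \<le> ?h x" for x
    proof -
      have "cmod (f x + g x) powr p \<le> (cmod (f x) + cmod (g x)) powr p"
        using p_ge_1 by (intro powr_mono2 norm_triangle_ineq) auto
      also have "cmod (f x) + cmod (g x) = (a + b) * (?s * (cmod (f x) / a) + ?t * (cmod (g x) / b))"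
        using 3 by (simp add: distrib_left)
      also have "\<dots> powr p = (a + b) powr p * (?s * (cmod (f x) / a) + ?t * (cmod (g x) / b)) powr p"
        using 3 by (simp add: powr_mult)
      also have "\<dots> \<le> (a + b) powr p * (?s * (cmod (f x) / a) powr p + ?t * (cmod (g x) / b) powr p)"
        using 3 st by (intro mult_left_mono powr_convex_combination) auto
      also have "\<dots> = ?h x" using 3 by (simp add: powr_divide)
      finally show ?thesis .
    qed
    have int: "integrable M ?h" using Lp_funD(2)[OF f] Lp_funD(2)[OF g] by auto
    have "(\<integral>x. cmod (f x + g x) powr p \<partial>M) \<le> (\<integral>x. ?h x \<partial>M)"
      by (rule integral_mono_AE'[OF int]) (use pt 3 in \<open>auto intro!: AE_I2 mult_nonneg_nonneg add_nonneg_nonneg\<close>)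
    also have "\<dots> = (a + b) powr p * (?s * (a powr p / a powr p) + ?t * (b powr p / b powr p))"
      using Lp_funD(2)[OF f] Lp_funD(2)[OF g] unfolding a_def b_def Lp_norm_powr by simp
    also have "\<dots> = (a + b) powr p" using 3 st by simp
    finally have "nrm M (\<lambda>x. f x + g x) \<le> a + b" using 3 by (subst Lp_norm_le_iff) auto
    then show ?thesis by (simp add: a_def b_def)
  qed
qed

lemma Lp_norm_sum_le:
  assumes "finite I" "\<And>i. i \<in> I \<Longrightarrow> f i \<in> Lp M"
  shows "nrm M (\<lambda>x. \<Sum>i\<in>I. f i x) \<le> (\<Sum>i\<in>I. nrm M (f i))"
  using assms
proof (induction I)
  case (insert i I)
  then have "nrm M (\<lambda>x. f i x + (\<Sum>i\<in>I. f i x)) \<le> nrm M (f i) + nrm M (\<lambda>x. \<Sum>i\<in>I. f i x)"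
    by (intro Lp_norm_triangle Lp_fun_sum) auto
  with insert show ?case by simp
qed (simp add: Lp_norm_zero)

lemma equiv_Lp_rel: "equiv (Lp M) (Lp_rel p M)"
proof (rule equivI)
  show "trans (Lp_rel p M)"
  proof (rule transI)
    fix f g h assume "(f, g) \<in> Lp_rel p M" "(g, h) \<in> Lp_rel p M"
    then have "f \<in> Lp M" "h \<in> Lp M" "AE x in M. f x = g x" "AE x in M. g x = h x"
      by (auto simp: Lp_rel_def)
    moreover have "AE x in M. f x = h x" using calculation(3,4) by eventually_elim simp
    ultimately show "(f, h) \<in> Lp_rel p M" by (auto simp: Lp_rel_def)
  qed
qed (auto simp: Lp_rel_def refl_on_def sym_def)

lemma carr_Lp: "carr (Lp_space p M) = Lp M // Lp_rel p M" by (simp add: Lp_space_def)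

lemma Lp_class_in: "f \<in> Lp M \<Longrightarrow> cls M f \<in> carr (Lp_space p M)"
  unfolding carr_Lp Lp_class_def by (rule quotientI)

lemma Lp_class_eq_iff:
  assumes "f \<in> Lp M" "g \<in> Lp M"
  shows "cls M f = cls M g \<longleftrightarrow> (AE x in M. f x = g x)"
  unfolding Lp_class_def using eq_equiv_class_iff[OF equiv_Lp_rel assms] assms by (simp add: Lp_rel_def)

lemma Lp_class_rep: "f \<in> Lp M \<Longrightarrow> Lp_rep (cls M f) \<in> Lp M"
  and Lp_class_rep_AE: "f \<in> Lp M \<Longrightarrow> AE x in M. Lp_rep (cls M f) x = f x"
proof -
  assume f: "f \<in> Lp M"
  have "Lp_rep (cls M f) \<in> cls M f"
    unfolding Lp_rep_def by (rule someI[of _ f]) (use f in \<open>auto simp: Lp_class_def Lp_rel_def\<close>)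
  then show "Lp_rep (cls M f) \<in> Lp M" "AE x in M. Lp_rep (cls M f) x = f x"
    by (auto simp: Lp_class_def Lp_rel_def elim: eventually_mono)
qed

lemma carr_LpE:
  assumes "\<xi> \<in> carr (Lp_space p M)"
  obtains f where "f \<in> Lp M" "\<xi> = cls M f"
  using assms unfolding carr_Lp Lp_class_def by (auto elim: quotientE)

lemma Lp_rep_in: "\<xi> \<in> carr (Lp_space p M) \<Longrightarrow> Lp_rep \<xi> \<in> Lp M"
  by (auto elim!: carr_LpE intro: Lp_class_rep)

lemma Lp_class_of_rep:
  assumes "\<xi> \<in> carr (Lp_space p M)"
  shows "cls M (Lp_rep \<xi>) = \<xi>"
proof -
  obtain f where f: "f \<in> Lp M" "\<xi> = cls M f" using carr_LpE[OF assms] .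
  then show ?thesis using Lp_class_eq_iff[OF Lp_class_rep[OF f(1)] f(1)] Lp_class_rep_AE[OF f(1)] by simp
qed

lemma norm_of_Lp: "norm_of (Lp_space p M) \<xi> = nrm M (Lp_rep \<xi>)"
  by (simp add: Lp_space_def Lp_norm_def)

lemma norm_of_Lp_class: "f \<in> Lp M \<Longrightarrow> norm_of (Lp_space p M) (cls M f) = nrm M f"
  unfolding norm_of_Lp by (intro Lp_norm_cong_AE Lp_funD(1) Lp_class_rep Lp_class_rep_AE)

lemma add_of_Lp_class:
  assumes "f \<in> Lp M" "g \<in> Lp M"
  shows "add_of (Lp_space p M) (cls M f) (cls M g) = cls M (\<lambda>x. f x + g x)"
proof -
  have "AE x in M. Lp_rep (cls M f) x + Lp_rep (cls M g) x = f x + g x"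
    using Lp_class_rep_AE[OF assms(1)] Lp_class_rep_AE[OF assms(2)] by eventually_elim simp
  then show ?thesis using assms by (simp add: Lp_space_def Lp_class_eq_iff Lp_fun_add Lp_class_rep)
qed

lemma scale_of_Lp_class:
  assumes "f \<in> Lp M"
  shows "scale_of (Lp_space p M) c (cls M f) = cls M (\<lambda>x. c * f x)"
proof -
  have "AE x in M. c * Lp_rep (cls M f) x = c * f x"
    using Lp_class_rep_AE[OF assms(1)] by eventually_elim simp
  then show ?thesis using assms by (simp add: Lp_space_def Lp_class_eq_iff Lp_fun_scale Lp_class_rep)
qed

lemma zero_of_Lp: "zero_of (Lp_space p M) = cls M (\<lambda>x. 0)" by (simp add: Lp_space_def)

lemmas Lp_class_ops = add_of_Lp_class scale_of_Lp_class norm_of_Lp_class zero_of_Lp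
  Lp_fun_add Lp_fun_scale Lp_fun_zero Lp_class_in

lemma complex_normed_space_Lp: "complex_normed_space (Lp_space p M)"
proof (unfold_locales, goal_cases)
  case (2 x y) then show ?case by (auto elim!: carr_LpE simp: Lp_class_ops)
next
  case (4 x y z) then show ?case by (auto elim!: carr_LpE simp: Lp_class_ops add.assoc)
next
  case (5 x y) then show ?case by (auto elim!: carr_LpE simp: Lp_class_ops add.commute)
next
  case (7 x)
  then obtain f where f: "f \<in> Lp M" "x = cls M f" using carr_LpE by blast
  then show ?case using Lp_fun_scale[OF f(1), of "-1"] by (simp add: add_of_Lp_class scale_of_Lp_class zero_of_Lp)
next
  case (9 x b c) then show ?case by (auto elim!: carr_LpE simp: Lp_class_ops mult.assoc)
next
  case (13 x)
  then obtain f where f: "f \<in> Lp M" "x = cls M f" using carr_LpE by blast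
  then show ?case using Lp_norm_eq_0[OF f(1)] by (simp add: Lp_class_ops Lp_class_eq_iff)
qed (auto elim!: carr_LpE simp: Lp_class_ops algebra_simps Lp_norm_nonneg Lp_norm_scale Lp_norm_triangle)

section \<open>Orthogonality from contractive rotations\<close>

text \<open>The derivative of \<open>\<parallel>v\<parallel>\<^sup>p\<close> in the direction \<open>\<zeta>\<close> is \<open>p Re \<integral> J(v) \<zeta>\<close>, where \<open>J\<close> is the
  following map. At \<open>0\<close> its value is \<open>0\<close>, also when \<open>p < 2\<close>.\<close>

definition duality_map :: "complex \<Rightarrow> complex" where
  "duality_map a = of_real (cmod a powr (p - 2)) * cnj a"

lemma duality_map_mult: "duality_map (a * b) = duality_map a * duality_map b"
  by (simp add: duality_map_def norm_mult powr_mult)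

lemma duality_map_eq_0_iff [simp]: "duality_map a = 0 \<longleftrightarrow> a = 0"
  by (simp add: duality_map_def)

lemma norm_duality_map: "cmod (duality_map a) = cmod a powr (p - 1)"
proof (cases "a = 0")
  case False
  then have "cmod a powr (p - 2) * cmod a = cmod a powr (p - 1)"
    using powr_mult_base[of "cmod a" "p - 2"] by (simp add: mult.commute)
  then show ?thesis by (simp add: duality_map_def norm_mult)
qed (simp add: duality_map_def)

lemma norm_duality_map_mult_le: "cmod (duality_map a * b) \<le> (cmod a + cmod b) powr p"
proof -
  have "cmod (duality_map a * b) \<le> (cmod a + cmod b) powr (p - 1) * (cmod a + cmod b)"
    unfolding norm_mult norm_duality_map using p_ge_1 by (intro mult_mono powr_mono2) auto
  also have "\<dots> = (cmod a + cmod b) powr p"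
    using powr_mult_base[of "cmod a + cmod b" "p - 1"] by (simp add: mult.commute)
  finally show ?thesis .
qed

text \<open>The derivative of \<open>t \<mapsto> \<bar>a + t b\<bar>\<^sup>p\<close> at \<open>0\<close>, for a convex function: the tangent of
  \<open>t \<mapsto> t\<^sup>p\<close> at \<open>\<bar>a\<bar>\<close>, together with \<open>Re (a\<^sup>* (a + b)) \<le> \<bar>a\<bar> \<bar>a + b\<bar>\<close>.\<close>

lemma duality_map_subgradient:
  "cmod a powr p + p * Re (duality_map a * b) \<le> cmod (a + b) powr p"
proof (cases "a = 0")
  case False
  then have a: "0 < cmod a" by simp
  have *: "Re (cnj a * b) \<le> cmod a * (cmod (a + b) - cmod a)"
  proof -
    have "cnj a * b = cnj a * (a + b) - of_real ((cmod a)\<^sup>2)"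
      by (simp add: algebra_simps complex_norm_square del: of_real_power)
    then have "Re (cnj a * b) = Re (cnj a * (a + b)) - (cmod a)\<^sup>2" by simp
    also have "Re (cnj a * (a + b)) \<le> cmod a * cmod (a + b)"
      using complex_Re_le_cmod[of "cnj a * (a + b)"] by (simp only: norm_mult complex_mod_cnj)
    finally show ?thesis by (simp add: algebra_simps power2_eq_square)
  qed
  have "p * Re (duality_map a * b) = p * (cmod a powr (p - 2) * Re (cnj a * b))"
    by (simp add: duality_map_def algebra_simps)
  also have "\<dots> \<le> p * (cmod a powr (p - 2) * (cmod a * (cmod (a + b) - cmod a)))"
    using * p_pos by (intro mult_left_mono) auto
  also have "\<dots> = p * cmod a powr (p - 1) * (cmod (a + b) - cmod a)"
    using powr_mult_base[of "cmod a" "p - 2"] by (simp add: mult_ac)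
  also have "\<dots> \<le> cmod (a + b) powr p - cmod a powr p"
    using powr_tangent[OF a, of "cmod (a + b)"] by simp
  finally show ?thesis by simp
qed (simp add: duality_map_def)

lemma duality_map_measurable [measurable]: "duality_map \<in> borel_measurable borel"
proof -
  have [measurable]: "cnj \<in> borel_measurable borel"
    by (intro borel_measurable_continuous_onI continuous_intros)
  show ?thesis unfolding duality_map_def[abs_def] by measurable
qed

lemma isCont_duality_map: "a \<noteq> 0 \<Longrightarrow> isCont duality_map a"
  unfolding duality_map_def[abs_def] by (intro continuous_intros) auto

lemma integrable_duality_map:
  assumes "v \<in> Lp M" "\<zeta> \<in> Lp M"
  shows "integrable M (\<lambda>x. duality_map (v x) * \<zeta> x)"
proof (rule Bochner_Integration.integrable_bound)
  note [measurable] = assms[THEN Lp_funD(1)]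
  show "(\<lambda>x. duality_map (v x) * \<zeta> x) \<in> borel_measurable M" by measurable
  have 1: "(\<lambda>x. of_real (cmod (v x))) \<in> Lp M" "(\<lambda>x. of_real (cmod (\<zeta> x))) \<in> Lp M"
    using assms by (auto simp: Lp_fun_def)
  show "integrable M (\<lambda>x. (cmod (v x) + cmod (\<zeta> x)) powr p)"
    using Lp_funD(2)[OF Lp_fun_add[OF 1]] by (simp flip: of_real_add)
  show "AE x in M. norm (duality_map (v x) * \<zeta> x) \<le> norm ((cmod (v x) + cmod (\<zeta> x)) powr p)"
    using norm_duality_map_mult_le by (intro AE_I2) auto
qed

lemma integral_subgradient:
  assumes "v \<in> Lp M" "\<zeta> \<in> Lp M"
  shows "(\<integral>x. cmod (v x) powr p \<partial>M) + p * Re (\<integral>x. duality_map (v x) * \<zeta> x \<partial>M)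
    \<le> (\<integral>x. cmod (v x + \<zeta> x) powr p \<partial>M)"
proof -
  note i = Lp_funD(2)[OF assms(1)] Lp_funD(2)[OF Lp_fun_add[OF assms]] integrable_duality_map[OF assms]
  have "(\<integral>x. cmod (v x) powr p \<partial>M) + p * Re (\<integral>x. duality_map (v x) * \<zeta> x \<partial>M)
     = (\<integral>x. cmod (v x) powr p + p * Re (duality_map (v x) * \<zeta> x) \<partial>M)"
    using i by (simp del: times_complex.sel)
  also have "\<dots> \<le> (\<integral>x. cmod (v x + \<zeta> x) powr p \<partial>M)"
    using i by (intro integral_mono duality_map_subgradient) (auto simp del: times_complex.sel)
  finally show ?thesis .
qed

text \<open>If \<open>\<parallel>v' + t \<rho>\<parallel> \<le> \<parallel>v + t \<zeta>\<parallel>\<close> for \<open>t > 0\<close>, with equality at \<open>t = 0\<close>, then the derivatives at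
  \<open>0\<close> compare in the same way. Applying the subgradient inequality on the right at \<open>v + t \<zeta>\<close> instead
  of \<open>v\<close> avoids difference quotients; \<open>t \<rightarrow> 0\<close> is then dominated convergence. Since \<open>J\<close> is not
  continuous at \<open>0\<close> when \<open>p = 1\<close>, the direction \<open>\<zeta>\<close> has to vanish where \<open>v\<close> does.\<close>

lemma directional_derivative_le:
  assumes v: "v \<in> Lp M" and \<zeta>: "\<zeta> \<in> Lp M"
    and v': "v' \<in> Lp M" and \<rho>: "\<rho> \<in> Lp M"
    and vanish: "\<And>x. v x = 0 \<Longrightarrow> \<zeta> x = 0"
    and base: "nrm M v \<le> nrm M v'"
    and le: "\<And>t::real. 0 < t \<Longrightarrow> nrm M (\<lambda>x. v' x + of_real t * \<rho> x) \<le> nrm M (\<lambda>x. v x + of_real t * \<zeta> x)"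
  shows "Re (\<integral>x. duality_map (v' x) * \<rho> x \<partial>M) \<le> Re (\<integral>x. duality_map (v x) * \<zeta> x \<partial>M)"
proof -
  note [measurable] = v[THEN Lp_funD(1)] \<zeta>[THEN Lp_funD(1)]
  let ?I = "\<lambda>t::real. \<integral>x. duality_map (v x + of_real t * \<zeta> x) * \<zeta> x \<partial>M"
  have norms: "nrm M f \<le> nrm M g \<Longrightarrow> (\<integral>x. cmod (f x) powr p \<partial>M) \<le> (\<integral>x. cmod (g x) powr p \<partial>M)" for f g
    unfolding Lp_norm_powr[symmetric] using p_pos Lp_norm_nonneg by (intro powr_mono2) auto
  have *: "Re (\<integral>x. duality_map (v' x) * \<rho> x \<partial>M) \<le> Re (?I t)" if t: "0 < t" for t
  proof -
    have "(\<integral>x. cmod (v' x) powr p \<partial>M) + p * (t * Re (\<integral>x. duality_map (v' x) * \<rho> x \<partial>M))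
        \<le> (\<integral>x. cmod (v' x + of_real t * \<rho> x) powr p \<partial>M)"
      using integral_subgradient[OF v' Lp_fun_scale[OF \<rho>, of "of_real t"]] by (simp add: mult.left_commute)
    also have "\<dots> \<le> (\<integral>x. cmod (v x + of_real t * \<zeta> x) powr p \<partial>M)" using norms[OF le[OF t]] .
    also have "\<dots> \<le> (\<integral>x. cmod (v x) powr p \<partial>M) + p * (t * Re (?I t))"
      using integral_subgradient[OF Lp_fun_add[OF v Lp_fun_scale[OF \<zeta>, of "of_real t"]] Lp_fun_scale[OF \<zeta>, of "- of_real t"]]
      by (simp add: mult.left_commute)
    also have "\<dots> \<le> (\<integral>x. cmod (v' x) powr p \<partial>M) + p * (t * Re (?I t))" using norms[OF base] by simp
    finally show ?thesis using t p_pos by simp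
  qed
  have "(\<lambda>n. ?I (inverse (real (Suc n)))) \<longlonglongrightarrow> (\<integral>x. duality_map (v x) * \<zeta> x \<partial>M)"
  proof (rule integral_dominated_convergence)
    have 1: "(\<lambda>x. of_real (cmod (v x))) \<in> Lp M" "(\<lambda>x. of_real (2 * cmod (\<zeta> x))) \<in> Lp M"
      using v Lp_fun_scale[OF \<zeta>, of 2] by (auto simp: Lp_fun_def norm_mult)
    show "integrable M (\<lambda>x. (cmod (v x) + 2 * cmod (\<zeta> x)) powr p)"
      using Lp_funD(2)[OF Lp_fun_add[OF 1]] by (simp only: norm_of_real flip: of_real_add) simp
    show "AE x in M. (\<lambda>n. duality_map (v x + of_real (inverse (real (Suc n))) * \<zeta> x) * \<zeta> x)
        \<longlonglongrightarrow> duality_map (v x) * \<zeta> x"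
    proof (rule AE_I2)
      fix x
      show "(\<lambda>n. duality_map (v x + of_real (inverse (real (Suc n))) * \<zeta> x) * \<zeta> x) \<longlonglongrightarrow> duality_map (v x) * \<zeta> x"
      proof (cases "\<zeta> x = 0")
        case False
        with vanish have "v x \<noteq> 0" by blast
        have "(\<lambda>n. v x + of_real (inverse (real (Suc n))) * \<zeta> x) \<longlonglongrightarrow> v x + of_real 0 * \<zeta> x"
          by (intro tendsto_intros LIMSEQ_inverse_real_of_nat)
        then have "(\<lambda>n. v x + of_real (inverse (real (Suc n))) * \<zeta> x) \<longlonglongrightarrow> v x" by simp
        from isCont_tendsto_compose[OF isCont_duality_map[OF \<open>v x \<noteq> 0\<close>] this]
        show ?thesis by (rule tendsto_mult_right)
      qed simp
    qed
    show "AE x in M. norm (duality_map (v x + of_real (inverse (real (Suc n))) * \<zeta> x) * \<zeta> x)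
        \<le> (cmod (v x) + 2 * cmod (\<zeta> x)) powr p" for n
    proof (rule AE_I2)
      fix x
      have "cmod (of_real (inverse (real (Suc n))) * \<zeta> x) \<le> 1 * cmod (\<zeta> x)"
        unfolding norm_mult norm_of_real by (intro mult_right_mono) (auto simp: inverse_eq_divide)
      then have "cmod (v x + of_real (inverse (real (Suc n))) * \<zeta> x) + cmod (\<zeta> x) \<le> cmod (v x) + 2 * cmod (\<zeta> x)"
        using norm_triangle_ineq[of "v x" "of_real (inverse (real (Suc n))) * \<zeta> x"] by linarith
      then show "norm (duality_map (v x + of_real (inverse (real (Suc n))) * \<zeta> x) * \<zeta> x)
          \<le> (cmod (v x) + 2 * cmod (\<zeta> x)) powr p"
        by (intro order_trans[OF norm_duality_map_mult_le] powr_mono2) (use p_pos in auto)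
    qed
  qed measurable
  then have "(\<lambda>n. Re (?I (inverse (real (Suc n))))) \<longlonglongrightarrow> Re (\<integral>x. duality_map (v x) * \<zeta> x \<partial>M)"
    by (rule tendsto_Re)
  then show ?thesis
    by (rule LIMSEQ_le_const) (intro exI allI impI *, simp)
qed

abbreviation fourth_roots :: "complex set" where "fourth_roots \<equiv> {1, -1, \<i>, -\<i>}"

lemma sum_fourth_roots: "(\<Sum>z\<in>fourth_roots. f z) = f 1 + f (-1) + f \<i> + f (-\<i>)" for f :: "complex \<Rightarrow> complex"
  by (simp add: complex_eq_iff add.assoc)

text \<open>The vectors \<open>\<rho>1\<close> and \<open>\<rho>2\<close> stand for \<open>T\<^sub>1 \<zeta>\<close> and \<open>T\<^sub>2 \<zeta>\<close>. The two conditions on \<open>c\<close> say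
  that \<open>c\<close> annihilates affine functions of \<open>z\<close>, so the comparison of derivatives for the directions
  \<open>c z * \<zeta>\<close> adds up to \<open>0 \<le> Re \<integral> G \<zeta>\<close>, where \<open>G\<close> is the sum in the conclusion. Where
  \<open>\<bar>u\<bar> \<noteq> \<bar>w\<bar>\<close> none of the four functions \<open>u + cnj z * w\<close> vanishes, so \<open>\<zeta>\<close> may be chosen with
  \<open>G \<zeta> = - \<bar>G\<bar> (\<bar>u\<bar> + \<bar>w\<bar>)\<close> there and \<open>\<zeta> = 0\<close> elsewhere.\<close>

lemma fourth_roots_relation:
  fixes c :: "complex \<Rightarrow> complex"
  assumes u: "u \<in> Lp M" and w: "w \<in> Lp M"
    and base: "\<And>z. z \<in> fourth_roots \<Longrightarrow> nrm M (\<lambda>x. u x + cnj z * w x) \<le> nrm M (\<lambda>x. u x + w x)"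
    and contr: "\<And>\<zeta>. \<zeta> \<in> Lp M \<Longrightarrow> \<exists>\<rho>1\<in>Lp M. \<exists>\<rho>2\<in>Lp M. \<forall>z\<in>fourth_roots. \<forall>b.
        nrm M (\<lambda>x. u x + w x + b * (\<rho>1 x + z * \<rho>2 x)) \<le> nrm M (\<lambda>x. u x + cnj z * w x + b * \<zeta> x)"
    and c0: "(\<Sum>z\<in>fourth_roots. c z) = 0" and c1: "(\<Sum>z\<in>fourth_roots. c z * z) = 0"
  shows "AE x in M. cmod (u x) \<noteq> cmod (w x) \<longrightarrow> (\<Sum>z\<in>fourth_roots. c z * duality_map (u x + cnj z * w x)) = 0"
proof -
  note [measurable] = u[THEN Lp_funD(1)] w[THEN Lp_funD(1)]
  have [measurable]: "cnj \<in> borel_measurable borel"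
    by (intro borel_measurable_continuous_onI continuous_intros)
  define G where "G x = (\<Sum>z\<in>fourth_roots. c z * duality_map (u x + cnj z * w x))" for x
  define \<zeta> where "\<zeta> x = (if cmod (u x) \<noteq> cmod (w x)
      then - (cnj (G x) / of_real (cmod (G x))) * of_real (cmod (u x) + cmod (w x)) else 0)" for x
  have Gm [measurable]: "G \<in> borel_measurable M" unfolding G_def[abs_def] by measurable
  have \<zeta>: "\<zeta> \<in> Lp M"
  proof (rule Lp_fun_dominated)
    show "\<zeta> \<in> borel_measurable M" unfolding \<zeta>_def[abs_def] by measurable
    have "(\<lambda>x. of_real (cmod (u x))) \<in> Lp M" "(\<lambda>x. of_real (cmod (w x))) \<in> Lp M"
      using u w by (auto simp: Lp_fun_def)
    then show "(\<lambda>x. of_real (cmod (u x)) + of_real (cmod (w x))) \<in> Lp M" by (rule Lp_fun_add)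
    show "cmod (\<zeta> x) \<le> cmod (of_real (cmod (u x)) + of_real (cmod (w x)))" for x
      unfolding of_real_add[symmetric] norm_of_real
      by (auto simp: \<zeta>_def norm_mult norm_divide simp del: of_real_add)
  qed
  obtain \<rho>1 \<rho>2 where \<rho>: "\<rho>1 \<in> Lp M" "\<rho>2 \<in> Lp M"
    and le: "\<And>z b. z \<in> fourth_roots \<Longrightarrow> nrm M (\<lambda>x. u x + w x + b * (\<rho>1 x + z * \<rho>2 x))
      \<le> nrm M (\<lambda>x. u x + cnj z * w x + b * \<zeta> x)"
    using contr[OF \<zeta>] by blast
  note uw = Lp_fun_add[OF u w]
  let ?J = "\<lambda>f g. \<integral>x. duality_map (f x) * g x \<partial>M"
  let ?v = "\<lambda>z x. u x + cnj z * w x"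
  have v: "?v z \<in> Lp M" for z using Lp_fun_add[OF u Lp_fun_scale[OF w]] .
  have "Re (?J (\<lambda>x. u x + w x) (\<lambda>x. c z * (\<rho>1 x + z * \<rho>2 x))) \<le> Re (?J (?v z) (\<lambda>x. c z * \<zeta> x))"
    if z: "z \<in> fourth_roots" for z
  proof (rule directional_derivative_le[OF v Lp_fun_scale[OF \<zeta>] uw])
    show "(\<lambda>x. c z * (\<rho>1 x + z * \<rho>2 x)) \<in> Lp M" using \<rho> by (intro Lp_fun_scale Lp_fun_add)
    show "nrm M (?v z) \<le> nrm M (\<lambda>x. u x + w x)" using base[OF z] .
    fix x assume "?v z x = 0"
    then have "cmod (u x) = cmod (- (cnj z * w x))" by (simp add: add_eq_0_iff2)
    also have "\<dots> = cmod (w x)" using z by (auto simp: norm_mult)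
    finally show "c z * \<zeta> x = 0" by (simp add: \<zeta>_def)
  next
    fix t :: real
    show "nrm M (\<lambda>x. u x + w x + of_real t * (c z * (\<rho>1 x + z * \<rho>2 x)))
       \<le> nrm M (\<lambda>x. u x + cnj z * w x + of_real t * (c z * \<zeta> x))"
      using le[OF z, of "of_real t * c z"] by (simp add: mult.assoc)
  qed
  then have "(\<Sum>z\<in>fourth_roots. Re (?J (\<lambda>x. u x + w x) (\<lambda>x. c z * (\<rho>1 x + z * \<rho>2 x))))
     \<le> (\<Sum>z\<in>fourth_roots. Re (?J (?v z) (\<lambda>x. c z * \<zeta> x)))" by (rule sum_mono)
  moreover have "?J (\<lambda>x. u x + w x) (\<lambda>x. c z * (\<rho>1 x + z * \<rho>2 x))
      = c z * ?J (\<lambda>x. u x + w x) \<rho>1 + c z * z * ?J (\<lambda>x. u x + w x) \<rho>2" for z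
  proof -
    have "?J (\<lambda>x. u x + w x) (\<lambda>x. c z * (\<rho>1 x + z * \<rho>2 x)) =
       (\<integral>x. c z * (duality_map (u x + w x) * \<rho>1 x) + (c z * z) * (duality_map (u x + w x) * \<rho>2 x) \<partial>M)"
      by (simp add: algebra_simps)
    also have "\<dots> = c z * ?J (\<lambda>x. u x + w x) \<rho>1 + c z * z * ?J (\<lambda>x. u x + w x) \<rho>2"
      using integrable_duality_map[OF uw \<rho>(1)] integrable_duality_map[OF uw \<rho>(2)]
      by (subst Bochner_Integration.integral_add) auto
    finally show ?thesis .
  qed
  then have "(\<Sum>z\<in>fourth_roots. Re (?J (\<lambda>x. u x + w x) (\<lambda>x. c z * (\<rho>1 x + z * \<rho>2 x))))
     = Re ((\<Sum>z\<in>fourth_roots. c z) * ?J (\<lambda>x. u x + w x) \<rho>1 + (\<Sum>z\<in>fourth_roots. c z * z) * ?J (\<lambda>x. u x + w x) \<rho>2)"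
    by (simp only: Re_sum[symmetric] sum.distrib sum_distrib_right)
  moreover have "(\<Sum>z\<in>fourth_roots. Re (?J (?v z) (\<lambda>x. c z * \<zeta> x))) = Re (\<integral>x. G x * \<zeta> x \<partial>M)"
  proof -
    have "(\<integral>x. G x * \<zeta> x \<partial>M) = (\<integral>x. (\<Sum>z\<in>fourth_roots. duality_map (?v z x) * (c z * \<zeta> x)) \<partial>M)"
      unfolding G_def sum_distrib_right by (simp only: mult_ac)
    also have "\<dots> = (\<Sum>z\<in>fourth_roots. ?J (?v z) (\<lambda>x. c z * \<zeta> x))"
      by (intro Bochner_Integration.integral_sum integrable_duality_map v Lp_fun_scale \<zeta>)
    finally show ?thesis by (simp only: Re_sum)
  qed
  ultimately have ge: "0 \<le> Re (\<integral>x. G x * \<zeta> x \<partial>M)" using c0 c1 by simp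
  define H where "H x = (if cmod (u x) \<noteq> cmod (w x) then cmod (G x) * (cmod (u x) + cmod (w x)) else 0)" for x
  have GG: "G x * (cnj (G x) / of_real (cmod (G x))) = of_real (cmod (G x))" for x
    by (cases "G x = 0") (simp_all add: field_simps flip: complex_norm_square power2_eq_square)
  have GH: "G x * \<zeta> x = - of_real (H x)" for x
  proof (cases "cmod (u x) = cmod (w x)")
    case False
    then have "G x * \<zeta> x = - (G x * (cnj (G x) / of_real (cmod (G x)))) * of_real (cmod (u x) + cmod (w x))"
      by (simp add: \<zeta>_def)
    then show ?thesis unfolding GG using False by (simp add: H_def)
  qed (simp add: H_def \<zeta>_def)
  have "integrable M (\<lambda>x. G x * \<zeta> x)"
  proof -
    have "integrable M (\<lambda>x. \<Sum>z\<in>fourth_roots. duality_map (?v z x) * (c z * \<zeta> x))"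
      by (intro Bochner_Integration.integrable_sum integrable_duality_map v Lp_fun_scale \<zeta>)
    then show ?thesis unfolding G_def sum_distrib_right by (simp only: mult_ac)
  qed
  then have "integrable M (\<lambda>x. Re (- (G x * \<zeta> x)))" by (intro integrable_Re Bochner_Integration.integrable_minus)
  then have Hi: "integrable M H" unfolding GH by simp
  have "(\<integral>x. G x * \<zeta> x \<partial>M) = of_real (- (\<integral>x. H x \<partial>M))" unfolding GH by simp
  with ge have "(\<integral>x. H x \<partial>M) \<le> 0" by simp
  moreover have H0: "0 \<le> H x" for x by (simp add: H_def)
  moreover have "0 \<le> (\<integral>x. H x \<partial>M)" using H0 by simp
  ultimately have "(\<integral>x. H x \<partial>M) = 0" by linarith
  then have "AE x in M. H x = 0"
    using integral_nonneg_eq_0_iff_AE[OF Hi] H0 by blast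
  then show ?thesis
  proof eventually_elim
    case (elim x)
    then show ?case unfolding G_def[symmetric] by (auto simp: H_def split: if_splits simp: add_nonneg_eq_0_iff)
  qed
qed

text \<open>The map \<open>J\<close> is multiplicative, so only the ratio \<open>s = w / u\<close> matters. In terms of the four
  numbers \<open>A, B, C, D = \<bar>1 + \<epsilon> s\<bar>\<^bsup>p-2\<^esup>\<close> for \<open>\<epsilon> = 1, -1, -\<i>, \<i>\<close> the relations read
  \<open>P + q s\<^sup>* = 0\<close> and \<open>q\<^sup>* + P s\<^sup>* = 0\<close> with \<open>P\<close> real, whence \<open>P (1 - \<bar>s\<bar>\<^sup>2) = 0\<close>. As
  \<open>\<bar>s\<bar> \<noteq> 1\<close>, this gives \<open>P = q = 0\<close>; all four moduli agree because \<open>p \<noteq> 2\<close>, and \<open>s = 0\<close>.\<close>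

lemma fourth_roots_rigidity:
  assumes p2: "p \<noteq> 2" and ne: "cmod u \<noteq> cmod w"
    and r1: "duality_map (u + w) + duality_map (u - w) - duality_map (u - \<i> * w) - duality_map (u + \<i> * w) = 0"
    and r2: "duality_map (u + w) - duality_map (u - w) + \<i> * duality_map (u - \<i> * w) - \<i> * duality_map (u + \<i> * w) = 0"
  shows "u * w = 0"
proof (rule ccontr)
  assume "u * w \<noteq> 0"
  then have u: "u \<noteq> 0" and w: "w \<noteq> 0" by auto
  define s where "s = w / u"
  have ws: "w = u * s" using u by (simp add: s_def)
  have s1: "cmod s \<noteq> 1" using ne u by (simp add: s_def norm_divide)
  have s0: "s \<noteq> 0" using u w by (simp add: s_def)
  have fac: "u + w = u * (1 + s)" "u - w = u * (1 - s)" "u - \<i> * w = u * (1 - \<i> * s)" "u + \<i> * w = u * (1 + \<i> * s)"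
    by (simp_all add: ws algebra_simps)
  have Ju: "duality_map u \<noteq> 0" using u by simp
  have "duality_map u * (duality_map (1 + s) + duality_map (1 - s) - duality_map (1 - \<i> * s) - duality_map (1 + \<i> * s)) = 0"
    using r1 unfolding fac duality_map_mult by (simp add: algebra_simps)
  then have q1: "duality_map (1 + s) + duality_map (1 - s) - duality_map (1 - \<i> * s) - duality_map (1 + \<i> * s) = 0"
    using Ju by simp
  have "duality_map u * (duality_map (1 + s) - duality_map (1 - s) + \<i> * duality_map (1 - \<i> * s) - \<i> * duality_map (1 + \<i> * s)) = 0"
    using r2 unfolding fac duality_map_mult by (simp add: algebra_simps)
  then have q2: "duality_map (1 + s) - duality_map (1 - s) + \<i> * duality_map (1 - \<i> * s) - \<i> * duality_map (1 + \<i> * s) = 0"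
    using Ju by simp
  define A B C D where "A = cmod (1 + s) powr (p - 2)" and "B = cmod (1 - s) powr (p - 2)"
    and "C = cmod (1 - \<i> * s) powr (p - 2)" and "D = cmod (1 + \<i> * s) powr (p - 2)"
  define P where "P = complex_of_real (A + B - C - D)"
  define q where "q = complex_of_real (A - B) - \<i> * complex_of_real (C - D)"
  have e1: "P + q * cnj s = 0"
    using q1 unfolding duality_map_def A_def[symmetric] B_def[symmetric] C_def[symmetric] D_def[symmetric] P_def q_def
    by (simp add: algebra_simps)
  have e2: "cnj q + P * cnj s = 0"
    using q2 unfolding duality_map_def A_def[symmetric] B_def[symmetric] C_def[symmetric] D_def[symmetric] P_def q_def
    by (simp add: algebra_simps)
  have "cnj (cnj q + P * cnj s) = 0" unfolding e2 by simp
  then have q: "q = - P * s" by (auto simp: P_def complex_eq_iff algebra_simps)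
  have "P * (1 - s * cnj s) = 0" using e1 unfolding q by (simp add: algebra_simps)
  moreover have "1 - s * cnj s \<noteq> 0"
  proof
    assume "1 - s * cnj s = 0"
    then have "complex_of_real ((cmod s)\<^sup>2) = of_real 1" by (simp only: complex_norm_square) simp
    then have "(cmod s)\<^sup>2 = 1" by (simp only: of_real_eq_iff)
    with s1 show False by (simp add: power2_eq_1_iff) (metis norm_ge_zero not_one_le_zero neg_0_le_iff_le)
  qed
  ultimately have "P = 0" by simp
  with q have "q = 0" by simp
  have eqs: "A = B" "C = D" "A = D"
  proof -
    have "Re q = 0" "Im q = 0" using \<open>q = 0\<close> by auto
    then show "A = B" "C = D" by (auto simp: q_def)
    with \<open>P = 0\<close> show "A = D" by (simp add: P_def flip: of_real_add of_real_diff)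
  qed
  have nz: "1 + s \<noteq> 0" "1 - s \<noteq> 0" "1 - \<i> * s \<noteq> 0" "1 + \<i> * s \<noteq> 0"
  proof -
    have ne: "- 1 \<noteq> v" if "cmod v = cmod s" for v using s1 that by auto
    show "1 + s \<noteq> 0" using ne[of s] by (auto simp: add_eq_0_iff)
    show "1 - s \<noteq> 0" using ne[of "-s"] by auto
    show "1 - \<i> * s \<noteq> 0" using ne[of "-\<i> * s"] by (auto simp: norm_mult)
    show "1 + \<i> * s \<noteq> 0" using ne[of "\<i> * s"] by (auto simp: norm_mult add_eq_0_iff)
  qed
  have inj: "x = y" if "x powr (p - 2) = y powr (p - 2)" "0 < x" "0 < y" for x y :: real
  proof -
    have "(p - 2) * ln x = (p - 2) * ln y"
      using arg_cong[OF that(1), of ln] that(2,3) by (simp only: ln_powr)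
    then show ?thesis using p2 that(2,3) by simp
  qed
  have "cmod (1 + s) = cmod (1 - s)" "cmod (1 - \<i> * s) = cmod (1 + \<i> * s)"
    using eqs(1,2) nz unfolding A_def B_def C_def D_def by (blast intro: inj zero_less_norm_iff[THEN iffD2])+
  then have "(cmod (1 + s))\<^sup>2 = (cmod (1 - s))\<^sup>2" "(cmod (1 - \<i> * s))\<^sup>2 = (cmod (1 + \<i> * s))\<^sup>2" by simp_all
  then have "Re s = 0" "Im s = 0" unfolding cmod_power2 by (simp_all add: power2_eq_square algebra_simps)
  with s0 show False by (simp add: complex_eq_iff)
qed

text \<open>The relations only give information where \<open>\<bar>u\<bar> \<noteq> \<bar>w\<bar>\<close>. But the hypotheses also hold with
  \<open>2 w\<close> in place of \<open>w\<close>, and \<open>\<bar>u\<bar> = \<bar>w\<bar> = \<bar>2 w\<bar>\<close> only where \<open>u\<close> and \<open>w\<close> vanish.\<close>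

lemma disjoint_of_contractive_rotations:
  assumes p2: "p \<noteq> 2"
    and u: "u \<in> Lp M" and w: "w \<in> Lp M"
    and T1: "\<And>\<zeta>. \<zeta> \<in> Lp M \<Longrightarrow> T1 \<zeta> \<in> Lp M"
    and T2: "\<And>\<zeta>. \<zeta> \<in> Lp M \<Longrightarrow> T2 \<zeta> \<in> Lp M"
    and contr: "\<And>z \<zeta>. z \<in> fourth_roots \<Longrightarrow> \<zeta> \<in> Lp M \<Longrightarrow>
        nrm M (\<lambda>x. T1 \<zeta> x + z * T2 \<zeta> x) \<le> nrm M \<zeta>"
    and T1uw: "\<And>a b \<zeta>. \<zeta> \<in> Lp M \<Longrightarrow> AE x in M. T1 (\<lambda>x. u x + a * w x + b * \<zeta> x) x = u x + b * T1 \<zeta> x"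
    and T2uw: "\<And>a b \<zeta>. \<zeta> \<in> Lp M \<Longrightarrow> AE x in M. T2 (\<lambda>x. u x + a * w x + b * \<zeta> x) x = a * w x + b * T2 \<zeta> x"
  shows "AE x in M. u x * w x = 0"
proof -
  have rot: "nrm M (\<lambda>x. u x + z * a * w x + b * (T1 \<zeta> x + z * T2 \<zeta> x)) \<le> nrm M (\<lambda>x. u x + a * w x + b * \<zeta> x)"
    if z: "z \<in> fourth_roots" and \<zeta>: "\<zeta> \<in> Lp M" for z a b \<zeta>
  proof -
    have L: "(\<lambda>x. u x + a * w x + b * \<zeta> x) \<in> Lp M" by (intro Lp_fun_add Lp_fun_scale u w \<zeta>)
    have "nrm M (\<lambda>x. u x + z * a * w x + b * (T1 \<zeta> x + z * T2 \<zeta> x)) =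
       nrm M (\<lambda>x. T1 (\<lambda>x. u x + a * w x + b * \<zeta> x) x + z * T2 (\<lambda>x. u x + a * w x + b * \<zeta> x) x)"
    proof (rule Lp_norm_cong_AE)
      show "AE x in M. u x + z * a * w x + b * (T1 \<zeta> x + z * T2 \<zeta> x) =
        T1 (\<lambda>x. u x + a * w x + b * \<zeta> x) x + z * T2 (\<lambda>x. u x + a * w x + b * \<zeta> x) x"
        using T1uw[OF \<zeta>, of a b] T2uw[OF \<zeta>, of a b] by eventually_elim (simp add: algebra_simps)
    qed (intro Lp_funD(1) Lp_fun_add Lp_fun_scale u w T1 T2 \<zeta> L)+
    also have "\<dots> \<le> nrm M (\<lambda>x. u x + a * w x + b * \<zeta> x)" by (rule contr[OF z L])
    finally show ?thesis .
  qed
  have main: "AE x in M. cmod (u x) \<noteq> cmod (r * w x) \<longrightarrow> u x * (r * w x) = 0" for r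
  proof -
    note rel = fourth_roots_relation[OF u Lp_fun_scale[OF w, of r]]
    have base: "nrm M (\<lambda>x. u x + cnj z * (r * w x)) \<le> nrm M (\<lambda>x. u x + r * w x)"
      if "z \<in> fourth_roots" for z
      using rot[of "cnj z" "\<lambda>x. 0" r 0] that Lp_fun_zero by (auto simp: mult.assoc)
    have ex: "\<exists>\<rho>1\<in>Lp M. \<exists>\<rho>2\<in>Lp M. \<forall>z\<in>fourth_roots. \<forall>b.
        nrm M (\<lambda>x. u x + r * w x + b * (\<rho>1 x + z * \<rho>2 x)) \<le> nrm M (\<lambda>x. u x + cnj z * (r * w x) + b * \<zeta> x)"
      if \<zeta>: "\<zeta> \<in> Lp M" for \<zeta>
    proof (rule bexI[OF _ T1[OF \<zeta>]], rule bexI[OF _ T2[OF \<zeta>]], intro ballI allI)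
      fix z b assume z: "z \<in> fourth_roots"
      have "z * (cnj z * r) = r" using z by auto
      then have "z * (cnj z * (r * w x)) = r * w x" for x by (metis mult.assoc)
      then show "nrm M (\<lambda>x. u x + r * w x + b * (T1 \<zeta> x + z * T2 \<zeta> x)) \<le> nrm M (\<lambda>x. u x + cnj z * (r * w x) + b * \<zeta> x)"
        using rot[OF z \<zeta>, of "cnj z * r" b] by (simp only: mult.assoc)
    qed
    \<comment> \<open>the coefficients \<open>z\<^sup>2\<close> and \<open>z\<close> span the annihilator of \<open>1\<close> and \<open>z\<close> on the fourth roots of unity\<close>
    have "AE x in M. cmod (u x) \<noteq> cmod (r * w x) \<longrightarrow>
      (\<Sum>z\<in>fourth_roots. z\<^sup>2 * duality_map (u x + cnj z * (r * w x))) = 0"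
      by (rule rel[OF base ex]) (simp_all only: sum_fourth_roots, simp_all add: power2_eq_square)
    moreover have "AE x in M. cmod (u x) \<noteq> cmod (r * w x) \<longrightarrow>
      (\<Sum>z\<in>fourth_roots. z * duality_map (u x + cnj z * (r * w x))) = 0"
      by (rule rel[OF base ex]) (simp_all only: sum_fourth_roots, simp_all add: power2_eq_square)
    ultimately show ?thesis
    proof eventually_elim
      case (elim x)
      show ?case
      proof
        assume ne: "cmod (u x) \<noteq> cmod (r * w x)"
        show "u x * (r * w x) = 0"
        proof (rule fourth_roots_rigidity[OF p2 ne])
          show "duality_map (u x + r * w x) + duality_map (u x - r * w x)
              - duality_map (u x - \<i> * (r * w x)) - duality_map (u x + \<i> * (r * w x)) = 0"
            using mp[OF elim(1) ne, unfolded sum_fourth_roots] by (simp add: power2_eq_square)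
          show "duality_map (u x + r * w x) - duality_map (u x - r * w x)
              + \<i> * duality_map (u x - \<i> * (r * w x)) - \<i> * duality_map (u x + \<i> * (r * w x)) = 0"
            using mp[OF elim(2) ne, unfolded sum_fourth_roots] by simp
        qed
      qed
    qed
  qed
  show ?thesis using main[of 1] main[of 2]
  proof eventually_elim
    case (elim x)
    show ?case
    proof (cases "cmod (u x) = cmod (w x)")
      case True
      then show ?thesis using elim(2) by (cases "w x = 0") (auto simp: norm_mult)
    qed (use elim in auto)
  qed
qed

end

section \<open>Normed spaces and their bounded operators\<close>

context complex_normed_space
begin

lemma scale_zero:
  assumes "x \<in> carr E"
  shows "scale_of E 0 x = zero_of E"
proof -
  have "scale_of E (1 + -1) x = add_of E (scale_of E 1 x) (scale_of E (-1) x)"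
    by (rule scale_add_left) fact
  then show ?thesis using assms by (simp add: scale_one add_minus)
qed

lemma scale_zero_right: "scale_of E c (zero_of E) = zero_of E"
  using scale_scale[OF zero_closed, of c 0] scale_zero[OF zero_closed] by simp

lemma norm_zero: "norm_of E (zero_of E) = 0"
  using norm_eq_zero[OF zero_closed] by simp

lemma zero_add: "x \<in> carr E \<Longrightarrow> add_of E (zero_of E) x = x"
  using add_commute[OF zero_closed] add_zero by simp

lemma dist_sym:
  assumes "x \<in> carr E" "y \<in> carr E"
  shows "dist_of E x y = dist_of E y x"
proof -
  have "scale_of E (-1) (add_of E x (scale_of E (-1) y)) = add_of E y (scale_of E (-1) x)"
    using assms add_commute[of "scale_of E (-1) x" y]
    by (simp add: scale_add_right scale_closed scale_scale scale_one)
  then show ?thesis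
    using norm_scale[of "add_of E x (scale_of E (-1) y)" "-1"] assms
    by (simp add: dist_of_def add_closed scale_closed)
qed

lemma dist_triangle:
  assumes "x \<in> carr E" "y \<in> carr E" "z \<in> carr E"
  shows "dist_of E x z \<le> dist_of E x y + dist_of E y z"
proof -
  have "add_of E (add_of E x (scale_of E (-1) y)) (add_of E y (scale_of E (-1) z))
      = add_of E x (add_of E (add_of E (scale_of E (-1) y) y) (scale_of E (-1) z))"
    using assms by (simp add: add_assoc add_closed scale_closed)
  also have "\<dots> = add_of E x (scale_of E (-1) z)"
    using assms by (simp add: add_commute[of "scale_of E (-1) y" y] scale_closed add_minus zero_add)
  finally show ?thesis
    using norm_triangle[of "add_of E x (scale_of E (-1) y)" "add_of E y (scale_of E (-1) z)"] assms
    by (simp add: dist_of_def add_closed scale_closed)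
qed

lemma dist_nonneg: "x \<in> carr E \<Longrightarrow> y \<in> carr E \<Longrightarrow> 0 \<le> dist_of E x y"
  by (simp add: dist_of_def norm_nonneg add_closed scale_closed)

lemma dist_eq_zero:
  assumes "x \<in> carr E" "y \<in> carr E" "dist_of E x y = 0"
  shows "x = y"
proof -
  have "add_of E x (scale_of E (-1) y) = zero_of E"
    using assms norm_eq_zero by (simp add: dist_of_def add_closed scale_closed)
  then have "add_of E (add_of E x (scale_of E (-1) y)) y = y" using assms by (simp add: zero_add)
  moreover have "add_of E (add_of E x (scale_of E (-1) y)) y = x"
    using assms by (simp add: add_assoc scale_closed add_commute[of "scale_of E (-1) y" y] add_minus add_zero)
  ultimately show ?thesis by simp
qed

lemma op_carr:
  "T \<in> carr (bounded_operators E) \<longleftrightarrow> T \<in> carr E \<rightarrow>\<^sub>E carr E \<and>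
     (\<forall>x\<in>carr E. \<forall>y\<in>carr E. T (add_of E x y) = add_of E (T x) (T y)) \<and>
     (\<forall>x\<in>carr E. \<forall>c. T (scale_of E c x) = scale_of E c (T x)) \<and>
     (\<exists>K. \<forall>x\<in>carr E. norm_of E (T x) \<le> K * norm_of E x)"
  by (simp add: bounded_operators_def)

lemma op_carrD:
  assumes "T \<in> carr (bounded_operators E)"
  shows "x \<in> carr E \<Longrightarrow> T x \<in> carr E"
    and "T \<in> extensional (carr E)"
    and "x \<in> carr E \<Longrightarrow> y \<in> carr E \<Longrightarrow> T (add_of E x y) = add_of E (T x) (T y)"
    and "x \<in> carr E \<Longrightarrow> T (scale_of E c x) = scale_of E c (T x)"
  using assms unfolding op_carr by (auto simp: PiE_def)

lemma op_norm_le: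
  assumes "\<And>x. x \<in> carr E \<Longrightarrow> norm_of E x \<le> 1 \<Longrightarrow> norm_of E (T x) \<le> c"
  shows "norm_of (bounded_operators E) T \<le> c"
proof -
  have "Sup {norm_of E (T x) | x. x \<in> carr E \<and> norm_of E x \<le> 1} \<le> c"
    using assms zero_closed norm_zero by (intro cSup_least) auto
  then show ?thesis by (simp add: bounded_operators_def)
qed

lemma op_norm_ge_unit:
  assumes "T \<in> carr (bounded_operators E)" "x \<in> carr E" "norm_of E x \<le> 1"
  shows "norm_of E (T x) \<le> norm_of (bounded_operators E) T"
proof -
  obtain K where K: "\<And>x. x \<in> carr E \<Longrightarrow> norm_of E (T x) \<le> K * norm_of E x"
    using assms(1) unfolding op_carr by blast
  have "norm_of E (T x) \<le> \<bar>K\<bar>" if "x \<in> carr E" "norm_of E x \<le> 1" for x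
  proof -
    have "K * norm_of E x \<le> \<bar>K\<bar> * 1" using that norm_nonneg by (intro mult_mono) auto
    then show ?thesis using K[OF that(1)] by simp
  qed
  then have "bdd_above {norm_of E (T x) | x. x \<in> carr E \<and> norm_of E x \<le> 1}"
    by (intro bdd_aboveI[of _ "\<bar>K\<bar>"]) auto
  then have "norm_of E (T x) \<le> Sup {norm_of E (T x) | x. x \<in> carr E \<and> norm_of E x \<le> 1}"
    using assms by (intro cSup_upper) auto
  then show ?thesis by (simp add: bounded_operators_def)
qed

lemma op_norm_nonneg:
  assumes "T \<in> carr (bounded_operators E)"
  shows "0 \<le> norm_of (bounded_operators E) T"
  using op_norm_ge_unit[OF assms zero_closed] norm_nonneg[OF op_carrD(1)[OF assms zero_closed]] norm_zero
  by simp

lemma op_norm_ge: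
  assumes T: "T \<in> carr (bounded_operators E)" and x: "x \<in> carr E"
  shows "norm_of E (T x) \<le> norm_of (bounded_operators E) T * norm_of E x"
proof (cases "norm_of E x = 0")
  case True
  then have "x = scale_of E 0 x" using norm_eq_zero x by (simp add: scale_zero)
  then have "T x = scale_of E 0 (T x)" using op_carrD(4)[OF T x, of 0] by simp
  then have "norm_of E (T x) = 0" using norm_scale[OF op_carrD(1)[OF T x], of 0] by simp
  then show ?thesis using True by simp
next
  case False
  then have pos: "0 < norm_of E x" using norm_nonneg[OF x] by simp
  let ?c = "complex_of_real (inverse (norm_of E x))"
  have "norm_of E (T (scale_of E ?c x)) \<le> norm_of (bounded_operators E) T"
    using op_norm_ge_unit[OF T scale_closed[OF x], of ?c] pos
    by (simp add: norm_scale x norm_inverse)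
  then have "inverse (norm_of E x) * norm_of E (T x) \<le> norm_of (bounded_operators E) T"
    using pos by (simp add: op_carrD[OF T] norm_scale x norm_inverse)
  then show ?thesis using pos by (simp add: field_simps)
qed

lemma complex_normed_space_bounded_operators: "complex_normed_space (bounded_operators E)"
proof -
  let ?B = "bounded_operators E"
  note sel = bounded_operators_def
  have op: "zero_of ?B = (\<lambda>x\<in>carr E. zero_of E)" "add_of ?B S T = (\<lambda>x\<in>carr E. add_of E (S x) (T x))"
    "scale_of ?B c T = (\<lambda>x\<in>carr E. scale_of E c (T x))" for S T c
    by (simp_all add: bounded_operators_def)
  have zero: "zero_of ?B \<in> carr ?B"
    unfolding op_carr op
    by (auto simp: zero_closed add_closed scale_closed add_zero norm_zero scale_zero_right intro!: exI[of _ 0])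
  have add: "add_of ?B S T \<in> carr ?B" if S: "S \<in> carr ?B" and T: "T \<in> carr ?B" for S T
  proof -
    have "norm_of E (add_of E (S x) (T x)) \<le> (norm_of ?B S + norm_of ?B T) * norm_of E x" if "x \<in> carr E" for x
      using norm_triangle[of "S x" "T x"] op_norm_ge[OF S that] op_norm_ge[OF T that] op_carrD(1)[OF S that] op_carrD(1)[OF T that]
      by (simp add: algebra_simps)
    moreover have "add_of E (add_of E a b) (add_of E c d) = add_of E (add_of E a c) (add_of E b d)"
      if "a \<in> carr E" "b \<in> carr E" "c \<in> carr E" "d \<in> carr E" for a b c d
    proof -
      have "add_of E (add_of E a b) (add_of E c d) = add_of E a (add_of E (add_of E b c) d)"
        using that by (simp add: add_assoc add_closed)
      also have "add_of E b c = add_of E c b" using that by (simp add: add_commute)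
      also have "add_of E a (add_of E (add_of E c b) d) = add_of E (add_of E a c) (add_of E b d)"
        using that by (simp add: add_assoc add_closed)
      finally show ?thesis .
    qed
    ultimately show ?thesis unfolding op_carr op using op_carrD[OF S] op_carrD[OF T]
      by (auto simp: add_closed scale_closed scale_add_right)
  qed
  have scale: "scale_of ?B c T \<in> carr ?B" if T: "T \<in> carr ?B" for c T
  proof -
    have "norm_of E (scale_of E c (T x)) \<le> (cmod c * norm_of ?B T) * norm_of E x" if "x \<in> carr E" for x
      using op_norm_ge[OF T that] op_carrD(1)[OF T that] by (simp add: norm_scale mult_left_mono mult.assoc)
    then have "\<exists>K. \<forall>x\<in>carr E. norm_of E (scale_of E c (T x)) \<le> K * norm_of E x" by blast
    moreover have "scale_of E b (scale_of E c y) = scale_of E c (scale_of E b y)" if "y \<in> carr E" for b y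
      using that by (simp add: scale_scale mult.commute)
    ultimately show ?thesis unfolding op_carr op using op_carrD[OF T]
      by (auto simp: scale_closed scale_add_right add_closed)
  qed
  have ext: "(\<lambda>x\<in>carr E. f x) = T" if "T \<in> carr ?B" "\<And>x. x \<in> carr E \<Longrightarrow> f x = T x" for f T
    by (rule extensionalityI[of _ "carr E"]) (use that op_carrD(2)[OF that(1)] in auto)
  have nscale: "norm_of ?B (scale_of ?B c T) \<le> cmod c * norm_of ?B T" if "T \<in> carr ?B" for c T
  proof (rule op_norm_le)
    fix x assume x: "x \<in> carr E" "norm_of E x \<le> 1"
    show "norm_of E (scale_of ?B c T x) \<le> cmod c * norm_of ?B T"
      unfolding op using x op_norm_ge_unit[OF that x] op_carrD(1)[OF that x(1)] by (simp add: norm_scale mult_left_mono)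
  qed
  show ?thesis
  proof (unfold_locales, goal_cases)
    case 1 show ?case by (rule zero)
  next
    case (2 x y) then show ?case by (rule add)
  next
    case (3 x c) then show ?case by (rule scale)
  next
    case (4 x y z) then show ?case unfolding op
      by (intro restrict_ext) (simp add: add_assoc op_carrD(1)[OF 4(1)] op_carrD(1)[OF 4(2)] op_carrD(1)[OF 4(3)])
  next
    case (5 x y) then show ?case unfolding op
      by (intro restrict_ext) (simp add: add_commute op_carrD(1)[OF 5(1)] op_carrD(1)[OF 5(2)])
  next
    case (6 x) then show ?case unfolding op by (intro ext) (auto simp: op_carrD(1)[OF 6] add_zero)
  next
    case (7 x) then show ?case unfolding op
      by (intro restrict_ext) (simp add: add_minus op_carrD(1)[OF 7])
  next
    case (8 x) then show ?case unfolding op by (intro ext) (auto simp: op_carrD(1)[OF 8] scale_one)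
  next
    case (9 x b c) then show ?case unfolding op
      by (intro restrict_ext) (simp add: scale_scale op_carrD(1)[OF 9])
  next
    case (10 x b c) then show ?case unfolding op
      by (intro restrict_ext) (simp add: scale_add_left op_carrD(1)[OF 10])
  next
    case (11 x y c) then show ?case unfolding op
      by (intro restrict_ext) (simp add: scale_add_right op_carrD(1)[OF 11(1)] op_carrD(1)[OF 11(2)])
  next
    case (12 x) then show ?case by (rule op_norm_nonneg)
  next
    case (13 T)
    show ?case
    proof
      assume z: "norm_of ?B T = 0"
      have "T x = zero_of E" if "x \<in> carr E" for x
        using op_norm_ge[OF 13 that] z norm_nonneg[OF op_carrD(1)[OF 13 that]] norm_eq_zero[OF op_carrD(1)[OF 13 that]] by simp
      then show "T = zero_of ?B" unfolding op using ext[OF 13, of "\<lambda>x. zero_of E"] by simp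
    next
      assume "T = zero_of ?B"
      then have "norm_of ?B T \<le> 0" by (intro op_norm_le) (simp add: op norm_zero)
      then show "norm_of ?B T = 0" using op_norm_nonneg[OF 13] by simp
    qed
  next
    case (14 T c)
    show ?case
    proof (cases "c = 0")
      case True
      then show ?thesis using nscale[OF 14, of 0] op_norm_nonneg[OF scale[OF 14, of 0]] by simp
    next
      case False
      have "scale_of ?B (inverse c) (scale_of ?B c T) = T"
        using False 14 unfolding op by (intro ext) (auto simp: op_carrD(1)[OF 14] scale_scale scale_one)
      then have "norm_of ?B T \<le> inverse (cmod c) * norm_of ?B (scale_of ?B c T)"
        using nscale[OF scale[OF 14, of c], of "inverse c"] by (simp add: norm_inverse)
      then have "cmod c * norm_of ?B T \<le> norm_of ?B (scale_of ?B c T)" using False by (simp add: field_simps)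
      then show ?thesis using nscale[OF 14, of c] by simp
    qed
  next
    case (15 S T)
    show ?case
    proof (rule op_norm_le)
      fix x assume x: "x \<in> carr E" "norm_of E x \<le> 1"
      show "norm_of E (add_of ?B S T x) \<le> norm_of ?B S + norm_of ?B T"
        unfolding op using x norm_triangle[of "S x" "T x"] op_norm_ge_unit[OF 15(1) x] op_norm_ge_unit[OF 15(2) x] op_carrD(1)[OF 15(1) x(1)] op_carrD(1)[OF 15(2) x(1)]
        by simp
    qed
  qed
qed

end

text \<open>An isometric image of a complete space is complete, hence closed.\<close>

lemma closed_subalgebra_isometric_image:
  fixes A :: "('a, 'y) cnalgebra_scheme" and B :: "('b, 'z) cnalgebra_scheme"
  assumes A: "complex_banach_algebra A" and B: "complex_normed_space B" and \<phi>: "isometric_hom A B \<phi>"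
  shows "closed_subalgebra (\<phi> ` carr A) B"
proof -
  interpret A: complex_banach_algebra A by fact
  interpret B: complex_normed_space B by fact
  have cl: "\<phi> x \<in> carr B" and add: "y \<in> carr A \<Longrightarrow> \<phi> (add_of A x y) = add_of B (\<phi> x) (\<phi> y)"
    and scale: "\<phi> (scale_of A c x) = scale_of B c (\<phi> x)"
    and mult: "y \<in> carr A \<Longrightarrow> \<phi> (mult_of A x y) = mult_of B (\<phi> x) (\<phi> y)"
    and iso: "norm_of B (\<phi> x) = norm_of A x"
    if "x \<in> carr A" for x y c using \<phi> that unfolding isometric_hom_def by auto
  have dist: "dist_of B (\<phi> x) (\<phi> y) = dist_of A x y" if "x \<in> carr A" "y \<in> carr A" for x y
    unfolding dist_of_def using that by (simp flip: add scale iso add: A.scale_closed A.add_closed)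
  have lim: "l \<in> \<phi> ` carr A"
    if s: "range s \<subseteq> \<phi> ` carr A" and l: "l \<in> carr B" and lim: "(\<lambda>n. dist_of B (s n) l) \<longlonglongrightarrow> 0" for s :: "nat \<Rightarrow> 'b" and l
  proof -
    have "\<forall>n. \<exists>a. a \<in> carr A \<and> s n = \<phi> a" using s by (auto simp: image_subset_iff image_iff)
    then obtain a where a: "\<And>n. a n \<in> carr A" "\<And>n. s n = \<phi> (a n)" by metis
    have sB: "s n \<in> carr B" for n using a cl by simp
    have "\<exists>N. \<forall>m\<ge>N. \<forall>n\<ge>N. dist_of A (a m) (a n) < e" if "0 < e" for e
    proof -
      have "\<forall>\<^sub>F n in sequentially. dist_of B (s n) l < e / 2"
        using order_tendstoD(2)[OF lim, of "e / 2"] that by simp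
      then obtain N where N: "\<And>n. n \<ge> N \<Longrightarrow> dist_of B (s n) l < e / 2" by (auto simp: eventually_sequentially)
      have "dist_of A (a m) (a n) < e" if "m \<ge> N" "n \<ge> N" for m n
        using B.dist_triangle[OF sB l sB, of m n] B.dist_sym[OF l sB, of n] N[OF that(1)] N[OF that(2)]
          dist[of "a m" "a n"] a by simp
      then show ?thesis by blast
    qed
    from A.complete[OF _ this] a(1) obtain b where b: "b \<in> carr A" "(\<lambda>n. dist_of A (a n) b) \<longlonglongrightarrow> 0"
      by (metis image_subsetI)
    have "(\<lambda>n. dist_of B (s n) l + dist_of A (a n) b) \<longlonglongrightarrow> 0 + 0" by (intro tendsto_add lim b)
    moreover have "dist_of B l (\<phi> b) \<le> dist_of B (s n) l + dist_of A (a n) b" for n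
      using B.dist_triangle[OF l sB cl[OF b(1)], of n] B.dist_sym[OF l sB, of n] dist[OF a(1) b(1), of n] a(2) by simp
    ultimately have "dist_of B l (\<phi> b) \<le> 0" by (intro LIMSEQ_le_const) auto
    then have "l = \<phi> b" using B.dist_nonneg[OF l cl[OF b(1)]] by (intro B.dist_eq_zero[OF l cl[OF b(1)]]) simp
    then show ?thesis using b by simp
  qed
  have "zero_of B = \<phi> (scale_of A 0 (zero_of A))"
    using scale[OF A.zero_closed, of 0] B.scale_zero[OF cl[OF A.zero_closed]] by simp
  then have zero: "zero_of B \<in> \<phi> ` carr A" using A.zero_closed A.scale_closed by blast
  show ?thesis unfolding closed_subalgebra_def
  proof (intro conjI ballI allI impI zero; (elim conjE)?)
    show "\<phi> ` carr A \<subseteq> carr B" using cl by auto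
    show "add_of B x y \<in> \<phi> ` carr A" "mult_of B x y \<in> \<phi> ` carr A" if "x \<in> \<phi> ` carr A" "y \<in> \<phi> ` carr A" for x y
      using that by (auto simp: A.add_closed A.mult_closed simp flip: add mult)
    show "scale_of B c x \<in> \<phi> ` carr A" if "x \<in> \<phi> ` carr A" for c x
      using that by (auto simp: A.scale_closed simp flip: scale)
  qed (rule lim)
qed

section \<open>The algebra \<open>C(X)\<close>\<close>

lemma sup0_le: "0 \<le> c \<Longrightarrow> (\<And>s. s \<in> S \<Longrightarrow> s \<le> c) \<Longrightarrow> sup0 S \<le> c"
  unfolding sup0_def by (rule cSup_least) auto

lemma sup0_ge: "bdd_above S \<Longrightarrow> s \<in> S \<Longrightarrow> s \<le> sup0 S"
  unfolding sup0_def by (rule cSup_upper) auto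

lemma sup0_nonneg: "bdd_above S \<Longrightarrow> 0 \<le> sup0 S"
  unfolding sup0_def by (rule cSup_upper) auto

lemma continuous_map_euclidean_iff:
  "continuous_map X euclidean f \<longleftrightarrow> (\<forall>x\<in>topspace X. (f \<longlongrightarrow> f x) (atin X x))"
  by (simp add: continuous_map_atin)

lemma continuous_map_complex_mult:
  fixes f g :: "'x \<Rightarrow> complex"
  shows "continuous_map X euclidean f \<Longrightarrow> continuous_map X euclidean g \<Longrightarrow> continuous_map X euclidean (\<lambda>x. f x * g x)"
  by (simp add: continuous_map_euclidean_iff tendsto_mult)

lemma continuous_map_complex_of_real:
  "continuous_map X euclideanreal f \<Longrightarrow> continuous_map X euclidean (\<lambda>x. complex_of_real (f x))"
  by (simp add: continuous_map_euclidean_iff tendsto_of_real)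

lemma continuous_map_restrict_iff:
  "continuous_map X Y (restrict f (topspace X)) \<longleftrightarrow> continuous_map X Y f"
  by (rule iffI; erule continuous_map_eq) auto

lemma C_carr: "f \<in> carr (C_algebra X) \<longleftrightarrow> f \<in> extensional (topspace X) \<and> continuous_map X euclidean f"
  by (simp add: C_algebra_def)

lemma restrict_in_C: "continuous_map X euclidean f \<Longrightarrow> restrict f (topspace X) \<in> carr (C_algebra X)"
  by (simp add: C_carr continuous_map_restrict_iff)

lemma C_norm_le:
  assumes "0 \<le> c" "\<And>x. x \<in> topspace X \<Longrightarrow> cmod (f x) \<le> c"
  shows "norm_of (C_algebra X) f \<le> c"
proof -
  have "sup0 ((\<lambda>x. cmod (f x)) ` topspace X) \<le> c" using assms by (intro sup0_le) auto
  then show ?thesis by (simp add: C_algebra_def)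
qed

lemma continuous_image_bdd_above:
  fixes f :: "'x \<Rightarrow> 'a::real_normed_vector"
  assumes "compact_space X" "continuous_map X euclidean f"
  shows "bdd_above ((\<lambda>x. norm (f x)) ` topspace X)"
proof -
  have "compactin euclidean (f ` topspace X)"
    using assms image_compactin compact_space_def by blast
  then have "bounded (f ` topspace X)" by (simp add: compact_imp_bounded)
  then show ?thesis by (auto simp: bounded_iff bdd_above_def)
qed

lemma C_norm_ge:
  assumes "compact_space X" "continuous_map X euclidean f" "x \<in> topspace X"
  shows "cmod (f x) \<le> norm_of (C_algebra X) f"
proof -
  have "cmod (f x) \<le> sup0 ((\<lambda>x. cmod (f x)) ` topspace X)"
    by (rule sup0_ge[OF continuous_image_bdd_above[OF assms(1,2)]]) (use assms in auto)
  then show ?thesis by (simp add: C_algebra_def)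
qed

lemma C_norm_nonneg:
  assumes "compact_space X" "continuous_map X euclidean f"
  shows "0 \<le> norm_of (C_algebra X) f"
proof -
  have "0 \<le> sup0 ((\<lambda>x. cmod (f x)) ` topspace X)"
    by (rule sup0_nonneg[OF continuous_image_bdd_above[OF assms(1,2)]])
  then show ?thesis by (simp add: C_algebra_def)
qed

lemma C_ops:
  "zero_of (C_algebra X) = (\<lambda>x\<in>topspace X. 0)"
  "add_of (C_algebra X) f g = (\<lambda>x\<in>topspace X. f x + g x)"
  "scale_of (C_algebra X) c f = (\<lambda>x\<in>topspace X. c * f x)"
  "mult_of (C_algebra X) f g = (\<lambda>x\<in>topspace X. f x * g x)"
  by (simp_all add: C_algebra_def)

lemma C_dist_le:
  assumes "0 \<le> c" "\<And>x. x \<in> topspace X \<Longrightarrow> cmod (f x - g x) \<le> c"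
  shows "dist_of (C_algebra X) f g \<le> c"
  unfolding dist_of_def C_ops using assms by (intro C_norm_le) auto

lemma C_dist:
  assumes "compact_space X" "f \<in> carr (C_algebra X)" "g \<in> carr (C_algebra X)"
  shows C_dist_ge: "x \<in> topspace X \<Longrightarrow> cmod (f x - g x) \<le> dist_of (C_algebra X) f g"
    and C_dist_nonneg: "0 \<le> dist_of (C_algebra X) f g"
proof -
  have c: "continuous_map X euclidean (\<lambda>x\<in>topspace X. f x + (\<lambda>x\<in>topspace X. (-1) * g x) x)"
  proof -
    have "continuous_map X euclidean (\<lambda>x\<in>topspace X. (-1) * g x)"
      unfolding continuous_map_restrict_iff
      by (rule continuous_map_complex_mult) (use assms in \<open>auto simp: C_carr\<close>)
    from continuous_map_add[OF _ this, of f] show ?thesis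
      unfolding continuous_map_restrict_iff using assms by (simp only: C_carr)
  qed
  show "cmod (f x - g x) \<le> dist_of (C_algebra X) f g" if "x \<in> topspace X"
    using C_norm_ge[OF assms(1) c that] that unfolding dist_of_def C_ops by simp
  show "0 \<le> dist_of (C_algebra X) f g"
    using C_norm_nonneg[OF assms(1) c] unfolding dist_of_def C_ops .
qed

lemma complex_banach_algebra_C:
  assumes X: "compact_space X"
  shows "complex_banach_algebra (C_algebra X)"
proof -
  let ?A = "C_algebra X"
  have ext: "(\<lambda>x\<in>topspace X. h x) = f" if "f \<in> carr ?A" "\<And>x. x \<in> topspace X \<Longrightarrow> h x = f x" for f h
    by (rule extensionalityI[of _ "topspace X"]) (use that in \<open>auto simp: C_carr\<close>)
  have cont: "continuous_map X euclidean f" if "f \<in> carr ?A" for f using that by (simp add: C_carr)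
  note ge = C_norm_ge[OF X cont]
  note nonneg = C_norm_nonneg[OF X cont]
  show ?thesis
  proof (unfold_locales, goal_cases)
    case 1 show ?case unfolding C_ops by (intro restrict_in_C) simp
  next
    case (2 x y) then show ?case unfolding C_ops by (intro restrict_in_C continuous_map_add cont)
  next
    case (3 x c) then show ?case unfolding C_ops
      by (intro restrict_in_C continuous_map_complex_mult[OF _ cont]) simp_all
  next
    case (6 x) then show ?case unfolding C_ops by (intro ext) auto
  next
    case (8 x) then show ?case unfolding C_ops by (intro ext) auto
  next
    case (12 x) then show ?case by (rule nonneg)
  next
    case (13 f)
    show ?case
    proof
      assume "norm_of ?A f = 0"
      then have "f x = 0" if "x \<in> topspace X" for x using ge[OF 13 that] by simp
      then show "f = zero_of ?A" using ext[OF 13, of "\<lambda>_. 0"] by (simp add: C_ops)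
    next
      assume "f = zero_of ?A"
      then have "norm_of ?A f \<le> 0" by (intro C_norm_le) (auto simp: C_ops)
      then show "norm_of ?A f = 0" using nonneg[OF 13] by simp
    qed
  next
    case (14 f c)
    have c: "continuous_map X euclidean (\<lambda>x. c * f x)" by (intro continuous_map_complex_mult[OF _ cont] 14) simp
    have "norm_of ?A (scale_of ?A c f) \<le> cmod c * norm_of ?A f"
      using ge[OF 14] nonneg[OF 14] unfolding C_ops by (intro C_norm_le) (auto simp: norm_mult mult_left_mono)
    moreover have "cmod c * norm_of ?A f \<le> norm_of ?A (scale_of ?A c f)" if "c \<noteq> 0"
    proof -
      have *: "cmod (c * f x) \<le> norm_of ?A (scale_of ?A c f)" if "x \<in> topspace X" for x
        using C_norm_ge[OF X _ that, of "\<lambda>x\<in>topspace X. c * f x"] c that by (simp add: C_ops continuous_map_restrict_iff)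
      have "norm_of ?A f \<le> norm_of ?A (scale_of ?A c f) / cmod c"
      proof (rule C_norm_le)
        show "0 \<le> norm_of ?A (scale_of ?A c f) / cmod c"
          using C_norm_nonneg[OF X, of "\<lambda>x\<in>topspace X. c * f x"] c by (simp add: C_ops continuous_map_restrict_iff)
        show "cmod (f x) \<le> norm_of ?A (scale_of ?A c f) / cmod c" if "x \<in> topspace X" for x
          using *[OF that] \<open>c \<noteq> 0\<close> by (simp add: norm_mult field_simps)
      qed
      then show ?thesis using that by (simp add: field_simps)
    qed
    moreover have "cmod c * norm_of ?A f \<le> norm_of ?A (scale_of ?A c f)" if "c = 0"
      using that C_norm_nonneg[OF X, of "\<lambda>x\<in>topspace X. c * f x"] c by (simp add: C_ops continuous_map_restrict_iff)
    ultimately show ?case by (cases "c = 0") (auto intro: antisym)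
  next
    case (15 f g)
    show ?case unfolding C_ops
    proof (rule C_norm_le)
      show "0 \<le> norm_of ?A f + norm_of ?A g" using nonneg[OF 15(1)] nonneg[OF 15(2)] by simp
      fix x assume x: "x \<in> topspace X"
      show "cmod ((\<lambda>x\<in>topspace X. f x + g x) x) \<le> norm_of ?A f + norm_of ?A g"
        using x norm_triangle_mono[OF ge[OF 15(1) x] ge[OF 15(2) x]] by simp
    qed
  next
    case (16 s)
    then have s: "s n \<in> carr ?A" for n by auto
    have "uniformly_Cauchy_on (topspace X) s"
      unfolding uniformly_Cauchy_on_def
    proof (intro allI impI)
      fix e :: real assume "0 < e"
      then obtain N where "\<And>m n. m \<ge> N \<Longrightarrow> n \<ge> N \<Longrightarrow> dist_of ?A (s m) (s n) < e" using 16(2) by blast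
      then show "\<exists>M. \<forall>x\<in>topspace X. \<forall>m\<ge>M. \<forall>n\<ge>M. dist (s m x) (s n x) < e"
        using C_dist_ge[OF X s s] unfolding dist_norm by (meson le_less_trans)
    qed
    then obtain l where l: "uniform_limit (topspace X) s l sequentially"
      using Cauchy_uniformly_convergent unfolding uniformly_convergent_on_def by blast
    have lim: "\<forall>\<^sub>F n in sequentially. \<forall>x\<in>topspace X. dist (s n x) (l x) < e" if "0 < e" for e
      using uniform_limitD[OF l that] .
    have "continuous_map X euclidean l"
      by (rule Met_TC.continuous_map_uniform_limit[where X=X and F=sequentially and f=s and g=l, unfolded mtopology_is_euclidean])
        (use lim cont[OF s] in auto)
    then have lA: "restrict l (topspace X) \<in> carr ?A" by (rule restrict_in_C)
    have "(\<lambda>n. dist_of ?A (s n) (restrict l (topspace X))) \<longlonglongrightarrow> 0"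
    proof (rule tendsto_norm_zero_cancel, rule order_tendstoI)
      fix a :: real assume "a < 0" then show "\<forall>\<^sub>F n in sequentially. a < norm (dist_of ?A (s n) (restrict l (topspace X)))"
        by (intro always_eventually allI less_le_trans[OF _ norm_ge_zero])
    next
      fix a :: real assume a: "0 < a"
      have nn: "0 \<le> dist_of ?A (s n) (restrict l (topspace X))" for n
        by (rule C_dist_nonneg[OF X s lA])
      from a have "0 < a / 2" by simp
      from lim[OF this] show "\<forall>\<^sub>F n in sequentially. norm (dist_of ?A (s n) (restrict l (topspace X))) < a"
      proof eventually_elim
        case (elim n)
        have "dist_of ?A (s n) (restrict l (topspace X)) \<le> a / 2"
          using elim a by (intro C_dist_le) (auto simp: dist_norm less_imp_le)
        then show ?case using nn[of n] a by simp
      qed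
    qed
    then show ?case using lA by blast
  next
    case (17 x y) then show ?case unfolding C_ops by (intro restrict_in_C continuous_map_complex_mult cont)
  next
    case (23 f g)
    show ?case unfolding C_ops
    proof (rule C_norm_le)
      show "0 \<le> norm_of ?A f * norm_of ?A g" using nonneg[OF 23(1)] nonneg[OF 23(2)] by simp
      fix x assume x: "x \<in> topspace X"
      show "cmod ((\<lambda>x\<in>topspace X. f x * g x) x) \<le> norm_of ?A f * norm_of ?A g"
        using x mult_mono[OF ge[OF 23(1) x] ge[OF 23(2) x] nonneg[OF 23(1)] norm_ge_zero] by (simp add: norm_mult)
    qed
  qed (auto simp: C_ops algebra_simps intro!: restrict_ext)
qed

lemma second_countable_compact_metrizable:
  assumes "compact_space X" "metrizable_space X"
  shows "second_countable X"
proof -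
  obtain S d where m: "Metric_space S d" and X: "X = Metric_space.mtopology S d"
    using assms(2) unfolding metrizable_space_def by blast
  interpret Metric_space S d by fact
  have "\<exists>F. finite F \<and> F \<subseteq> S \<and> S \<subseteq> (\<Union>x\<in>F. mball x (inverse (Suc n)))" for n
  proof -
    have "compactin mtopology S" using assms(1) unfolding X compact_space_def by simp
    then have "\<exists>\<F>. finite \<F> \<and> \<F> \<subseteq> (\<lambda>x. mball x (inverse (Suc n))) ` S \<and> S \<subseteq> \<Union>\<F>"
      by (rule compactinD) (auto simp: openin_mball intro!: bexI centre_in_mball_iff[THEN iffD2])
    then show ?thesis by (metis finite_subset_image)
  qed
  then obtain F where F: "\<And>n. finite (F n)" "\<And>n. F n \<subseteq> S" "\<And>n. S \<subseteq> (\<Union>x\<in>F n. mball x (inverse (Suc n)))" by metis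
  let ?B = "\<Union>n. (\<lambda>x. mball x (inverse (Suc n))) ` F n"
  show ?thesis unfolding second_countable_def
  proof (intro exI[of _ ?B] conjI allI impI ballI)
    show "countable ?B" using F(1) by (auto intro: countable_finite)
    show "openin X V" if "V \<in> ?B" for V using that by (auto simp: X openin_mball)
    fix U x assume "openin X U \<and> x \<in> U"
    then obtain r where r: "0 < r" "mball x r \<subseteq> U" and "x \<in> S"
      unfolding X openin_mtopology by blast
    obtain n where n: "inverse (Suc n) < r / 2" using r reals_Archimedean[of "r / 2"] by auto
    obtain y where y: "y \<in> F n" "x \<in> mball y (inverse (Suc n))" using F(3)[of n] \<open>x \<in> S\<close> by auto
    have "mball y (inverse (Suc n)) \<subseteq> mball x r"
    proof
      fix z assume z: "z \<in> mball y (inverse (Suc n))"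
      have "d x z \<le> d x y + d y z" using y z by (intro triangle) auto
      also have "\<dots> < r" using y z n commute[of x y] by auto
      finally show "z \<in> mball x r" using z \<open>x \<in> S\<close> by auto
    qed
    then show "\<exists>V\<in>?B. x \<in> V \<and> V \<subseteq> U" using y r by blast
  qed
qed

text \<open>For a finite set \<open>F\<close> of pairs \<open>(V, q)\<close> let \<open>\<Phi> F n\<close> be the set of those \<open>f\<close> that are within
  \<open>1 / (n + 1)\<close> of \<open>q\<close> on \<open>V\<close> for each pair, where the sets \<open>V\<close> cover \<open>X\<close>. These sets have diameter
  at most \<open>2 / (n + 1)\<close>, and by compactness those with \<open>V\<close> in a countable base and \<open>q\<close> in a countable
  dense set cover \<open>C(X)\<close> for each \<open>n\<close>. One member of each nonempty \<open>\<Phi> F n\<close> gives a countable dense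
  set, so no dense family of functions has to be constructed.\<close>

lemma separable_C:
  assumes X: "compact_space X" "metrizable_space X"
  shows "separable (C_algebra X)"
proof -
  let ?A = "C_algebra X"
  obtain \<V> where \<V>: "countable \<V>" "\<And>V. V \<in> \<V> \<Longrightarrow> openin X V"
    "\<And>U x. openin X U \<Longrightarrow> x \<in> U \<Longrightarrow> \<exists>V\<in>\<V>. x \<in> V \<and> V \<subseteq> U"
    using second_countable_compact_metrizable[OF X] unfolding second_countable_def by metis
  obtain Q :: "complex set" where Q: "countable Q" "\<And>U. open U \<Longrightarrow> U \<noteq> {} \<Longrightarrow> \<exists>q\<in>Q. q \<in> U"
    using countable_dense_setE by blast
  define \<Phi> where "\<Phi> F n f \<longleftrightarrow> f \<in> carr ?A \<and> topspace X \<subseteq> \<Union>(fst ` F) \<and>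
    (\<forall>(V, q)\<in>F. \<forall>x\<in>V. cmod (f x - q) < inverse (real (Suc n)))" for F and n :: nat and f
  define I where "I = {F. finite F \<and> F \<subseteq> \<V> \<times> Q}"
  have I: "countable I" unfolding I_def using \<V>(1) Q(1)
    by (intro countable_Collect_finite_subset countable_SIGMA) auto
  define D where "D = {SOME f. \<Phi> F n f | F n. F \<in> I \<and> (\<exists>f. \<Phi> F n f)}"
  have "countable ((\<lambda>(F, n). SOME f. \<Phi> F n f) ` (I \<times> (UNIV :: nat set)))" using I by (intro countable_image countable_SIGMA) auto
  then have Dc: "countable D" by (rule countable_subset[rotated]) (auto simp: D_def)
  have DA: "D \<subseteq> carr ?A"
  proof
    fix g assume "g \<in> D"
    then obtain F n where "g = (SOME f. \<Phi> F n f)" "\<exists>f. \<Phi> F n f" by (auto simp: D_def)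
    then have "\<Phi> F n g" using someI_ex by metis
    then show "g \<in> carr ?A" by (simp add: \<Phi>_def)
  qed
  have ex: "\<exists>F\<in>I. \<Phi> F n f" if f: "f \<in> carr ?A" for f n
  proof -
    let ?r = "inverse (real (Suc n))"
    let ?G = "{V \<in> \<V>. \<exists>q\<in>Q. \<forall>x\<in>V. cmod (f x - q) < ?r}"
    have cov: "topspace X \<subseteq> \<Union>?G"
    proof
      fix x assume x: "x \<in> topspace X"
      have "\<exists>q\<in>Q. q \<in> ball (f x) ?r"
        using Q(2)[OF open_ball, of "f x" ?r] centre_in_ball[of "f x" ?r] by (metis empty_iff inverse_positive_iff_positive of_nat_0_less_iff zero_less_Suc)
      then obtain q where q: "q \<in> Q" "q \<in> ball (f x) ?r" by blast
      have "openin X {y \<in> topspace X. f y \<in> ball q ?r}"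
        using f by (intro openin_continuous_map_preimage[of X euclidean]) (auto simp: C_carr)
      moreover have "x \<in> {y \<in> topspace X. f y \<in> ball q ?r}" using x q by (simp add: dist_commute)
      ultimately obtain V where "V \<in> \<V>" "x \<in> V" "V \<subseteq> {y \<in> topspace X. f y \<in> ball q ?r}" using \<V>(3) by blast
      then have "V \<in> ?G" using q by (auto simp: dist_norm norm_minus_commute intro!: bexI[of _ q])
      with \<open>x \<in> V\<close> show "x \<in> \<Union>?G" by blast
    qed
    have "\<exists>\<F>. finite \<F> \<and> \<F> \<subseteq> ?G \<and> topspace X \<subseteq> \<Union>\<F>"
      by (rule compactinD[OF _ _ cov]) (use X(1) \<V>(2) in \<open>auto simp: compact_space_def\<close>)
    then obtain \<F> where \<F>: "finite \<F>" "\<F> \<subseteq> ?G" "topspace X \<subseteq> \<Union>\<F>" by blast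
    have "\<forall>V\<in>\<F>. \<exists>q. q \<in> Q \<and> (\<forall>x\<in>V. cmod (f x - q) < ?r)" using \<F>(2) by blast
    from bchoice[OF this] obtain q where q: "\<And>V. V \<in> \<F> \<Longrightarrow> q V \<in> Q \<and> (\<forall>x\<in>V. cmod (f x - q V) < ?r)" by blast
    show ?thesis
    proof (rule bexI[of _ "(\<lambda>V. (V, q V)) ` \<F>"])
      show "(\<lambda>V. (V, q V)) ` \<F> \<in> I" using \<F> q by (auto simp: I_def)
      show "\<Phi> ((\<lambda>V. (V, q V)) ` \<F>) n f" using f \<F>(3) q by (auto simp: \<Phi>_def image_image)
    qed
  qed
  have "\<exists>d\<in>D. dist_of ?A f d < e" if f: "f \<in> carr ?A" and e: "0 < e" for f e
  proof -
    obtain n where n: "inverse (real (Suc n)) < e / 2" using e reals_Archimedean[of "e / 2"] by auto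
    obtain F where F: "F \<in> I" "\<Phi> F n f" using ex[OF f] by blast
    let ?g = "SOME g. \<Phi> F n g"
    have g: "\<Phi> F n ?g" using someI[of "\<Phi> F n" f] F by simp
    have "dist_of ?A f ?g \<le> 2 * inverse (real (Suc n))"
    proof (rule C_dist_le)
      fix x assume "x \<in> topspace X"
      then have "x \<in> \<Union>(fst ` F)" using F(2) unfolding \<Phi>_def by blast
      then obtain V q where "(V, q) \<in> F" "x \<in> V" by auto
      then have "cmod (f x - q) < inverse (real (Suc n))" "cmod (?g x - q) < inverse (real (Suc n))"
        using F(2) g unfolding \<Phi>_def by blast+
      then show "cmod (f x - ?g x) \<le> 2 * inverse (real (Suc n))"
        using norm_triangle_ineq4[of "f x - q" "?g x - q"] by simp
    qed simp
    moreover have "?g \<in> D" using F by (auto simp: D_def)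
    ultimately show ?thesis using n by (intro bexI[of _ ?g]) auto
  qed
  then show ?thesis unfolding separable_def using Dc DA by blast
qed

lemma sum_of_disjoint:
  assumes "finite I" and dis: "\<And>i j. i \<in> I \<Longrightarrow> j \<in> I \<Longrightarrow> i \<noteq> j \<Longrightarrow> a i = 0 \<or> a j = 0" and "F 0 = 0"
  shows "F (\<Sum>i\<in>I. a i) = (\<Sum>i\<in>I. F (a i))"
proof (cases "\<exists>i\<in>I. a i \<noteq> 0")
  case True
  then obtain i where i: "i \<in> I" "a i \<noteq> 0" by blast
  then have z: "a j = 0" if "j \<in> I - {i}" for j using dis[of i j] that by auto
  have "(\<Sum>j\<in>I. a j) = (\<Sum>j\<in>{i}. a j)" using assms(1) i z by (intro sum.mono_neutral_right) auto
  moreover have "(\<Sum>j\<in>I. F (a j)) = (\<Sum>j\<in>{i}. F (a j))"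
    using assms i z by (intro sum.mono_neutral_right) auto
  ultimately show ?thesis by simp
qed (use assms in simp)

section \<open>Representations of \<open>C(X)\<close> as actions on functions\<close>

locale C_representation = Lp_exponent p
  for p :: real +
  fixes X :: "'x topology" and M :: "'m measure"
    and \<pi> :: "('x \<Rightarrow> complex) \<Rightarrow> ('m \<Rightarrow> complex) set \<Rightarrow> ('m \<Rightarrow> complex) set"
  assumes compact: "compact_space X" and metrizable: "metrizable_space X"
    and rep: "isometric_rep p M (C_algebra X) \<pi>"
begin

text \<open>The operator \<open>\<pi>(f)\<close> on functions; by the choice of representatives it is linear and
  multiplicative almost everywhere only. Restricting \<open>f\<close> first admits all functions that are
  continuous on \<open>X\<close>, whatever their values off \<open>X\<close>.\<close>

definition action :: "('x \<Rightarrow> complex) \<Rightarrow> ('m \<Rightarrow> complex) \<Rightarrow> 'm \<Rightarrow> complex" where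
  "action f \<xi> = Lp_rep (\<pi> (restrict f (topspace X)) (cls M \<xi>))"

abbreviation cont :: "('x \<Rightarrow> complex) \<Rightarrow> bool" where "cont f \<equiv> continuous_map X euclidean f"

abbreviation cont_real :: "('x \<Rightarrow> real) \<Rightarrow> bool" where "cont_real f \<equiv> continuous_map X euclidean f"

interpretation E: complex_normed_space "Lp_space p M" by (rule complex_normed_space_Lp)

lemma rep_op: "f \<in> carr (C_algebra X) \<Longrightarrow> \<pi> f \<in> carr (Lp_operators p M)"
  using rep by (auto simp: isometric_hom_def)

lemma cont_add: "cont f \<Longrightarrow> cont g \<Longrightarrow> cont (\<lambda>x. f x + g x)" by (rule continuous_map_add)
lemma cont_mult: "cont f \<Longrightarrow> cont g \<Longrightarrow> cont (\<lambda>x. f x * g x)" by (rule continuous_map_complex_mult)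
lemma cont_const: "cont (\<lambda>x. c)" by simp
lemma cont_scale: "cont f \<Longrightarrow> cont (\<lambda>x. c * f x)" by (rule cont_mult[OF cont_const])
lemma cont_diff: "cont f \<Longrightarrow> cont g \<Longrightarrow> cont (\<lambda>x. f x - g x)" 
  using cont_add[of f "\<lambda>x. (-1) * g x"] cont_scale[of g "-1"] by simp
lemma cont_sum: "finite I \<Longrightarrow> (\<And>i. i \<in> I \<Longrightarrow> cont (f i)) \<Longrightarrow> cont (\<lambda>x. \<Sum>i\<in>I. f i x)"
  by (intro continuous_map_sum)

lemmas cont_intros = cont_add cont_mult cont_const cont_scale cont_diff cont_sum continuous_map_complex_of_real

lemma action_class:
  assumes "cont f" "\<xi> \<in> Lp M"
  shows "cls M (action f \<xi>) = \<pi> (restrict f (topspace X)) (cls M \<xi>)"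
    and action_in: "action f \<xi> \<in> Lp M"
proof -
  have "\<pi> (restrict f (topspace X)) (cls M \<xi>) \<in> carr (Lp_space p M)"
    by (rule E.op_carrD(1)[OF rep_op[OF restrict_in_C[OF assms(1)]] Lp_class_in[OF assms(2)]])
  then show "cls M (action f \<xi>) = \<pi> (restrict f (topspace X)) (cls M \<xi>)" "action f \<xi> \<in> Lp M"
    unfolding action_def by (rule Lp_class_of_rep Lp_rep_in)+
qed

lemma action_cong_AE:
  assumes "\<xi> \<in> Lp M" "\<eta> \<in> Lp M" "AE x in M. \<xi> x = \<eta> x"
  shows "action f \<xi> = action f \<eta>"
  unfolding action_def using Lp_class_eq_iff[OF assms(1,2)] assms(3) by simp

lemma action_cong: "(\<And>x. x \<in> topspace X \<Longrightarrow> f x = g x) \<Longrightarrow> action f = action g"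
  unfolding action_def using restrict_ext[of "topspace X" f g] by (intro ext) metis

lemma action_AE_I:
  assumes "\<eta> \<in> Lp M" "\<zeta> \<in> Lp M" "cls M \<eta> = cls M \<zeta>"
  shows "AE x in M. \<eta> x = \<zeta> x"
  using Lp_class_eq_iff[OF assms(1,2)] assms(3) by simp

lemma action_add:
  assumes "cont f" "cont g" "\<xi> \<in> Lp M"
  shows "AE y in M. action (\<lambda>x. f x + g x) \<xi> y = action f \<xi> y + action g \<xi> y"
proof (rule action_AE_I)
  let ?r = "\<lambda>f. restrict f (topspace X)"
  have "?r (\<lambda>x. f x + g x) = add_of (C_algebra X) (?r f) (?r g)" by (auto simp: C_ops intro!: restrict_ext)
  then have "\<pi> (?r (\<lambda>x. f x + g x)) = add_of (Lp_operators p M) (\<pi> (?r f)) (\<pi> (?r g))"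
    using rep restrict_in_C[OF assms(1)] restrict_in_C[OF assms(2)] by (simp add: isometric_hom_def)
  then show "cls M (action (\<lambda>x. f x + g x) \<xi>) = cls M (\<lambda>y. action f \<xi> y + action g \<xi> y)"
    using assms by (simp add: action_class cont_add bounded_operators_def Lp_class_in flip: add_of_Lp_class[OF action_in action_in])
qed (intro action_in cont_add Lp_fun_add assms)+

lemma action_scale:
  assumes "cont f" "\<xi> \<in> Lp M"
  shows "AE y in M. action (\<lambda>x. c * f x) \<xi> y = c * action f \<xi> y"
proof (rule action_AE_I)
  let ?r = "\<lambda>f. restrict f (topspace X)"
  have "?r (\<lambda>x. c * f x) = scale_of (C_algebra X) c (?r f)" by (auto simp: C_ops intro!: restrict_ext)
  then have "\<pi> (?r (\<lambda>x. c * f x)) = scale_of (Lp_operators p M) c (\<pi> (?r f))"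
    using rep restrict_in_C[OF assms(1)] by (simp add: isometric_hom_def)
  then show "cls M (action (\<lambda>x. c * f x) \<xi>) = cls M (\<lambda>y. c * action f \<xi> y)"
    using assms by (simp add: action_class cont_scale bounded_operators_def Lp_class_in flip: scale_of_Lp_class[OF action_in])
qed (intro action_in cont_scale Lp_fun_scale assms)+

lemma action_mult:
  assumes "cont f" "cont g" "\<xi> \<in> Lp M"
  shows "AE y in M. action (\<lambda>x. f x * g x) \<xi> y = action f (action g \<xi>) y"
proof (rule action_AE_I)
  let ?r = "\<lambda>f. restrict f (topspace X)"
  have "?r (\<lambda>x. f x * g x) = mult_of (C_algebra X) (?r f) (?r g)" by (auto simp: C_ops intro!: restrict_ext)
  then have "\<pi> (?r (\<lambda>x. f x * g x)) = mult_of (Lp_operators p M) (\<pi> (?r f)) (\<pi> (?r g))"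
    using rep restrict_in_C[OF assms(1)] restrict_in_C[OF assms(2)] by (simp add: isometric_hom_def)
  then show "cls M (action (\<lambda>x. f x * g x) \<xi>) = cls M (action f (action g \<xi>))"
    using assms by (simp add: action_class cont_mult bounded_operators_def Lp_class_in action_in)
qed (intro action_in cont_mult assms)+

lemma action_vec_add:
  assumes "cont f" "\<xi> \<in> Lp M" "\<eta> \<in> Lp M"
  shows "AE y in M. action f (\<lambda>x. \<xi> x + \<eta> x) y = action f \<xi> y + action f \<eta> y"
proof (rule action_AE_I)
  show "cls M (action f (\<lambda>x. \<xi> x + \<eta> x)) = cls M (\<lambda>y. action f \<xi> y + action f \<eta> y)"
    using assms E.op_carrD(3)[OF rep_op[OF restrict_in_C[OF assms(1)]] Lp_class_in[OF assms(2)] Lp_class_in[OF assms(3)]]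
    by (simp add: action_class Lp_fun_add add_of_Lp_class flip: add_of_Lp_class[OF action_in action_in])
qed (intro action_in Lp_fun_add assms)+

lemma action_vec_scale:
  assumes "cont f" "\<xi> \<in> Lp M"
  shows "AE y in M. action f (\<lambda>x. c * \<xi> x) y = c * action f \<xi> y"
proof (rule action_AE_I)
  show "cls M (action f (\<lambda>x. c * \<xi> x)) = cls M (\<lambda>y. c * action f \<xi> y)"
    using assms E.op_carrD(4)[OF rep_op[OF restrict_in_C[OF assms(1)]] Lp_class_in[OF assms(2)], of c]
    by (simp add: action_class Lp_fun_scale scale_of_Lp_class flip: scale_of_Lp_class[OF action_in])
qed (intro action_in Lp_fun_scale assms)+

lemma norm_rep: "f \<in> carr (C_algebra X) \<Longrightarrow> norm_of (Lp_operators p M) (\<pi> f) = norm_of (C_algebra X) f"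
  using rep by (simp add: isometric_hom_def)

lemma norm_action: 
  assumes "cont f" "\<xi> \<in> Lp M"
  shows "nrm M (action f \<xi>) = norm_of (Lp_space p M) (\<pi> (restrict f (topspace X)) (cls M \<xi>))"
  using norm_of_Lp_class[OF action_in[OF assms]] action_class[OF assms] by simp

lemma action_norm_le:
  assumes f: "cont f" and \<xi>: "\<xi> \<in> Lp M" and B: "0 \<le> B" "\<And>x. x \<in> topspace X \<Longrightarrow> cmod (f x) \<le> B"
  shows "nrm M (action f \<xi>) \<le> B * nrm M \<xi>"
proof -
  let ?r = "restrict f (topspace X)"
  have "nrm M (action f \<xi>) \<le> norm_of (Lp_operators p M) (\<pi> ?r) * nrm M \<xi>"
    unfolding norm_action[OF f \<xi>]
    using E.op_norm_ge[OF rep_op[OF restrict_in_C[OF f]] Lp_class_in[OF \<xi>]] by (simp add: norm_of_Lp_class \<xi>)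
  also have "norm_of (Lp_operators p M) (\<pi> ?r) = norm_of (C_algebra X) ?r" by (rule norm_rep[OF restrict_in_C[OF f]])
  also have "\<dots> * nrm M \<xi> \<le> B * nrm M \<xi>"
    using B by (intro mult_right_mono C_norm_le Lp_norm_nonneg) auto
  finally show ?thesis .
qed

text \<open>Isometry of \<open>\<pi>\<close> enters the lower bound for matrix norms through this lemma.\<close>

lemma action_norm_attained:
  assumes f: "cont f" and x: "x \<in> topspace X" and c: "c < cmod (f x)"
  shows "\<exists>\<xi>\<in>Lp M. nrm M \<xi> \<le> 1 \<and> c < nrm M (action f \<xi>)"
proof (rule ccontr)
  assume neg: "\<not> ?thesis"
  let ?r = "restrict f (topspace X)"
  have "norm_of (Lp_operators p M) (\<pi> ?r) \<le> c"
  proof (rule E.op_norm_le)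
    fix \<Xi> assume "\<Xi> \<in> carr (Lp_space p M)" "norm_of (Lp_space p M) \<Xi> \<le> 1"
    then obtain \<xi> where \<xi>: "\<xi> \<in> Lp M" "\<Xi> = cls M \<xi>" "nrm M \<xi> \<le> 1"
      by (metis carr_LpE norm_of_Lp_class)
    then show "norm_of (Lp_space p M) (\<pi> ?r \<Xi>) \<le> c"
      using neg norm_action[OF f \<xi>(1)] by (metis linorder_not_less)
  qed
  moreover have "cmod (?r x) \<le> norm_of (C_algebra X) ?r"
    by (intro C_norm_ge compact x continuous_map_restrict_iff[THEN iffD2] f)
  ultimately show False using c x norm_rep[OF restrict_in_C[OF f]] by simp
qed

lemma action_zero:
  assumes "\<And>x. x \<in> topspace X \<Longrightarrow> f x = 0" "\<xi> \<in> Lp M"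
  shows "AE y in M. action f \<xi> y = 0"
proof -
  have eq: "action f = action (\<lambda>x. 0)" using assms(1) by (rule action_cong)
  have "nrm M (action (\<lambda>x. 0) \<xi>) \<le> 0 * nrm M \<xi>" by (rule action_norm_le) (auto simp: assms)
  then have "nrm M (action (\<lambda>x. 0) \<xi>) = 0" using Lp_norm_nonneg[of M] by (simp add: antisym)
  then show ?thesis unfolding eq using Lp_norm_eq_0[OF action_in[OF cont_const assms(2)]] by simp
qed

lemma action_sum:
  assumes "finite I" "\<And>i. i \<in> I \<Longrightarrow> cont (f i)" "\<xi> \<in> Lp M"
  shows "AE y in M. action (\<lambda>x. \<Sum>i\<in>I. f i x) \<xi> y = (\<Sum>i\<in>I. action (f i) \<xi> y)"
  using assms(1,2)
proof (induction I)
  case empty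
  show ?case using action_zero[OF _ assms(3), of "\<lambda>x. 0"] by simp
next
  case (insert i I)
  have "AE y in M. action (\<lambda>x. f i x + (\<Sum>i\<in>I. f i x)) \<xi> y = action (f i) \<xi> y + action (\<lambda>x. \<Sum>i\<in>I. f i x) \<xi> y"
    using insert by (intro action_add assms(3) cont_sum) auto
  moreover have "AE y in M. action (\<lambda>x. \<Sum>i\<in>I. f i x) \<xi> y = (\<Sum>i\<in>I. action (f i) \<xi> y)" using insert by simp
  ultimately show ?case by eventually_elim (use insert in simp)
qed

lemma action_disjoint_separated:
  assumes p2: "p \<noteq> 2" and c: "cont f" "cont g" "cont f1" "cont g1"
    and f1: "\<And>x. x \<in> topspace X \<Longrightarrow> f1 x * f x = f x" "\<And>x. x \<in> topspace X \<Longrightarrow> f1 x * g x = 0"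
    and g1: "\<And>x. x \<in> topspace X \<Longrightarrow> g1 x * g x = g x" "\<And>x. x \<in> topspace X \<Longrightarrow> g1 x * f x = 0"
    and le: "\<And>x z. x \<in> topspace X \<Longrightarrow> z \<in> fourth_roots \<Longrightarrow> cmod (f1 x + z * g1 x) \<le> 1"
    and \<xi>: "\<xi> \<in> Lp M" and \<eta>: "\<eta> \<in> Lp M"
  shows "AE y in M. action f \<xi> y * action g \<eta> y = 0"
proof -
  let ?u = "action f \<xi>" and ?w = "action g \<eta>"
  have u: "?u \<in> Lp M" and w: "?w \<in> Lp M" using c \<xi> \<eta> by (auto intro: action_in)
  have fix_: "AE y in M. action h (action k \<zeta>) y = action k \<zeta> y"
    if "cont h" "cont k" "\<And>x. x \<in> topspace X \<Longrightarrow> h x * k x = k x" "\<zeta> \<in> Lp M" for h k \<zeta>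
    using action_mult[OF that(1,2,4)] action_cong[OF that(3)] by (auto elim: eventually_mono)
  have kill: "AE y in M. action h (action k \<zeta>) y = 0"
    if "cont h" "cont k" "\<And>x. x \<in> topspace X \<Longrightarrow> h x * k x = 0" "\<zeta> \<in> Lp M" for h k \<zeta>
  proof -
    have "AE y in M. action (\<lambda>x. h x * k x) \<zeta> y = 0" by (rule action_zero) (use that in auto)
    then show ?thesis using action_mult[OF that(1,2,4)] by eventually_elim simp
  qed
  have lin: "AE y in M. action h (\<lambda>y. ?u y + a * ?w y + b * \<zeta> y) y = action h ?u y + a * action h ?w y + b * action h \<zeta> y"
    if "cont h" "\<zeta> \<in> Lp M" for h a b \<zeta>
    using action_vec_add[OF that(1) Lp_fun_add[OF u Lp_fun_scale[OF w, of a]] Lp_fun_scale[OF that(2), of b]]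
      action_vec_add[OF that(1) u Lp_fun_scale[OF w, of a]] action_vec_scale[OF that(1) w, of a] action_vec_scale[OF that, of b]
    by eventually_elim simp
  have F: "AE y in M. action f1 ?u y = ?u y" "AE y in M. action f1 ?w y = 0"
    "AE y in M. action g1 ?w y = ?w y" "AE y in M. action g1 ?u y = 0"
    by (rule fix_ kill; use c f1 g1 \<xi> \<eta> in blast)+
  show ?thesis
  proof (rule disjoint_of_contractive_rotations[OF p2 u w, of "action f1" "action g1"])
    fix \<zeta> assume \<zeta>: "\<zeta> \<in> Lp M"
    show "action f1 \<zeta> \<in> Lp M" "action g1 \<zeta> \<in> Lp M" using c \<zeta> by (auto intro: action_in)
    show "nrm M (\<lambda>x. action f1 \<zeta> x + z * action g1 \<zeta> x) \<le> nrm M \<zeta>" if z: "z \<in> fourth_roots" for z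
    proof -
      have "nrm M (\<lambda>x. action f1 \<zeta> x + z * action g1 \<zeta> x) = nrm M (action (\<lambda>x. f1 x + z * g1 x) \<zeta>)"
      proof (rule Lp_norm_cong_AE)
        show "AE x in M. action f1 \<zeta> x + z * action g1 \<zeta> x = action (\<lambda>x. f1 x + z * g1 x) \<zeta> x"
          using action_add[OF c(3) cont_scale[OF c(4), of z] \<zeta>] action_scale[OF c(4) \<zeta>, of z] by eventually_elim simp
      qed (intro Lp_funD(1) Lp_fun_add Lp_fun_scale action_in c \<zeta> cont_intros)+
      also have "\<dots> \<le> 1 * nrm M \<zeta>" using le[OF _ z] by (intro action_norm_le cont_intros c \<zeta>) auto
      finally show ?thesis by simp
    qed
    show "AE x in M. action f1 (\<lambda>x. ?u x + a * ?w x + b * \<zeta> x) x = ?u x + b * action f1 \<zeta> x" for a b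
      using lin[OF c(3) \<zeta>, of a b] F(1,2) by eventually_elim simp
    show "AE x in M. action g1 (\<lambda>x. ?u x + a * ?w x + b * \<zeta> x) x = a * ?w x + b * action g1 \<zeta> x" for a b
      using lin[OF c(4) \<zeta>, of a b] F(3,4) by eventually_elim simp
  qed
qed

text \<open>Truncation reduces \<open>f g = 0\<close> to separated supports: \<open>trunc n f\<close> is supported where
  \<open>n \<bar>f\<bar> > 1\<close>, the function \<open>plateau n f\<close> is \<open>1\<close> there and vanishes where \<open>f\<close> does, and
  \<open>\<bar>f - trunc n f\<bar> \<le> 2 / n\<close>. The minimum \<open>m\<close> of \<open>\<bar>\<pi>(f) \<xi>\<bar>\<close> and \<open>\<bar>\<pi>(g) \<eta>\<bar>\<close> is bounded by the
  sum of the two errors of this approximation.\<close>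

lemma action_disjoint:
  assumes p2: "p \<noteq> 2" and f: "cont f" and g: "cont g" and fg: "\<And>x. x \<in> topspace X \<Longrightarrow> f x * g x = 0"
    and \<xi>: "\<xi> \<in> Lp M" and \<eta>: "\<eta> \<in> Lp M"
  shows "AE y in M. action f \<xi> y * action g \<eta> y = 0"
proof -
  define plateau where "plateau n h x = complex_of_real (min 1 (real n * cmod (h x)))" for n and h :: "'x \<Rightarrow> complex" and x
  define trunc where "trunc n h x = h x * complex_of_real (max 0 (min 1 (real n * cmod (h x) - 1)))" for n and h :: "'x \<Rightarrow> complex" and x
  have cnorm: "cont_real (\<lambda>x. cmod (h x))" if "cont h" for h
    using that by (simp add: continuous_map_euclidean_iff tendsto_norm)
  have cp: "cont (plateau n h)" and ct: "cont (trunc n h)" if "cont h" for h n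
    unfolding plateau_def trunc_def using cnorm[OF that] that
    by (auto intro!: cont_intros continuous_map_real_min continuous_map_real_max continuous_map_real_mult continuous_map_diff)
  have pt: "plateau n h x * trunc n h x = trunc n h x" for n h x
    by (auto simp: plateau_def trunc_def min_def max_def)
  have le: "cmod (h x - trunc n h x) \<le> 2 / real n" if "0 < n" for n h x
  proof -
    let ?t = "max 0 (min 1 (real n * cmod (h x) - 1))"
    have "h x - trunc n h x = h x * of_real (1 - ?t)" by (simp add: trunc_def algebra_simps)
    then have "cmod (h x - trunc n h x) = cmod (h x) * \<bar>1 - ?t\<bar>" by (simp only: norm_mult norm_of_real)
    then have eq: "cmod (h x - trunc n h x) = cmod (h x) * (1 - ?t)" by simp
    show ?thesis
    proof (cases "real n * cmod (h x) \<le> 2")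
      case True
      have "cmod (h x) * (1 - ?t) \<le> cmod (h x) * 1" by (intro mult_left_mono) auto
      also have "\<dots> \<le> 2 / real n" using True that by (simp add: field_simps)
      finally show ?thesis unfolding eq .
    next
      case False
      then have "?t = 1" by simp
      then show ?thesis unfolding eq using that by simp
    qed
  qed
  let ?u = "action f \<xi>" and ?w = "action g \<eta>"
  let ?un = "\<lambda>n. action (trunc n f) \<xi>" and ?wn = "\<lambda>n. action (trunc n g) \<eta>"
  have L: "?u \<in> Lp M" "?w \<in> Lp M" "?un n \<in> Lp M" "?wn n \<in> Lp M" for n
    by (intro action_in f g \<xi> \<eta> ct)+
  note [measurable] = L[THEN Lp_funD(1)]
  have dis: "AE y in M. ?un n y * ?wn n y = 0" for n
  proof (rule action_disjoint_separated[OF p2, where ?f1.0="plateau n f" and ?g1.0="plateau n g"])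
    fix x z assume x: "x \<in> topspace X"
    have z: "f x = 0 \<or> g x = 0" using fg[OF x] by simp
    then show "plateau n f x * trunc n g x = 0" "plateau n g x * trunc n f x = 0"
      by (auto simp: plateau_def trunc_def)
    show "plateau n f x * trunc n f x = trunc n f x" "plateau n g x * trunc n g x = trunc n g x" by (rule pt)+
    assume "z \<in> fourth_roots"
    then have "cmod z = 1" by auto
    then show "cmod (plateau n f x + z * plateau n g x) \<le> 1" using z by (auto simp: plateau_def norm_mult)
  qed (intro cp ct f g \<xi> \<eta>)+
  have diff: "nrm M (\<lambda>y. action h \<zeta> y - action (trunc n h) \<zeta> y) \<le> 2 / real n * nrm M \<zeta>"
    if h: "cont h" and \<zeta>: "\<zeta> \<in> Lp M" and n: "0 < n" for h \<zeta> n
  proof -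
    have "AE y in M. action (\<lambda>x. h x + (-1) * trunc n h x) \<zeta> y = action h \<zeta> y - action (trunc n h) \<zeta> y"
      using action_add[OF h cont_scale[OF ct[OF h, of n], of "-1"] \<zeta>] action_scale[OF ct[OF h, of n] \<zeta>, of "-1"]
      by eventually_elim simp
    then have "nrm M (\<lambda>y. action h \<zeta> y - action (trunc n h) \<zeta> y) = nrm M (action (\<lambda>x. h x + (-1) * trunc n h x) \<zeta>)"
      by (intro Lp_norm_cong_AE Lp_funD(1) Lp_fun_diff action_in cont_intros h \<zeta> ct) (auto elim: eventually_mono)
    also have "\<dots> \<le> 2 / real n * nrm M \<zeta>"
      using le[OF n] by (intro action_norm_le cont_intros h \<zeta> ct) auto
    finally show ?thesis .
  qed
  define m where "m y = complex_of_real (min (cmod (?u y)) (cmod (?w y)))" for y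
  have mm [measurable]: "m \<in> borel_measurable M" unfolding m_def[abs_def] by measurable
  have mL: "m \<in> Lp M" by (rule Lp_fun_dominated[OF mm L(1)]) (simp add: m_def)
  have "nrm M m \<le> 2 / real n * (nrm M \<xi> + nrm M \<eta>)" if n: "0 < n" for n
  proof -
    let ?a = "\<lambda>y. complex_of_real (cmod (?u y - ?un n y))" and ?b = "\<lambda>y. complex_of_real (cmod (?w y - ?wn n y))"
    have ab: "?a \<in> Lp M" "?b \<in> Lp M"
      using Lp_fun_diff[OF L(1) L(3)[of n]] Lp_fun_diff[OF L(2) L(4)[of n]] by (auto simp: Lp_fun_def)
    have "nrm M m \<le> nrm M (\<lambda>y. ?a y + ?b y)"
    proof (rule Lp_norm_mono[OF mm Lp_fun_add[OF ab]])
      show "AE y in M. cmod (m y) \<le> cmod (?a y + ?b y)"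
        using dis[of n]
      proof eventually_elim
        case (elim y)
        then show ?case by (auto simp: m_def min_le_iff_disj simp flip: of_real_add)
      qed
    qed
    also have "\<dots> \<le> nrm M ?a + nrm M ?b" by (rule Lp_norm_triangle[OF ab])
    also have "nrm M ?a = nrm M (\<lambda>y. ?u y - ?un n y)" by (simp add: Lp_norm_def)
    also have "nrm M ?b = nrm M (\<lambda>y. ?w y - ?wn n y)" by (simp add: Lp_norm_def)
    finally show ?thesis using diff[OF f \<xi> n] diff[OF g \<eta> n] by (simp add: distrib_left)
  qed
  then have "nrm M m \<le> 2 / real (Suc n) * (nrm M \<xi> + nrm M \<eta>)" for n by blast
  moreover have "(\<lambda>n. 2 / real (Suc n) * (nrm M \<xi> + nrm M \<eta>)) \<longlonglongrightarrow> 0 * (nrm M \<xi> + nrm M \<eta>)"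
    by (intro tendsto_mult tendsto_const LIMSEQ_Suc[OF lim_const_over_n])
  ultimately have "nrm M m \<le> 0" using LIMSEQ_le_const by (metis (no_types, lifting) mult_zero_left)
  then have "nrm M m = 0" using Lp_norm_nonneg[of M m] by simp
  then have "AE y in M. m y = 0" using Lp_norm_eq_0[OF mL] by simp
  then show ?thesis by eventually_elim (auto simp: m_def min_def split: if_splits)
qed

section \<open>Almost disjoint partitions\<close>

definition clamp01 :: "real \<Rightarrow> real" where "clamp01 t = max 0 (min 1 t)"

lemma action_of_real_le:
  assumes "cont_real f" "\<xi> \<in> Lp M" "\<And>x. x \<in> topspace X \<Longrightarrow> \<bar>f x\<bar> \<le> 1"
  shows "nrm M (action (\<lambda>x. of_real (f x)) \<xi>) \<le> nrm M \<xi>"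
  using action_norm_le[of "\<lambda>x. of_real (f x)" \<xi> 1] assms by (simp add: continuous_map_complex_of_real)

text \<open>Pigeonhole: as the functions \<open>\<gamma> \<tau>\<close> have mutual products \<open>0\<close>, the \<open>p\<close>-th powers of the norms
  of \<open>\<pi>(\<gamma> \<tau>) \<xi>\<close> add up to that of \<open>\<pi>(\<Sum> \<gamma> \<tau>) \<xi>\<close>, which is at most that of \<open>\<xi>\<close>.\<close>

lemma small_layer:
  assumes p2: "p \<noteq> 2" and fin: "finite J" and \<xi>: "\<And>j. j \<in> J \<Longrightarrow> \<xi> j \<in> Lp M"
    and \<gamma>: "\<And>\<tau>. \<tau> < L \<Longrightarrow> cont_real (\<gamma> \<tau>)" "\<And>\<tau> x. \<tau> < L \<Longrightarrow> x \<in> topspace X \<Longrightarrow> \<bar>\<gamma> \<tau> x\<bar> \<le> 1"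
    and dis: "\<And>\<tau> \<sigma> x. \<tau> < L \<Longrightarrow> \<sigma> < L \<Longrightarrow> \<tau> \<noteq> \<sigma> \<Longrightarrow> x \<in> topspace X \<Longrightarrow> \<gamma> \<tau> x = 0 \<or> \<gamma> \<sigma> x = 0"
    and L: "0 < L"
  shows "\<exists>\<tau><L. (\<Sum>j\<in>J. nrm M (action (\<lambda>x. of_real (\<gamma> \<tau> x)) (\<xi> j)) powr p)
    \<le> (\<Sum>j\<in>J. nrm M (\<xi> j) powr p) / real L"
proof (rule ccontr)
  let ?a = "\<lambda>\<tau>. action (\<lambda>x. complex_of_real (\<gamma> \<tau> x))"
  let ?S = "\<lambda>\<tau>. \<Sum>j\<in>J. nrm M (?a \<tau> (\<xi> j)) powr p"
  let ?C = "\<Sum>j\<in>J. nrm M (\<xi> j) powr p"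
  assume "\<not> ?thesis"
  then have "?C / real L < ?S \<tau>" if "\<tau> < L" for \<tau> using that by force
  then have "(\<Sum>\<tau><L. ?C / real L) < (\<Sum>\<tau><L. ?S \<tau>)" using L by (intro sum_strict_mono) auto
  then have "?C < (\<Sum>\<tau><L. ?S \<tau>)" using L by simp
  also have "\<dots> = (\<Sum>j\<in>J. \<Sum>\<tau><L. nrm M (?a \<tau> (\<xi> j)) powr p)" by (rule sum.swap)
  also have "\<dots> \<le> ?C"
  proof (rule sum_mono)
    fix j assume j: "j \<in> J"
    have c: "cont (\<lambda>x. complex_of_real (\<gamma> \<tau> x))" if "\<tau> < L" for \<tau>
      using \<gamma>(1)[OF that] by (rule continuous_map_complex_of_real)
    have aL: "?a \<tau> (\<xi> j) \<in> Lp M" if "\<tau> < L" for \<tau> using c[OF that] \<xi>[OF j] by (rule action_in)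
    have "AE y in M. \<forall>\<tau>\<in>{..<L}. \<forall>\<sigma>\<in>{..<L}. \<tau> \<noteq> \<sigma> \<longrightarrow> ?a \<tau> (\<xi> j) y * ?a \<sigma> (\<xi> j) y = 0"
    proof (intro AE_finite_allI finite_lessThan)
      fix \<tau> \<sigma> assume "\<tau> \<in> {..<L}" "\<sigma> \<in> {..<L}"
      then show "AE y in M. \<tau> \<noteq> \<sigma> \<longrightarrow> ?a \<tau> (\<xi> j) y * ?a \<sigma> (\<xi> j) y = 0"
        using action_disjoint[OF p2 c c _ \<xi>[OF j] \<xi>[OF j], of \<tau> \<sigma>] dis[of \<tau> \<sigma>]
        by (cases "\<tau> = \<sigma>") auto
    qed
    then have AE: "AE y in M. cmod (\<Sum>\<tau><L. ?a \<tau> (\<xi> j) y) powr p = (\<Sum>\<tau><L. cmod (?a \<tau> (\<xi> j) y) powr p)"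
      by eventually_elim (rule sum_of_disjoint[where F="\<lambda>a. cmod a powr p"], auto)
    have "(\<Sum>\<tau><L. nrm M (?a \<tau> (\<xi> j)) powr p) = (\<integral>y. (\<Sum>\<tau><L. cmod (?a \<tau> (\<xi> j) y) powr p) \<partial>M)"
      unfolding Lp_norm_powr using Lp_funD(2)[OF aL] by (intro Bochner_Integration.integral_sum[symmetric]) auto
    also have "\<dots> = (\<integral>y. cmod (\<Sum>\<tau><L. ?a \<tau> (\<xi> j) y) powr p \<partial>M)"
    proof (rule integral_cong_AE)
      show "(\<lambda>y. \<Sum>\<tau><L. cmod (?a \<tau> (\<xi> j) y) powr p) \<in> borel_measurable M"
        using aL by (intro borel_measurable_sum borel_measurable_integrable Lp_funD(2)) auto
      show "(\<lambda>y. cmod (\<Sum>\<tau><L. ?a \<tau> (\<xi> j) y) powr p) \<in> borel_measurable M"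
        using aL by (intro borel_measurable_integrable Lp_funD(2) Lp_fun_sum) auto
    qed (use AE in \<open>auto elim: eventually_mono\<close>)
    also have "\<dots> = nrm M (\<lambda>y. \<Sum>\<tau><L. ?a \<tau> (\<xi> j) y) powr p" unfolding Lp_norm_powr ..
    also have "nrm M (\<lambda>y. \<Sum>\<tau><L. ?a \<tau> (\<xi> j) y) = nrm M (action (\<lambda>x. \<Sum>\<tau><L. of_real (\<gamma> \<tau> x)) (\<xi> j))"
      using action_sum[of "{..<L}" "\<lambda>\<tau> x. of_real (\<gamma> \<tau> x)" "\<xi> j"] c \<xi>[OF j] aL
      by (intro Lp_norm_cong_AE Lp_funD(1) Lp_fun_sum action_in cont_sum) (auto elim: eventually_mono)
    also have "\<dots> powr p \<le> nrm M (\<xi> j) powr p"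
    proof (rule powr_mono2[OF less_imp_le[OF p_pos] Lp_norm_nonneg], rule order_trans[OF action_norm_le[where B=1]])
      fix x assume x: "x \<in> topspace X"
      have "cmod (\<Sum>\<tau><L. complex_of_real (\<gamma> \<tau> x)) = \<bar>\<Sum>\<tau><L. \<gamma> \<tau> x\<bar>" by (simp flip: of_real_sum)
      also have "\<dots> \<le> 1"
      proof (cases "\<exists>\<tau><L. \<gamma> \<tau> x \<noteq> 0")
        case True
        then obtain \<tau> where t: "\<tau> < L" "\<gamma> \<tau> x \<noteq> 0" by blast
        then have "\<gamma> \<sigma> x = 0" if "\<sigma> < L" "\<sigma> \<noteq> \<tau>" for \<sigma> using dis[OF t(1) that(1) _ x] that by auto
        then have "(\<Sum>\<tau><L. \<gamma> \<tau> x) = (\<Sum>\<tau>\<in>{\<tau>}. \<gamma> \<tau> x)" using t by (intro sum.mono_neutral_right) auto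
        then show ?thesis using \<gamma>(2)[OF t(1) x] by simp
      qed simp
      finally show "cmod (\<Sum>\<tau><L. complex_of_real (\<gamma> \<tau> x)) \<le> 1" .
    qed (use c \<xi>[OF j] in \<open>auto intro: cont_sum\<close>)
    finally show "(\<Sum>\<tau><L. nrm M (?a \<tau> (\<xi> j)) powr p) \<le> nrm M (\<xi> j) powr p" .
  qed
  finally show False by simp
qed

lemma normal: "normal_space X"
  using compact metrizable by (simp add: metrizable_imp_normal_space)

text \<open>Take a Urysohn function \<open>f\<close> that is \<open>0\<close> off \<open>V\<close> and \<open>1\<close> off \<open>U\<close>, and cut \<open>[0, 1]\<close> into \<open>L\<close>
  layers of equal width. For the layer \<open>\<tau>\<close> let \<open>\<phi>\<close> descend from \<open>1\<close> to \<open>0\<close> in its lower half and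
  let \<open>\<psi>\<close> ascend from \<open>0\<close> to \<open>1\<close> in its upper half, as functions of \<open>f\<close>. The gap
  \<open>1 - \<phi> - \<psi>\<close> is supported in the layer, so for some \<open>\<tau>\<close> it is small on the given vectors. The
  closed set \<open>K\<close> between the support of \<open>\<phi>\<close> and \<open>U\<close> is what an induction on covers needs.\<close>

lemma almost_partition_of_two:
  assumes p2: "p \<noteq> 2" and U: "openin X U" and V: "openin X V" and UV: "topspace X \<subseteq> U \<union> V"
    and fin: "finite J" and \<xi>: "\<And>j. j \<in> J \<Longrightarrow> \<xi> j \<in> Lp M" and \<epsilon>: "0 < \<epsilon>"
  obtains \<phi> \<psi> :: "'x \<Rightarrow> real" and K
  where "cont_real \<phi>" "cont_real \<psi>" "\<And>x. 0 \<le> \<phi> x \<and> \<phi> x \<le> 1" "\<And>x. 0 \<le> \<psi> x \<and> \<psi> x \<le> 1"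
    "\<And>x. \<phi> x = 0 \<or> \<psi> x = 0" "closedin X K" "K \<subseteq> U" "\<And>x. x \<in> topspace X \<Longrightarrow> \<phi> x \<noteq> 0 \<Longrightarrow> x \<in> K"
    "\<And>x. x \<in> topspace X \<Longrightarrow> \<psi> x \<noteq> 0 \<Longrightarrow> x \<in> V"
    "\<And>j. j \<in> J \<Longrightarrow> nrm M (action (\<lambda>x. of_real (1 - \<phi> x - \<psi> x)) (\<xi> j)) \<le> \<epsilon>"
proof -
  have "disjnt (topspace X - V) (topspace X - U)" using UV by (auto simp: disjnt_def)
  then obtain f where f: "continuous_map X (top_of_set {0..1::real}) f"
    and f0: "f ` (topspace X - V) \<subseteq> {0}" and f1: "f ` (topspace X - U) \<subseteq> {1}"
    using Urysohn_lemma[OF normal, of "topspace X - V" "topspace X - U" 0 1] U V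
    by (metis closedin_diff closedin_topspace zero_le_one)
  have fc: "cont_real f" using f continuous_map_into_fulltopology by blast
  define C where "C = (\<Sum>j\<in>J. nrm M (\<xi> j) powr p)"
  obtain n where n: "C / \<epsilon> powr p < real n" using reals_Archimedean2 by blast
  define L where "L = Suc n"
  have CL: "C / real L \<le> \<epsilon> powr p"
  proof -
    have "C / \<epsilon> powr p \<le> real L" using n by (simp add: L_def)
    then have "C \<le> real L * \<epsilon> powr p" using \<epsilon> by (simp add: divide_le_eq)
    then show ?thesis by (simp add: L_def divide_le_eq mult.commute)
  qed
  define r where "r \<tau> x = real L * f x - real \<tau>" for \<tau> :: nat and x
  define \<phi> where "\<phi> \<tau> x = clamp01 (1 - 2 * r \<tau> x)" for \<tau> x
  define \<psi> where "\<psi> \<tau> x = clamp01 (2 * r \<tau> x - 1)" for \<tau> x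
  define \<gamma> where "\<gamma> \<tau> x = 1 - \<phi> \<tau> x - \<psi> \<tau> x" for \<tau> x
  have cc: "cont_real (\<lambda>x. clamp01 (g x))" if "cont_real g" for g
    unfolding clamp01_def by (intro continuous_map_real_max continuous_map_real_min that) simp_all
  have rc: "cont_real (r \<tau>)" for \<tau> unfolding r_def[abs_def]
    by (intro continuous_map_diff continuous_map_real_mult_left fc) simp
  have c\<phi>: "cont_real (\<phi> \<tau>)" for \<tau> unfolding \<phi>_def[abs_def]
    by (intro cc continuous_map_diff continuous_map_real_mult_left rc) simp
  have c\<psi>: "cont_real (\<psi> \<tau>)" for \<tau> unfolding \<psi>_def[abs_def]
    by (intro cc continuous_map_diff continuous_map_real_mult_left rc) simp
  have c\<gamma>: "cont_real (\<gamma> \<tau>)" for \<tau> unfolding \<gamma>_def[abs_def]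
    by (intro continuous_map_diff c\<phi> c\<psi>) simp
  have b: "0 \<le> \<phi> \<tau> x \<and> \<phi> \<tau> x \<le> 1" "0 \<le> \<psi> \<tau> x \<and> \<psi> \<tau> x \<le> 1" "\<phi> \<tau> x = 0 \<or> \<psi> \<tau> x = 0" for \<tau> x
    by (auto simp: \<phi>_def \<psi>_def clamp01_def)
  have g1: "\<bar>\<gamma> \<tau> x\<bar> \<le> 1" for \<tau> x using b[of \<tau> x] unfolding \<gamma>_def by linarith
  have g0: "0 < r \<tau> x \<and> r \<tau> x < 1" if "\<gamma> \<tau> x \<noteq> 0" for \<tau> x
    using that unfolding \<gamma>_def \<phi>_def \<psi>_def clamp01_def by (auto simp: max_def min_def split: if_splits)
  have "\<exists>\<tau><L. (\<Sum>j\<in>J. nrm M (action (\<lambda>x. of_real (\<gamma> \<tau> x)) (\<xi> j)) powr p) \<le> C / real L"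
    unfolding C_def
  proof (rule small_layer[OF p2 fin \<xi>])
    fix \<tau> \<sigma> :: nat and x assume ne: "\<tau> \<noteq> \<sigma>"
    show "\<gamma> \<tau> x = 0 \<or> \<gamma> \<sigma> x = 0"
    proof (rule ccontr)
      assume "\<not> ?thesis"
      then have "0 < r \<tau> x \<and> r \<tau> x < 1" "0 < r \<sigma> x \<and> r \<sigma> x < 1" using g0 by auto
      then have "real \<tau> < real \<sigma> + 1" "real \<sigma> < real \<tau> + 1" unfolding r_def by linarith+
      then show False using ne by linarith
    qed
  qed (auto simp: c\<gamma> g1 L_def)
  then obtain \<tau> where \<tau>: "\<tau> < L" "(\<Sum>j\<in>J. nrm M (action (\<lambda>x. of_real (\<gamma> \<tau> x)) (\<xi> j)) powr p) \<le> C / real L" by blast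
  show thesis
  proof (rule that[OF c\<phi>[of \<tau>] c\<psi>[of \<tau>] b])
    let ?K = "{x \<in> topspace X. f x \<in> {..1 - 1 / (2 * real L)}}"
    show "closedin X ?K" by (rule closedin_continuous_map_preimage[OF fc]) simp
    show "?K \<subseteq> U"
    proof
      fix x assume x: "x \<in> ?K"
      then have "f x \<noteq> 1" by (auto simp: L_def)
      then show "x \<in> U" using x f1 by auto
    qed
    show "x \<in> ?K" if "x \<in> topspace X" "\<phi> \<tau> x \<noteq> 0" for x
    proof -
      have "1 - 2 * r \<tau> x > 0" using that(2) unfolding \<phi>_def clamp01_def by (auto simp: max_def min_def split: if_splits)
      moreover have "real \<tau> \<le> real L - 1" using \<tau>(1) by linarith
      moreover have "y \<le> l - 1 / 2" if "0 < 1 - 2 * (y - t)" "t \<le> l - 1" for y t l :: real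
        using that by (simp add: field_simps)
      ultimately have "real L * f x \<le> real L - 1 / 2" unfolding r_def by blast
      moreover have "0 < real L" by (simp add: L_def)
      ultimately have "f x \<le> (real L - 1 / 2) / real L" by (simp add: le_divide_eq mult.commute)
      also have "\<dots> = 1 - 1 / (2 * real L)" using \<open>0 < real L\<close> by (simp add: diff_divide_distrib)
      finally show ?thesis using that(1) by simp
    qed
    show "x \<in> V" if "x \<in> topspace X" "\<psi> \<tau> x \<noteq> 0" for x
    proof -
      have "2 * r \<tau> x - 1 > 0" using that(2) unfolding \<psi>_def clamp01_def by (auto simp: max_def min_def split: if_splits)
      then have "f x \<noteq> 0" unfolding r_def by auto
      then show ?thesis using f0 that(1) by auto
    qed
    show "nrm M (action (\<lambda>x. of_real (1 - \<phi> \<tau> x - \<psi> \<tau> x)) (\<xi> j)) \<le> \<epsilon>" if j: "j \<in> J" for j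
    proof -
      have "nrm M (action (\<lambda>x. of_real (\<gamma> \<tau> x)) (\<xi> j)) powr p \<le> (\<Sum>j\<in>J. nrm M (action (\<lambda>x. of_real (\<gamma> \<tau> x)) (\<xi> j)) powr p)"
        by (rule member_le_sum[OF j _ fin]) simp
      also have "\<dots> \<le> \<epsilon> powr p" using \<tau>(2) CL by linarith
      finally show ?thesis using \<epsilon> unfolding Lp_norm_powr \<gamma>_def by (subst Lp_norm_le_iff) auto
    qed
  qed
qed

text \<open>Induction on the number of open sets. For the step, split \<open>X\<close> into the last set and the union of
  the others with the complement of \<open>C\<close>, and multiply by \<open>\<phi>\<close> the functions obtained for
  \<open>C \<inter> K\<close>. Stating smallness for all \<open>\<kappa>\<close> supported in \<open>C\<close>, rather than for the constant \<open>1\<close>,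
  lets the induction hypothesis be applied with \<open>\<kappa> \<phi>\<close>, which is supported in \<open>C \<inter> K\<close>.\<close>

lemma almost_partition:
  fixes m :: nat
  assumes p2: "p \<noteq> 2" and fin: "finite J" and \<xi>: "\<forall>j\<in>J. \<xi> j \<in> Lp M"
  shows "\<lbrakk>0 < \<epsilon>; closedin X C; \<forall>k<m. openin X (V k); C \<subseteq> (\<Union>k<m. V k)\<rbrakk> \<Longrightarrow>
    \<exists>h :: nat \<Rightarrow> 'x \<Rightarrow> real. (\<forall>k<m. cont_real (h k) \<and> (\<forall>x. 0 \<le> h k x \<and> h k x \<le> 1) \<and> (\<forall>x\<in>topspace X. h k x \<noteq> 0 \<longrightarrow> x \<in> V k)) \<and>
      (\<forall>k<m. \<forall>l<m. k \<noteq> l \<longrightarrow> (\<forall>x. h k x = 0 \<or> h l x = 0)) \<and>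
      (\<forall>\<kappa>. cont_real \<kappa> \<longrightarrow> (\<forall>x. 0 \<le> \<kappa> x \<and> \<kappa> x \<le> 1) \<longrightarrow> (\<forall>x\<in>topspace X. \<kappa> x \<noteq> 0 \<longrightarrow> x \<in> C) \<longrightarrow>
         (\<forall>j\<in>J. nrm M (action (\<lambda>x. of_real (\<kappa> x * (1 - (\<Sum>k<m. h k x)))) (\<xi> j)) \<le> \<epsilon>))"
proof (induction m arbitrary: C \<epsilon>)
  case 0
  have "nrm M (action (\<lambda>x. of_real (\<kappa> x)) (\<xi> j)) \<le> \<epsilon>"
    if "cont_real \<kappa>" "\<forall>x\<in>topspace X. \<kappa> x \<noteq> 0 \<longrightarrow> x \<in> C" "j \<in> J" for \<kappa> :: "'x \<Rightarrow> real" and j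
  proof -
    have "nrm M (action (\<lambda>x. of_real (\<kappa> x)) (\<xi> j)) \<le> 0 * nrm M (\<xi> j)"
      using that 0 \<xi> by (intro action_norm_le continuous_map_complex_of_real) auto
    then show ?thesis using 0 by simp
  qed
  then show ?case by auto
next
  case (Suc m)
  let ?U = "(\<Union>k<m. V k) \<union> (topspace X - C)"
  have U: "openin X ?U" using Suc.prems by (intro openin_Un openin_Union openin_diff) auto
  have V: "openin X (V m)" using Suc.prems by simp
  have UV: "topspace X \<subseteq> ?U \<union> V m" using Suc.prems(4) by (auto simp: lessThan_Suc)
  have e2: "0 < \<epsilon> / 2" using Suc.prems by simp
  obtain \<phi> \<psi> :: "'x \<Rightarrow> real" and K where c\<phi>: "cont_real \<phi>" and c\<psi>: "cont_real \<psi>"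
    and b\<phi>: "\<And>x. 0 \<le> \<phi> x \<and> \<phi> x \<le> 1" and b\<psi>: "\<And>x. 0 \<le> \<psi> x \<and> \<psi> x \<le> 1"
    and dis: "\<And>x. \<phi> x = 0 \<or> \<psi> x = 0" and K: "closedin X K" "K \<subseteq> ?U" "\<And>x. x \<in> topspace X \<Longrightarrow> \<phi> x \<noteq> 0 \<Longrightarrow> x \<in> K"
    and \<psi>V: "\<And>x. x \<in> topspace X \<Longrightarrow> \<psi> x \<noteq> 0 \<Longrightarrow> x \<in> V m"
    and small: "\<And>j. j \<in> J \<Longrightarrow> nrm M (action (\<lambda>x. of_real (1 - \<phi> x - \<psi> x)) (\<xi> j)) \<le> \<epsilon> / 2"
  proof (rule almost_partition_of_two[where \<xi>=\<xi>, OF p2 U V UV fin _ e2], goal_cases)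
    case (1 j)
    from 1(2) show "\<xi> j \<in> Lp M" by (rule bspec[OF \<xi>])
  next
    case (2 \<phi> \<psi> K)
    from 2(2-) show thesis by (rule 2(1))
  qed
  note \<phi> = c\<phi> b\<phi> and \<psi> = c\<psi> b\<psi>
  have "closedin X (C \<inter> K)" "\<forall>k<m. openin X (V k)" "C \<inter> K \<subseteq> (\<Union>k<m. V k)" using K Suc.prems by auto
  note IH = Suc.IH[OF e2 this]
  from IH obtain h :: "nat \<Rightarrow> 'x \<Rightarrow> real" where
    H1: "\<forall>k<m. cont_real (h k) \<and> (\<forall>x. 0 \<le> h k x \<and> h k x \<le> 1) \<and> (\<forall>x\<in>topspace X. h k x \<noteq> 0 \<longrightarrow> x \<in> V k)"
    and H2: "\<forall>k<m. \<forall>l<m. k \<noteq> l \<longrightarrow> (\<forall>x. h k x = 0 \<or> h l x = 0)"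
    and H3: "\<forall>\<kappa>. cont_real \<kappa> \<longrightarrow> (\<forall>x. 0 \<le> \<kappa> x \<and> \<kappa> x \<le> 1) \<longrightarrow> (\<forall>x\<in>topspace X. \<kappa> x \<noteq> 0 \<longrightarrow> x \<in> C \<inter> K) \<longrightarrow>
         (\<forall>j\<in>J. nrm M (action (\<lambda>x. of_real (\<kappa> x * (1 - (\<Sum>k<m. h k x)))) (\<xi> j)) \<le> \<epsilon> / 2)"
    by (elim exE conjE) (rule that)
  have h: "\<And>k. k < m \<Longrightarrow> cont_real (h k)" "\<And>k x. k < m \<Longrightarrow> 0 \<le> h k x \<and> h k x \<le> 1"
      "\<And>k x. k < m \<Longrightarrow> x \<in> topspace X \<Longrightarrow> h k x \<noteq> 0 \<Longrightarrow> x \<in> V k"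
    using H1 by blast+
  have hd: "h k x = 0 \<or> h l x = 0" if "k < m" "l < m" "k \<noteq> l" for k l x
    using H2 that by blast
  define h' where "h' k x = (if k < m then \<phi> x * h k x else \<psi> x)" for k x
  have ch': "cont_real (h' k)" if "k < Suc m" for k
    using continuous_map_real_mult[OF \<phi>(1) h(1), of k] \<psi>(1) unfolding h'_def[abs_def] by (cases "k < m") auto
  have bh': "0 \<le> h' k x \<and> h' k x \<le> 1" for k x
    using \<phi>(2)[of x] \<psi>(2)[of x] h(2)[of k x] by (auto simp: h'_def intro: mult_le_one)
  have Vh': "x \<in> V k" if "k < Suc m" "x \<in> topspace X" "h' k x \<noteq> 0" for k x
    using that h(3)[of k x] \<psi>V[of x] by (auto simp: h'_def less_Suc_eq)
  have dh': "h' k x = 0 \<or> h' l x = 0" if "k < Suc m" "l < Suc m" "k \<noteq> l" for k l x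
    using that dis[of x] hd[of k l x] by (auto simp: h'_def less_Suc_eq)
  have sh': "nrm M (action (\<lambda>x. of_real (\<kappa> x * (1 - (\<Sum>k<Suc m. h' k x)))) (\<xi> j)) \<le> \<epsilon>"
    if \<kappa>: "cont_real \<kappa>" "\<And>x. 0 \<le> \<kappa> x \<and> \<kappa> x \<le> 1" "\<And>x. x \<in> topspace X \<Longrightarrow> \<kappa> x \<noteq> 0 \<Longrightarrow> x \<in> C" and j: "j \<in> J" for \<kappa> j
  proof -
    let ?f = "\<lambda>x. complex_of_real (\<kappa> x) * of_real (1 - \<phi> x - \<psi> x)"
    let ?g = "\<lambda>x. complex_of_real (\<kappa> x * \<phi> x * (1 - (\<Sum>k<m. h k x)))"
    have eq: "complex_of_real (\<kappa> x * (1 - (\<Sum>k<Suc m. h' k x))) = ?f x + ?g x" for x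
    proof -
      have "(\<Sum>k<Suc m. h' k x) = \<phi> x * (\<Sum>k<m. h k x) + \<psi> x"
        by (simp add: h'_def sum_distrib_left)
      then have "\<kappa> x * (1 - (\<Sum>k<Suc m. h' k x)) = \<kappa> x * (1 - \<phi> x - \<psi> x) + \<kappa> x * \<phi> x * (1 - (\<Sum>k<m. h k x))"
        by (simp add: algebra_simps)
      then show ?thesis by (simp only: of_real_add of_real_mult)
    qed
    have c1: "cont_real (\<lambda>x. 1 - \<phi> x - \<psi> x)" by (intro continuous_map_diff \<phi> \<psi>) simp
    have c1': "cont (\<lambda>x. complex_of_real (1 - \<phi> x - \<psi> x))" by (rule continuous_map_complex_of_real[OF c1])
    have cf: "cont ?f" by (intro cont_mult c1' continuous_map_complex_of_real[OF \<kappa>(1)])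
    have cg: "cont ?g" by (intro continuous_map_complex_of_real continuous_map_real_mult \<kappa>(1) \<phi>(1) continuous_map_diff continuous_map_sum h(1)) auto
    have j': "\<xi> j \<in> Lp M" using bspec[OF \<xi> j] .
    have "nrm M (action (\<lambda>x. ?f x + ?g x) (\<xi> j)) = nrm M (\<lambda>y. action ?f (\<xi> j) y + action ?g (\<xi> j) y)"
      by (intro Lp_norm_cong_AE Lp_funD(1) action_add action_in cont_add Lp_fun_add cf cg j')
    also have "\<dots> \<le> nrm M (action ?f (\<xi> j)) + nrm M (action ?g (\<xi> j))"
      by (intro Lp_norm_triangle action_in cf cg j')
    also have "nrm M (action ?f (\<xi> j)) = nrm M (action (\<lambda>x. of_real (\<kappa> x)) (action (\<lambda>x. of_real (1 - \<phi> x - \<psi> x)) (\<xi> j)))"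
      by (intro Lp_norm_cong_AE Lp_funD(1) action_mult action_in cf c1' continuous_map_complex_of_real[OF \<kappa>(1)] j')
    also have "\<dots> \<le> nrm M (action (\<lambda>x. of_real (1 - \<phi> x - \<psi> x)) (\<xi> j))"
      using \<kappa>(2) by (intro action_of_real_le \<kappa>(1) action_in c1' j') auto
    also have "\<dots> \<le> \<epsilon> / 2" by (rule small[OF j])
    also have "nrm M (action ?g (\<xi> j)) \<le> \<epsilon> / 2"
    proof (rule H3[rule_format, OF _ _ _ j])
      show "cont_real (\<lambda>x. \<kappa> x * \<phi> x)" by (intro continuous_map_real_mult \<kappa>(1) \<phi>(1))
      show "0 \<le> \<kappa> x * \<phi> x \<and> \<kappa> x * \<phi> x \<le> 1" for x using \<kappa>(2)[of x] \<phi>(2)[of x] by (auto intro: mult_le_one)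
      show "x \<in> C \<inter> K" if "x \<in> topspace X" "\<kappa> x * \<phi> x \<noteq> 0" for x using that \<kappa>(3) K(3) by auto
    qed
    finally show ?thesis unfolding eq by simp
  qed
  show ?case
  proof (intro exI[of _ h'] conjI allI impI ballI)
    fix k x assume k: "k < Suc m"
    show "cont_real (h' k)" using ch'[OF k] .
    show "0 \<le> h' k x" "h' k x \<le> 1" using bh'[of k x] by auto
    show "x \<in> V k" if "x \<in> topspace X" "h' k x \<noteq> 0" using Vh'[OF k that] .
    show "h' k x = 0 \<or> h' l x = 0" if "l < Suc m" "k \<noteq> l" for l using dh'[OF k that] .
  qed (rule sh'; simp)
qed

end

context Lp_exponent
begin

section \<open>Columns of functions and matrices over \<open>C(X)\<close>\<close>

abbreviation lp :: "'i set \<Rightarrow> ('i \<Rightarrow> complex) \<Rightarrow> real" where "lp I \<equiv> nrm (count_space I)"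

lemma Lp_fun_count_space: "finite I \<Longrightarrow> c \<in> Lp (count_space I)"
  by (simp add: Lp_fun_def integrable_count_space)

lemma Lp_norm_count_space:
  "finite I \<Longrightarrow> lp I c = (\<Sum>i\<in>I. cmod (c i) powr p) powr (1 / p)"
  by (simp add: Lp_norm_def lebesgue_integral_count_space_finite)

lemma Lp_norm_count_space_powr:
  "finite I \<Longrightarrow> lp I c powr p = (\<Sum>i\<in>I. cmod (c i) powr p)"
  by (simp add: Lp_norm_powr lebesgue_integral_count_space_finite)

lemma Lp_norm_count_space_mono:
  assumes "finite I" "\<And>i. i \<in> I \<Longrightarrow> cmod (c i) \<le> cmod (d i)"
  shows "lp I c \<le> lp I d"
  by (rule Lp_norm_mono) (use assms in \<open>auto intro: Lp_fun_count_space simp: AE_count_space\<close>)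

text \<open>The norm of \<open>L\<^sup>p(I \<times> M)\<close> for finite \<open>I\<close>, as the \<open>l\<^sup>p\<close> norm of the norms of the entries.\<close>

definition column_norm :: "'m measure \<Rightarrow> 'i set \<Rightarrow> ('i \<Rightarrow> 'm \<Rightarrow> complex) \<Rightarrow> real" where
  "column_norm M I v = lp I (\<lambda>i. of_real (nrm M (v i)))"

lemma column_norm_nonneg: "0 \<le> column_norm M I v" by (simp add: column_norm_def Lp_norm_nonneg)

lemma column_norm_powr: "finite I \<Longrightarrow> column_norm M I v powr p = (\<Sum>i\<in>I. nrm M (v i) powr p)"
  by (simp add: column_norm_def Lp_norm_count_space_powr Lp_norm_nonneg)

lemma column_norm_le_iff:
  assumes "finite I" "0 \<le> c"
  shows "column_norm M I v \<le> c \<longleftrightarrow> (\<Sum>i\<in>I. nrm M (v i) powr p) \<le> c powr p"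
  unfolding column_norm_def Lp_norm_le_iff[OF assms(2)] using assms(1)
  by (simp add: lebesgue_integral_count_space_finite Lp_norm_nonneg)

lemma column_norm_triangle:
  assumes "finite I" "\<And>i. i \<in> I \<Longrightarrow> v i \<in> Lp M" "\<And>i. i \<in> I \<Longrightarrow> w i \<in> Lp M"
  shows "column_norm M I (\<lambda>i y. v i y + w i y) \<le> column_norm M I v + column_norm M I w"
proof -
  have "column_norm M I (\<lambda>i y. v i y + w i y) \<le>
      lp I (\<lambda>i. of_real (nrm M (v i)) + of_real (nrm M (w i)))"
    unfolding column_norm_def
  proof (rule Lp_norm_count_space_mono[OF assms(1)])
    fix i assume "i \<in> I"
    then show "cmod (of_real (nrm M (\<lambda>y. v i y + w i y)))
       \<le> cmod (of_real (nrm M (v i)) + of_real (nrm M (w i)))"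
      using Lp_norm_triangle[OF assms(2,3), of i i] Lp_norm_nonneg[of M] by (simp flip: of_real_add)
  qed
  also have "\<dots> \<le> column_norm M I v + column_norm M I w"
    unfolding column_norm_def by (intro Lp_norm_triangle Lp_fun_count_space assms(1))
  finally show ?thesis .
qed

end

context C_representation
begin

text \<open>At most one of the vectors \<open>v k\<close> is nonzero, so the sums over \<open>k\<close> reduce to one term.\<close>

lemma disjoint_blocks_bound:
  fixes v :: "nat \<Rightarrow> 'i \<Rightarrow> complex" and b :: "nat \<Rightarrow> 'i \<Rightarrow> 'i \<Rightarrow> complex"
  assumes "finite I"
    and dis: "\<And>k l j j'. k < m \<Longrightarrow> l < m \<Longrightarrow> k \<noteq> l \<Longrightarrow> j \<in> I \<Longrightarrow> j' \<in> I \<Longrightarrow> v k j * v l j' = 0"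
    and K: "\<And>k c. k < m \<Longrightarrow> (\<Sum>i\<in>I. cmod (\<Sum>j\<in>I. b k i j * c j) powr p) \<le> K * (\<Sum>j\<in>I. cmod (c j) powr p)"
  shows "(\<Sum>i\<in>I. cmod (\<Sum>j\<in>I. \<Sum>k<m. b k i j * v k j) powr p) \<le> K * (\<Sum>j\<in>I. cmod (\<Sum>k<m. v k j) powr p)"
proof (cases "\<exists>k<m. \<exists>j\<in>I. v k j \<noteq> 0")
  case True
  then obtain k where k: "k < m" "\<exists>j\<in>I. v k j \<noteq> 0" by blast
  have z: "v l j = 0" if "l < m" "l \<noteq> k" "j \<in> I" for l j
    using k dis[OF k(1) that(1)] that by (metis mult_eq_0_iff)
  have "(\<Sum>k<m. b k i j * v k j) = (\<Sum>k\<in>{k}. b k i j * v k j)" if "j \<in> I" for i j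
    using k z that by (intro sum.mono_neutral_right) auto
  moreover have "(\<Sum>k<m. v k j) = (\<Sum>k\<in>{k}. v k j)" if "j \<in> I" for j
    using k z that by (intro sum.mono_neutral_right) auto
  ultimately show ?thesis using K[OF k(1), of "v k"] by simp
next
  case False
  then have "v k j = 0" if "k < m" "j \<in> I" for k j using that by blast
  then show ?thesis by simp
qed

lemma compact_finite_cover:
  assumes "\<And>x. x \<in> topspace X \<Longrightarrow> openin X (W x) \<and> x \<in> W x"
  obtains s :: "nat \<Rightarrow> 'x" and m where "\<And>k. k < m \<Longrightarrow> s k \<in> topspace X" "topspace X \<subseteq> (\<Union>k<m. W (s k))"
proof -
  have "\<exists>\<F>. finite \<F> \<and> \<F> \<subseteq> W ` topspace X \<and> topspace X \<subseteq> \<Union>\<F>"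
    by (rule compactinD[of X "topspace X"]) (use compact assms in \<open>auto simp: compact_space_def\<close>)
  then obtain F where F: "finite F" "F \<subseteq> topspace X" "topspace X \<subseteq> \<Union>(W ` F)"
    by (metis finite_subset_image)
  obtain s :: "nat \<Rightarrow> 'x" and m where "F = s ` {i. i < m}"
    using F(1) by (metis finite_imp_nat_seg_image_inj_on)
  then show thesis using F by (intro that[of m s]) auto
qed

text \<open>On a set \<open>W x\<close> the matrix \<open>a\<close> is within \<open>\<epsilon>\<close> of \<open>a(x)\<close>. With an almost disjoint partition \<open>h\<close>
  subordinate to finitely many of these sets, every entry \<open>a i j\<close> is
  \<open>a i j (1 - \<Sum> h k) + \<Sum> (a i j - a i j (s k)) h k + \<Sum> a i j (s k) h k\<close>. The first two summands
  contribute \<open>O(\<epsilon>)\<close>, and the third acts blockwise by scalar matrices.\<close>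

lemma matrix_action_upper:
  fixes a :: "'i \<Rightarrow> 'i \<Rightarrow> 'x \<Rightarrow> complex"
  assumes p2: "p \<noteq> 2" and fin: "finite I" and a: "\<And>i j. i \<in> I \<Longrightarrow> j \<in> I \<Longrightarrow> cont (a i j)"
    and K0: "0 \<le> K" and K: "\<And>x c. x \<in> topspace X \<Longrightarrow>
        (\<Sum>i\<in>I. cmod (\<Sum>j\<in>I. a i j x * c j) powr p) \<le> K powr p * (\<Sum>j\<in>I. cmod (c j) powr p)"
    and \<xi>: "\<And>j. j \<in> I \<Longrightarrow> \<xi> j \<in> Lp M"
  shows "column_norm M I (\<lambda>i y. \<Sum>j\<in>I. action (a i j) (\<xi> j) y) \<le> K * column_norm M I \<xi>"
proof -
  define A where "A = (\<Sum>i\<in>I. \<Sum>j\<in>I. norm_of (C_algebra X) (a i j))"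
  have A: "cmod (a i j x) \<le> A" if "i \<in> I" "j \<in> I" "x \<in> topspace X" for i j x
    unfolding A_def by (rule order_trans[OF C_norm_ge[OF compact a[OF that(1,2)] that(3)]
      member_le_double_sum[where f="\<lambda>i j. norm_of (C_algebra X) (a i j)", OF fin fin that(1,2)]])
      (rule C_norm_nonneg[OF compact a])
  have A0: "0 \<le> A" unfolding A_def by (intro sum_nonneg C_norm_nonneg compact a)
  define E where "E = (\<Sum>j\<in>I. A + nrm M (\<xi> j))"
  define C where "C = lp I (\<lambda>i. of_real E)"
  let ?row = "\<lambda>i y. \<Sum>j\<in>I. action (a i j) (\<xi> j) y"
  have main: "column_norm M I ?row \<le> K * column_norm M I \<xi> + \<epsilon> * C" if \<epsilon>: "0 < \<epsilon>" for \<epsilon>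
  proof -
    define W where "W x = {y \<in> topspace X. (\<Sum>i\<in>I. \<Sum>j\<in>I. cmod (a i j y - a i j x)) \<in> {..<\<epsilon>}}" for x
    have cn: "cont_real (\<lambda>y. cmod (a i j y - a i j x))" if "i \<in> I" "j \<in> I" for i j x
      using cont_diff[OF a[OF that] cont_const] by (simp add: continuous_map_euclidean_iff tendsto_norm)
    have "openin X (W x) \<and> x \<in> W x" if "x \<in> topspace X" for x
    proof
      show "openin X (W x)" unfolding W_def
        by (rule openin_continuous_map_preimage[of X euclidean]) (use cn fin in \<open>auto intro!: continuous_map_sum\<close>)
      show "x \<in> W x" using that \<epsilon> by (simp add: W_def)
    qed
    then obtain s :: "nat \<Rightarrow> 'x" and m where s: "\<And>k. k < m \<Longrightarrow> s k \<in> topspace X"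
      and cov: "topspace X \<subseteq> (\<Union>k<m. W (s k))" and Wo: "\<And>x. x \<in> topspace X \<Longrightarrow> openin X (W x)"
      using compact_finite_cover[of W] by metis
    have near: "cmod (a i j y - a i j x) < \<epsilon>" if "y \<in> W x" "i \<in> I" "j \<in> I" for x y i j
    proof -
      have "cmod (a i j y - a i j x) \<le> (\<Sum>i\<in>I. \<Sum>j\<in>I. cmod (a i j y - a i j x))"
        by (rule member_le_double_sum[OF fin fin that(2,3)]) simp
      also have "\<dots> < \<epsilon>" using that(1) by (simp add: W_def)
      finally show ?thesis .
    qed
    have \<xi>': "\<forall>j\<in>I. \<xi> j \<in> Lp M" using \<xi> by blast
    have Wo': "\<forall>k<m. openin X (W (s k))" using s Wo by blast
    from almost_partition[OF p2 fin \<xi>' \<epsilon> closedin_topspace Wo' cov]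
    obtain h :: "nat \<Rightarrow> 'x \<Rightarrow> real" where
      H1: "\<forall>k<m. cont_real (h k) \<and> (\<forall>x. 0 \<le> h k x \<and> h k x \<le> 1) \<and> (\<forall>x\<in>topspace X. h k x \<noteq> 0 \<longrightarrow> x \<in> W (s k))"
      and H2: "\<forall>k<m. \<forall>l<m. k \<noteq> l \<longrightarrow> (\<forall>x. h k x = 0 \<or> h l x = 0)"
      and H3: "\<forall>\<kappa>. cont_real \<kappa> \<longrightarrow> (\<forall>x. 0 \<le> \<kappa> x \<and> \<kappa> x \<le> 1) \<longrightarrow> (\<forall>x\<in>topspace X. \<kappa> x \<noteq> 0 \<longrightarrow> x \<in> topspace X) \<longrightarrow>
         (\<forall>j\<in>I. nrm M (action (\<lambda>x. of_real (\<kappa> x * (1 - (\<Sum>k<m. h k x)))) (\<xi> j)) \<le> \<epsilon>)"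
      by (elim exE conjE) (rule that)
    let ?h = "\<lambda>k x. complex_of_real (h k x)"
    let ?H = "\<lambda>x. \<Sum>k<m. h k x"
    have ch: "cont (?h k)" if "k < m" for k using H1 that by (intro continuous_map_complex_of_real) blast
    have hb: "0 \<le> h k x" "h k x \<le> 1" if "k < m" for k x using H1 that by auto
    have hW: "x \<in> W (s k)" if "k < m" "x \<in> topspace X" "h k x \<noteq> 0" for k x using H1 that by blast
    have H01: "0 \<le> ?H x \<and> ?H x \<le> 1" for x
    proof (cases "\<exists>k<m. h k x \<noteq> 0")
      case True
      then obtain k where k: "k < m" "h k x \<noteq> 0" by blast
      then have "h l x = 0" if "l < m" "l \<noteq> k" for l using H2 that by metis
      then have "?H x = (\<Sum>k\<in>{k}. h k x)" using k by (intro sum.mono_neutral_right) auto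
      then show ?thesis using hb[OF k(1)] by simp
    qed simp
    have small: "nrm M (action (\<lambda>x. of_real (1 - ?H x)) (\<xi> j)) \<le> \<epsilon>" if "j \<in> I" for j
      using H3[rule_format, of "\<lambda>x. 1" j] that by simp
    have cH: "cont (\<lambda>x. complex_of_real (1 - ?H x))"
      using H1 by (intro continuous_map_complex_of_real continuous_map_diff continuous_map_sum) auto
    let ?\<eta> = "\<lambda>i y. \<Sum>j\<in>I. \<Sum>k<m. a i j (s k) * action (?h k) (\<xi> j) y"
    have hL: "action (?h k) (\<xi> j) \<in> Lp M" if "k < m" "j \<in> I" for k j
      by (rule action_in[OF ch[OF that(1)] \<xi>[OF that(2)]])
    have aL: "action (a i j) (\<xi> j) \<in> Lp M" if "i \<in> I" "j \<in> I" for i j by (rule action_in[OF a[OF that] \<xi>[OF that(2)]])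
    have inner: "(\<lambda>y. \<Sum>k<m. a i j (s k) * action (?h k) (\<xi> j) y) \<in> Lp M" if "i \<in> I" "j \<in> I" for i j
      using hL that by (intro Lp_fun_sum Lp_fun_scale) auto
    have \<eta>L: "?\<eta> i \<in> Lp M" if "i \<in> I" for i using inner[OF that] by (rule Lp_fun_sum)
    have rL: "?row i \<in> Lp M" if "i \<in> I" for i using aL[OF that] by (rule Lp_fun_sum)
    have entry: "nrm M (\<lambda>y. action (a i j) (\<xi> j) y - (\<Sum>k<m. a i j (s k) * action (?h k) (\<xi> j) y))
        \<le> \<epsilon> * (A + nrm M (\<xi> j))" if ij: "i \<in> I" "j \<in> I" for i j
    proof -
      let ?f1 = "\<lambda>x. a i j x * of_real (1 - ?H x)"
      let ?f2 = "\<lambda>x. \<Sum>k<m. (a i j x - a i j (s k)) * ?h k x"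
      let ?f3 = "\<lambda>x. \<Sum>k<m. a i j (s k) * ?h k x"
      note \<xi>j = \<xi>[OF ij(2)]
      have c1: "cont ?f1" by (intro cont_mult a ij cH)
      have c2: "cont ?f2" using ch by (intro cont_sum cont_mult cont_diff a ij cont_const) auto
      have c3: "cont ?f3" using ch by (intro cont_sum cont_scale) auto
      have "a i j x = ?f1 x + (?f2 x + ?f3 x)" for x
        by (simp add: sum.distrib[symmetric] algebra_simps sum_distrib_left)
      then have eq: "action (a i j) = action (\<lambda>x. ?f1 x + (?f2 x + ?f3 x))" by (intro action_cong) blast
      have "AE y in M. action ?f3 (\<xi> j) y = (\<Sum>k<m. action (\<lambda>x. a i j (s k) * ?h k x) (\<xi> j) y)"
        using ch by (intro action_sum cont_scale \<xi>j) auto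
      moreover have "AE y in M. \<forall>k\<in>{..<m}. action (\<lambda>x. a i j (s k) * ?h k x) (\<xi> j) y = a i j (s k) * action (?h k) (\<xi> j) y"
        using ch by (intro AE_finite_allI action_scale \<xi>j) auto
      ultimately have "AE y in M. action (a i j) (\<xi> j) y - (\<Sum>k<m. a i j (s k) * action (?h k) (\<xi> j) y)
          = action ?f1 (\<xi> j) y + action ?f2 (\<xi> j) y"
        using action_add[OF c1 cont_add[OF c2 c3] \<xi>j] action_add[OF c2 c3 \<xi>j]
        unfolding eq by eventually_elim simp
      then have "nrm M (\<lambda>y. action (a i j) (\<xi> j) y - (\<Sum>k<m. a i j (s k) * action (?h k) (\<xi> j) y))
         = nrm M (\<lambda>y. action ?f1 (\<xi> j) y + action ?f2 (\<xi> j) y)"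
        by (intro Lp_norm_cong_AE Lp_funD(1) Lp_fun_diff aL inner ij Lp_fun_add action_in c1 c2 \<xi>j)
      also have "\<dots> \<le> nrm M (action ?f1 (\<xi> j)) + nrm M (action ?f2 (\<xi> j))"
        by (intro Lp_norm_triangle action_in c1 c2 \<xi>j)
      also have "nrm M (action ?f1 (\<xi> j)) = nrm M (action (a i j) (action (\<lambda>x. of_real (1 - ?H x)) (\<xi> j)))"
        by (intro Lp_norm_cong_AE Lp_funD(1) action_mult action_in c1 cH a ij \<xi>j)
      also have "\<dots> \<le> A * nrm M (action (\<lambda>x. of_real (1 - ?H x)) (\<xi> j))"
        using A[OF ij] A0 by (intro action_norm_le a ij action_in cH \<xi>j) auto
      also have "\<dots> \<le> A * \<epsilon>" by (intro mult_left_mono small ij A0)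
      also have "nrm M (action ?f2 (\<xi> j)) \<le> \<epsilon> * nrm M (\<xi> j)"
      proof (rule action_norm_le[OF c2 \<xi>j])
        fix x assume x: "x \<in> topspace X"
        have "cmod (?f2 x) \<le> (\<Sum>k<m. \<epsilon> * h k x)"
        proof (rule sum_norm_le)
          fix k assume "k \<in> {..<m}"
          then have k: "k < m" by simp
          show "cmod ((a i j x - a i j (s k)) * ?h k x) \<le> \<epsilon> * h k x"
          proof (cases "h k x = 0")
            case False
            then have "cmod (a i j x - a i j (s k)) \<le> \<epsilon>" using near[OF hW[OF k x] ij] by simp
            then show ?thesis using hb[OF k, of x] by (simp add: norm_mult mult_right_mono)
          qed simp
        qed
        also have "\<dots> = \<epsilon> * ?H x" by (simp add: sum_distrib_left)
        also have "\<dots> \<le> \<epsilon> * 1" using H01[of x] \<epsilon> by (intro mult_left_mono) auto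
        finally show "cmod (?f2 x) \<le> \<epsilon>" by simp
      qed (use \<epsilon> in simp)
      finally show ?thesis by (simp add: algebra_simps)
    qed
    have "column_norm M I (\<lambda>i y. ?row i y - ?\<eta> i y) \<le> lp I (\<lambda>i. of_real \<epsilon> * of_real E)"
      unfolding column_norm_def
    proof (rule Lp_norm_count_space_mono[OF fin])
      fix i assume i: "i \<in> I"
      have "nrm M (\<lambda>y. ?row i y - ?\<eta> i y) =
        nrm M (\<lambda>y. \<Sum>j\<in>I. action (a i j) (\<xi> j) y - (\<Sum>k<m. a i j (s k) * action (?h k) (\<xi> j) y))"
        by (simp add: sum_subtractf)
      also have "\<dots> \<le> (\<Sum>j\<in>I. nrm M (\<lambda>y. action (a i j) (\<xi> j) y - (\<Sum>k<m. a i j (s k) * action (?h k) (\<xi> j) y)))"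
        by (intro Lp_norm_sum_le fin Lp_fun_diff aL inner i)
      also have "\<dots> \<le> (\<Sum>j\<in>I. \<epsilon> * (A + nrm M (\<xi> j)))" by (intro sum_mono entry i)
      also have "\<dots> = \<epsilon> * E" by (simp add: E_def sum_distrib_left)
      finally have "nrm M (\<lambda>y. ?row i y - ?\<eta> i y) \<le> \<epsilon> * E" .
      then show "cmod (of_real (nrm M (\<lambda>y. ?row i y - ?\<eta> i y))) \<le> cmod (of_real \<epsilon> * of_real E)"
        using Lp_norm_nonneg[of M "\<lambda>y. ?row i y - ?\<eta> i y"] by (simp flip: of_real_mult)
    qed
    also have "\<dots> = \<epsilon> * C" using \<epsilon> by (simp add: Lp_norm_scale C_def)
    finally have err: "column_norm M I (\<lambda>i y. ?row i y - ?\<eta> i y) \<le> \<epsilon> * C" .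
    \<comment> \<open>in \<open>?\<eta>\<close> the contributions of different \<open>k\<close> are disjoint, so the scalar bound \<open>K\<close> applies pointwise\<close>
    have "column_norm M I ?\<eta> \<le> K * column_norm M I \<xi>"
    proof -
      let ?g = "\<lambda>j y. \<Sum>k<m. action (?h k) (\<xi> j) y"
      have gL: "?g j \<in> Lp M" if "j \<in> I" for j using hL that by (intro Lp_fun_sum) auto
      have "AE y in M. \<forall>k\<in>{..<m}. \<forall>l\<in>{..<m}. \<forall>j\<in>I. \<forall>j'\<in>I. k \<noteq> l \<longrightarrow> action (?h k) (\<xi> j) y * action (?h l) (\<xi> j') y = 0"
      proof (intro AE_finite_allI finite_lessThan fin)
        fix k l j j' assume *: "k \<in> {..<m}" "l \<in> {..<m}" "j \<in> I" "j' \<in> I"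
        show "AE y in M. k \<noteq> l \<longrightarrow> action (?h k) (\<xi> j) y * action (?h l) (\<xi> j') y = 0"
        proof (cases "k = l")
          case False
          have "AE y in M. action (?h k) (\<xi> j) y * action (?h l) (\<xi> j') y = 0"
            using * ch \<xi> H2 False by (intro action_disjoint[OF p2]) auto
          then show ?thesis by eventually_elim simp
        qed simp
      qed
      then have "AE y in M. (\<Sum>i\<in>I. cmod (?\<eta> i y) powr p) \<le> K powr p * (\<Sum>j\<in>I. cmod (?g j y) powr p)"
      proof eventually_elim
        case (elim y)
        show ?case
          by (rule disjoint_blocks_bound[OF fin, where b="\<lambda>k i j. a i j (s k)" and v="\<lambda>k j. action (?h k) (\<xi> j) y"])
            (use elim K s in auto)
      qed
      then have "(\<integral>y. (\<Sum>i\<in>I. cmod (?\<eta> i y) powr p) \<partial>M) \<le> (\<integral>y. K powr p * (\<Sum>j\<in>I. cmod (?g j y) powr p) \<partial>M)"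
        using Lp_funD(2)[OF \<eta>L] Lp_funD(2)[OF gL]
        by (intro integral_mono_AE integrable_mult_right Bochner_Integration.integrable_sum) auto
      moreover have "(\<integral>y. (\<Sum>i\<in>I. cmod (?\<eta> i y) powr p) \<partial>M) = (\<Sum>i\<in>I. nrm M (?\<eta> i) powr p)"
        unfolding Lp_norm_powr using Lp_funD(2)[OF \<eta>L] by (intro Bochner_Integration.integral_sum) auto
      moreover have "(\<integral>y. K powr p * (\<Sum>j\<in>I. cmod (?g j y) powr p) \<partial>M) = K powr p * (\<Sum>j\<in>I. nrm M (?g j) powr p)"
        unfolding Lp_norm_powr using Lp_funD(2)[OF gL] by (simp add: Bochner_Integration.integral_sum)
      ultimately have "(\<Sum>i\<in>I. nrm M (?\<eta> i) powr p) \<le> K powr p * (\<Sum>j\<in>I. nrm M (?g j) powr p)" by argo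
      also have "\<dots> \<le> K powr p * (\<Sum>j\<in>I. nrm M (\<xi> j) powr p)"
      proof (intro mult_left_mono sum_mono powr_mono2 Lp_norm_nonneg)
        fix j assume j: "j \<in> I"
        have "nrm M (?g j) = nrm M (action (\<lambda>x. \<Sum>k<m. ?h k x) (\<xi> j))"
          using action_sum[of "{..<m}" ?h "\<xi> j"] ch \<xi>[OF j]
          by (intro Lp_norm_cong_AE Lp_funD(1) gL j action_in cont_sum) (auto elim: eventually_mono)
        also have "\<dots> \<le> 1 * nrm M (\<xi> j)"
          using ch H01 by (intro action_norm_le cont_sum \<xi> j) (auto simp flip: of_real_sum)
        finally show "nrm M (?g j) \<le> nrm M (\<xi> j)" by simp
      qed (use p_pos in auto)
      also have "\<dots> = (K * column_norm M I \<xi>) powr p"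
        using K0 column_norm_nonneg[of M I \<xi>] by (simp add: powr_mult column_norm_powr fin)
      finally show ?thesis
        using K0 column_norm_nonneg[of M I \<xi>] by (subst column_norm_le_iff[OF fin]) auto
    qed
    moreover have "column_norm M I (\<lambda>i y. ?\<eta> i y + (?row i y - ?\<eta> i y)) \<le> column_norm M I ?\<eta> + column_norm M I (\<lambda>i y. ?row i y - ?\<eta> i y)"
      by (intro column_norm_triangle fin \<eta>L Lp_fun_diff rL)
    ultimately show ?thesis using err by simp
  qed
  show ?thesis
  proof (rule field_le_epsilon)
    fix e :: real assume e: "0 < e"
    have C0: "0 \<le> C" by (simp add: C_def Lp_norm_nonneg)
    have "e / (C + 1) * C \<le> e" using e C0 by (simp add: field_simps)
    then show "column_norm M I ?row \<le> K * column_norm M I \<xi> + e"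
      using main[of "e / (C + 1)"] e C0 by simp
  qed
qed

text \<open>The column \<open>c\<^sub>j \<zeta>\<close> with \<open>\<zeta> = \<pi>(f) \<eta>\<close>, where \<open>f\<close> is a bump at \<open>x\<close> supported where
  \<open>b = a c\<close> is within \<open>\<delta>\<close> of \<open>b(x)\<close> and \<open>\<eta>\<close> almost attains the norm of \<open>\<pi>(f)\<close>: its image has
  entries within \<open>\<delta>\<close> of \<open>b\<^sub>i(x) \<zeta>\<close>.\<close>

lemma matrix_action_lower:
  fixes a :: "'i \<Rightarrow> 'i \<Rightarrow> 'x \<Rightarrow> complex"
  assumes fin: "finite I" and a: "\<And>i j. i \<in> I \<Longrightarrow> j \<in> I \<Longrightarrow> cont (a i j)"
    and x: "x \<in> topspace X" and c: "lp I c \<le> 1"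
    and t: "t < lp I (\<lambda>i. \<Sum>j\<in>I. a i j x * c j)"
  shows "\<exists>\<xi>. (\<forall>j. \<xi> j \<in> Lp M) \<and> column_norm M I \<xi> \<le> 1 \<and>
     t < column_norm M I (\<lambda>i y. \<Sum>j\<in>I. action (a i j) (\<xi> j) y)"
proof -
  define b where "b i y = (\<Sum>j\<in>I. a i j y * c j)" for i y
  have cb: "cont (b i)" if "i \<in> I" for i unfolding b_def[abs_def] using that by (intro cont_sum fin cont_mult a cont_const)
  define B where "B = lp I (\<lambda>i. b i x)"
  define L1 where "L1 = lp I (\<lambda>i. 1)"
  have BL: "0 \<le> B" "0 \<le> L1" "t < B" using t by (auto simp: B_def L1_def b_def Lp_norm_nonneg)
  define \<delta> where "\<delta> = (B - t) / (B + L1 + 1)"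
  have \<delta>: "0 < \<delta>" using BL by (simp add: \<delta>_def)
  have \<delta>t: "t < B - \<delta> * (B + L1)"
  proof -
    have "\<delta> * (B + L1) < \<delta> * (B + L1 + 1)" using \<delta> by simp
    also have "\<dots> = B - t" using BL by (simp add: \<delta>_def)
    finally show ?thesis by simp
  qed
  let ?W = "{y \<in> topspace X. (\<Sum>i\<in>I. cmod (b i y - b i x)) \<in> {..<\<delta>}}"
  have cn: "cont_real (\<lambda>y. cmod (b i y - b i x))" if "i \<in> I" for i
    using cont_diff[OF cb[OF that] cont_const] by (simp add: continuous_map_euclidean_iff tendsto_norm)
  have W: "openin X ?W"
    by (rule openin_continuous_map_preimage[of X euclidean]) (use cn fin in \<open>auto intro!: continuous_map_sum\<close>)
  have xW: "x \<in> ?W" using x \<delta> by simp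
  have sing: "closedin X {x}"
    by (rule closedin_t1_singleton[OF metrizable_imp_t1_space[OF metrizable] x])
  have "closedin X (topspace X - ?W)" by (rule closedin_diff[OF closedin_topspace W])
  moreover have "disjnt (topspace X - ?W) {x}" using xW by (simp add: disjnt_def)
  ultimately obtain f where f: "continuous_map X (top_of_set {0..1::real}) f"
    and f0: "f ` (topspace X - ?W) \<subseteq> {0}" and f1: "f ` {x} \<subseteq> {1}"
    by (rule Urysohn_lemma[OF normal _ sing _ zero_le_one])
  have fc: "cont_real f" using f continuous_map_into_fulltopology by blast
  have f01: "0 \<le> f y" "f y \<le> 1" if "y \<in> topspace X" for y
    using continuous_map_image_subset_topspace[OF f] that by auto
  let ?f = "\<lambda>y. complex_of_real (f y)"
  have cf: "cont ?f" by (rule continuous_map_complex_of_real[OF fc])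
  obtain \<eta> where \<eta>: "\<eta> \<in> Lp M" "nrm M \<eta> \<le> 1" "1 - \<delta> < nrm M (action ?f \<eta>)"
    using action_norm_attained[OF cf x, of "1 - \<delta>"] f1 \<delta> by auto
  define \<zeta> where "\<zeta> = action ?f \<eta>"
  have \<zeta>: "\<zeta> \<in> Lp M" unfolding \<zeta>_def by (rule action_in[OF cf \<eta>(1)])
  have \<zeta>1: "nrm M \<zeta> \<le> 1"
  proof -
    have "nrm M \<zeta> \<le> nrm M \<eta>" unfolding \<zeta>_def using f01 by (intro action_of_real_le fc \<eta>(1)) auto
    then show ?thesis using \<eta>(2) by simp
  qed
  let ?\<xi> = "\<lambda>j y. c j * \<zeta> y"
  let ?row = "\<lambda>i y. \<Sum>j\<in>I. action (a i j) (?\<xi> j) y"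
  have \<xi>L: "?\<xi> j \<in> Lp M" for j by (rule Lp_fun_scale[OF \<zeta>])
  have \<xi>1: "column_norm M I ?\<xi> \<le> 1"
  proof -
    have "column_norm M I ?\<xi> \<le> lp I c"
      unfolding column_norm_def
    proof (rule Lp_norm_count_space_mono[OF fin])
      fix i
      have "cmod (c i) * nrm M \<zeta> \<le> cmod (c i) * 1" using \<zeta>1 by (intro mult_left_mono) auto
      then show "cmod (of_real (nrm M (?\<xi> i))) \<le> cmod (c i)"
        using Lp_norm_nonneg[of M \<zeta>] by (simp add: Lp_norm_scale norm_mult)
    qed
    then show ?thesis using c by simp
  qed
  have row: "cmod (b i x) * nrm M \<zeta> \<le> nrm M (?row i) + \<delta>" if i: "i \<in> I" for i
  proof -
    let ?g = "\<lambda>y. (b i y - b i x) * ?f y"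
    have cg: "cont ?g" by (intro cont_mult cont_diff cb i cont_const cf)
    have rL: "?row i \<in> Lp M" by (intro Lp_fun_sum action_in a i \<xi>L)
    have "AE y in M. \<forall>j\<in>I. action (a i j) (?\<xi> j) y = c j * action (a i j) \<zeta> y"
      using a i by (intro AE_finite_allI fin action_vec_scale \<zeta>) auto
    moreover have "AE y in M. \<forall>j\<in>I. action (\<lambda>z. c j * (a i j z)) \<zeta> y = c j * action (a i j) \<zeta> y"
      using a i by (intro AE_finite_allI fin action_scale \<zeta>) auto
    moreover have "AE y in M. action (\<lambda>z. \<Sum>j\<in>I. c j * (a i j z)) \<zeta> y = (\<Sum>j\<in>I. action (\<lambda>z. c j * (a i j z)) \<zeta> y)"
      using a i by (intro action_sum fin cont_scale \<zeta>) auto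
    ultimately have r1: "AE y in M. ?row i y = action (b i) \<zeta> y"
      unfolding b_def[abs_def] by eventually_elim (simp add: mult.commute)
    have "AE y in M. action (\<lambda>z. b i z * ?f z) \<eta> y = action (b i) \<zeta> y"
      unfolding \<zeta>_def by (intro action_mult cb i cf \<eta>(1))
    moreover have "action (\<lambda>z. b i z * ?f z) = action (\<lambda>z. b i x * ?f z + ?g z)"
      by (rule action_cong) (simp add: algebra_simps)
    moreover have "AE y in M. action (\<lambda>z. b i x * ?f z + ?g z) \<eta> y = action (\<lambda>z. b i x * ?f z) \<eta> y + action ?g \<eta> y"
      by (intro action_add cont_scale cf cg \<eta>(1))
    moreover have "AE y in M. action (\<lambda>z. b i x * ?f z) \<eta> y = b i x * \<zeta> y"
      unfolding \<zeta>_def by (intro action_scale cf \<eta>(1))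
    ultimately have "AE y in M. b i x * \<zeta> y = ?row i y + (-1) * action ?g \<eta> y"
      using r1 by (auto elim!: eventually_rev_mp)
    then have "nrm M (\<lambda>y. b i x * \<zeta> y) = nrm M (\<lambda>y. ?row i y + (-1) * action ?g \<eta> y)"
      by (intro Lp_norm_cong_AE Lp_funD(1) Lp_fun_scale \<zeta> Lp_fun_add rL action_in cg \<eta>(1))
    also have "\<dots> \<le> nrm M (?row i) + nrm M (\<lambda>y. (-1) * action ?g \<eta> y)"
      by (intro Lp_norm_triangle rL Lp_fun_scale action_in cg \<eta>(1))
    also have "nrm M (\<lambda>y. (-1) * action ?g \<eta> y) = nrm M (action ?g \<eta>)"
      by (subst Lp_norm_scale) simp
    also have "\<dots> \<le> \<delta> * nrm M \<eta>"
    proof (rule action_norm_le[OF cg \<eta>(1)])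
      fix y assume y: "y \<in> topspace X"
      show "cmod (?g y) \<le> \<delta>"
      proof (cases "y \<in> ?W")
        case True
        have "cmod (b i y - b i x) \<le> (\<Sum>i\<in>I. cmod (b i y - b i x))"
          by (rule member_le_sum[where f="\<lambda>i. cmod (b i y - b i x)"]) (use i fin in auto)
        also have "\<dots> < \<delta>" using True by simp
        finally have "cmod (b i y - b i x) * f y \<le> \<delta> * 1" using f01[OF y] \<delta> by (intro mult_mono) auto
        then show ?thesis using f01[OF y] by (simp add: norm_mult)
      next
        case False
        then have "f y = 0" using f0 y by blast
        then show ?thesis using \<delta> by simp
      qed
    qed (use \<delta> in simp)
    also have "\<dots> \<le> \<delta> * 1" using \<eta>(2) \<delta> by (intro mult_left_mono) auto
    finally show ?thesis by (simp add: Lp_norm_scale)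
  qed
  have "B * nrm M \<zeta> = lp I (\<lambda>i. of_real (nrm M \<zeta>) * b i x)"
    by (subst Lp_norm_scale) (simp add: B_def Lp_norm_nonneg)
  also have "\<dots> \<le> lp I (\<lambda>i. of_real (nrm M (?row i)) + of_real \<delta> * 1)"
  proof (rule Lp_norm_count_space_mono[OF fin])
    fix i assume "i \<in> I"
    then show "cmod (of_real (nrm M \<zeta>) * b i x) \<le> cmod (of_real (nrm M (?row i)) + of_real \<delta> * 1)"
      using row[of i] Lp_norm_nonneg[of M \<zeta>] Lp_norm_nonneg[of M "?row i"] \<delta>
      by (simp add: norm_mult mult.commute flip: of_real_add)
  qed
  also have "\<dots> \<le> column_norm M I ?row + lp I (\<lambda>i. of_real \<delta> * 1)"
    unfolding column_norm_def by (intro Lp_norm_triangle Lp_fun_count_space fin)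
  also have "lp I (\<lambda>i. of_real \<delta> * 1) = \<delta> * L1"
    using \<delta> by (subst Lp_norm_scale) (simp add: L1_def)
  finally have "B * nrm M \<zeta> - \<delta> * L1 \<le> column_norm M I ?row" by simp
  moreover have "B * (1 - \<delta>) \<le> B * nrm M \<zeta>" using \<eta>(3) BL unfolding \<zeta>_def by (intro mult_left_mono) auto
  ultimately have "t < column_norm M I ?row" using \<delta>t by (simp add: algebra_simps)
  then show ?thesis by (intro exI[of _ ?\<xi>] conjI allI \<xi>L \<xi>1)
qed

end

context Lp_exponent
begin

section \<open>The matrix norms of a representation\<close>

lemma column_norm_cong:
  assumes "finite I" "\<And>i. i \<in> I \<Longrightarrow> v i = w i"
  shows "column_norm M I v = column_norm M I w"
  using assms by (simp add: column_norm_def Lp_norm_count_space)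

context
  fixes M :: "'m measure" and I :: "'i set"
  assumes sf: "sigma_finite_measure M" and fin: "finite I"
begin

lemma pair_sigma_finite_count: "pair_sigma_finite (count_space I) M"
  by (simp add: pair_sigma_finite_def sf sigma_finite_measure_count_space_finite fin)

interpretation pair_sigma_finite "count_space I" M by (rule pair_sigma_finite_count)

lemma Lp_fun_product:
  "F \<in> Lp (count_space I \<Otimes>\<^sub>M M) \<longleftrightarrow> (\<forall>i\<in>I. (\<lambda>y. F (i, y)) \<in> Lp M)"
proof
  assume F: "F \<in> Lp (count_space I \<Otimes>\<^sub>M M)"
  have "AE i in count_space I. integrable M (\<lambda>y. cmod (F (i, y)) powr p)"
    using AE_integrable_fst'[OF Lp_funD(2)[OF F]] by simp
  then have "integrable M (\<lambda>y. cmod (F (i, y)) powr p)" if "i \<in> I" for i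
    using that by (simp add: AE_count_space)
  moreover have "(\<lambda>y. F (i, y)) \<in> borel_measurable M" if "i \<in> I" for i
    using measurable_Pair2[OF Lp_funD(1)[OF F], of i] that by simp
  ultimately show "\<forall>i\<in>I. (\<lambda>y. F (i, y)) \<in> Lp M" by (simp add: Lp_fun_def)
next
  assume F: "\<forall>i\<in>I. (\<lambda>y. F (i, y)) \<in> Lp M"
  have m: "F \<in> borel_measurable (count_space I \<Otimes>\<^sub>M M)"
    by (rule measurable_pair_measure_countable1) (use F fin in \<open>auto simp: countable_finite intro: Lp_funD(1)\<close>)
  have "integrable (count_space I \<Otimes>\<^sub>M M) (\<lambda>z. cmod (F z) powr p)"
  proof (rule Fubini_integrable)
    show "(\<lambda>z. cmod (F z) powr p) \<in> borel_measurable (count_space I \<Otimes>\<^sub>M M)" using m by measurable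
    show "AE i in count_space I. integrable M (\<lambda>y. cmod (F (i, y)) powr p)"
      using F by (auto simp: AE_count_space intro: Lp_funD(2))
  qed (simp add: integrable_count_space fin)
  with m show "F \<in> Lp (count_space I \<Otimes>\<^sub>M M)" by (simp add: Lp_fun_def)
qed

lemma Lp_norm_product:
  assumes F: "F \<in> Lp (count_space I \<Otimes>\<^sub>M M)"
  shows "nrm (count_space I \<Otimes>\<^sub>M M) F = column_norm M I (\<lambda>i y. F (i, y))"
proof -
  have "(\<integral>z. cmod (F z) powr p \<partial>(count_space I \<Otimes>\<^sub>M M)) = (\<Sum>i\<in>I. \<integral>y. cmod (F (i, y)) powr p \<partial>M)"
    using integral_fst'[OF Lp_funD(2)[OF F]] by (simp add: lebesgue_integral_count_space_finite fin)
  then show ?thesis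
    by (simp add: column_norm_def Lp_norm_count_space fin Lp_norm_nonneg Lp_norm_powr)
      (simp add: Lp_norm_def)
qed

lemma AE_product:
  assumes "AE z in count_space I \<Otimes>\<^sub>M M. P z" "i \<in> I"
  shows "AE y in M. P (i, y)"
  using AE_pair[OF assms(1)] assms(2) by (simp add: AE_count_space)

end

text \<open>Both kinds of matrix operators are given by maps of functions that are composed with a choice of
  representatives. The choice drops out of the norm.\<close>

lemma operator_norm_of_function_map:
  assumes \<Phi>: "\<And>f. f \<in> Lp N \<Longrightarrow> \<Phi> f \<in> Lp N"
    and cong: "\<And>f g. f \<in> Lp N \<Longrightarrow> g \<in> Lp N \<Longrightarrow> (AE x in N. f x = g x) \<Longrightarrow> nrm N (\<Phi> f) = nrm N (\<Phi> g)"
  shows "norm_of (Lp_operators p N) (\<lambda>\<xi>\<in>carr (Lp_space p N). cls N (\<Phi> (Lp_rep \<xi>)))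
    = Sup {nrm N (\<Phi> f) | f. f \<in> Lp N \<and> nrm N f \<le> 1}"
proof -
  let ?T = "\<lambda>\<xi>\<in>carr (Lp_space p N). cls N (\<Phi> (Lp_rep \<xi>))"
  have n: "norm_of (Lp_space p N) (?T (cls N f)) = nrm N (\<Phi> f)" if f: "f \<in> Lp N" for f
    using cong[OF Lp_class_rep[OF f] f Lp_class_rep_AE[OF f]]
    by (simp add: Lp_class_in f norm_of_Lp_class \<Phi> Lp_class_rep)
  have "{norm_of (Lp_space p N) (?T x) | x. x \<in> carr (Lp_space p N) \<and> norm_of (Lp_space p N) x \<le> 1}
    = {nrm N (\<Phi> f) | f. f \<in> Lp N \<and> nrm N f \<le> 1}" (is "?A = ?B")
  proof (intro set_eqI iffI)
    fix s assume "s \<in> ?A"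
    then obtain x where x: "x \<in> carr (Lp_space p N)" "norm_of (Lp_space p N) x \<le> 1" "s = norm_of (Lp_space p N) (?T x)" by blast
    obtain f where f: "f \<in> Lp N" "x = cls N f" using carr_LpE[OF x(1)] .
    have "s = nrm N (\<Phi> f)" "nrm N f \<le> 1"
      using x(2,3) n[OF f(1)] norm_of_Lp_class[OF f(1)] unfolding f(2) by simp_all
    then show "s \<in> ?B" using f(1) by blast
  next
    fix s assume "s \<in> ?B"
    then obtain f where f: "f \<in> Lp N" "nrm N f \<le> 1" "s = nrm N (\<Phi> f)" by blast
    have "s = norm_of (Lp_space p N) (?T (cls N f))" using n[OF f(1)] f(3) by simp
    moreover have "norm_of (Lp_space p N) (cls N f) \<le> 1" using norm_of_Lp_class[OF f(1)] f(2) by simp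
    ultimately show "s \<in> ?A" using Lp_class_in[OF f(1)] by blast
  qed
  then show ?thesis by (simp add: bounded_operators_def)
qed

lemma scalar_matrix_norm_eq_Sup:
  "scalar_matrix_norm p n a = Sup {lp {1..n} (\<lambda>i. \<Sum>j=1..n. a i j * c j) | c.
      lp {1..n} c \<le> 1}"
proof -
  have L: "c \<in> Lp (count_space {1..n})" for c :: "nat \<Rightarrow> complex" by (simp add: Lp_fun_count_space)
  have "scalar_matrix_norm p n a = Sup {lp {1..n} (\<lambda>i. \<Sum>j=1..n. a i j * c j) | c.
      c \<in> Lp (count_space {1..n}) \<and> lp {1..n} c \<le> 1}"
    unfolding scalar_matrix_norm_def scalar_matrix_operator_def
  proof (rule operator_norm_of_function_map[where \<Phi>="\<lambda>c i. \<Sum>j=1..n. a i j * c j"])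
    fix f g :: "nat \<Rightarrow> complex" assume "AE j in count_space {1..n}. f j = g j"
    then have "f j = g j" if "j \<in> {1..n}" for j using that by (auto simp: AE_count_space)
    then show "lp {1..n} (\<lambda>i. \<Sum>j=1..n. a i j * f j) = lp {1..n} (\<lambda>i. \<Sum>j=1..n. a i j * g j)"
      by simp
  qed (rule L)
  then show ?thesis by (simp only: L simp_thms)
qed

lemma norm_le_Lp_norm_count_space:
  assumes "finite I" "i \<in> I"
  shows "cmod (c i) \<le> lp I c"
proof -
  have "cmod (c i) powr p \<le> (\<Sum>i\<in>I. cmod (c i) powr p)"
    by (rule member_le_sum[where f="\<lambda>i. cmod (c i) powr p"]) (use assms in auto)
  then have "(cmod (c i) powr p) powr (1 / p) \<le> lp I c"
    unfolding Lp_norm_count_space[OF assms(1)] using p_pos by (intro powr_mono2) auto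
  then show ?thesis using p_pos by (simp add: powr_powr)
qed

lemma scalar_matrix_bound:
  assumes A: "\<And>i j. i \<in> {1..n} \<Longrightarrow> j \<in> {1..n} \<Longrightarrow> cmod (a i j) \<le> A"
    and c: "lp {1..n} c \<le> 1"
  shows "lp {1..n} (\<lambda>i. \<Sum>j=1..n. a i j * c j) \<le> lp {1..n} (\<lambda>i. of_real (real n * A))"
proof (rule Lp_norm_count_space_mono)
  fix i assume i: "i \<in> {1..n}"
  have "cmod (\<Sum>j=1..n. a i j * c j) \<le> (\<Sum>j=1..n. A)"
  proof (rule sum_norm_le)
    fix j assume j: "j \<in> {1..n}"
    have "cmod (c j) \<le> 1" using norm_le_Lp_norm_count_space[of "{1..n}" j c] j c by simp
    then have "cmod (a i j) * cmod (c j) \<le> A * 1"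
      by (intro mult_mono A[OF i j] order_trans[OF norm_ge_zero A[OF i j]] norm_ge_zero)
    then show "cmod (a i j * c j) \<le> A" by (simp add: norm_mult)
  qed
  then have "cmod (\<Sum>j=1..n. a i j * c j) \<le> real n * A" by simp
  also have "\<dots> \<le> cmod (of_real (real n * A))" unfolding norm_of_real by (rule abs_ge_self)
  finally show "cmod (\<Sum>j=1..n. a i j * c j) \<le> cmod (of_real (real n * A))" .
qed simp

lemma scalar_matrix_norm_set:
  fixes a :: "nat \<Rightarrow> nat \<Rightarrow> complex" and n :: nat
  defines "S \<equiv> {lp {1..n} (\<lambda>i. \<Sum>j=1..n. a i j * c j) | c. lp {1..n} c \<le> 1}"
  shows "bdd_above S" and "0 \<in> S"
proof -
  define A where "A = (\<Sum>i=1..n. \<Sum>j=1..n. cmod (a i j))"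
  have A: "cmod (a i j) \<le> A" if "i \<in> {1..n}" "j \<in> {1..n}" for i j
    unfolding A_def by (rule member_le_double_sum) (use that in auto)
  show "bdd_above S"
  proof (rule bdd_aboveI)
    fix s assume "s \<in> S"
    then obtain c where c: "lp {1..n} c \<le> 1" "s = lp {1..n} (\<lambda>i. \<Sum>j=1..n. a i j * c j)"
      unfolding S_def by (elim CollectE exE conjE) (rule that)
    show "s \<le> lp {1..n} (\<lambda>i. of_real (real n * A))"
      unfolding c(2) by (rule scalar_matrix_bound[OF A c(1)])
  qed
  show "0 \<in> S" unfolding S_def
    by (intro CollectI exI[of _ "\<lambda>i. 0"] conjI) (simp_all add: Lp_norm_zero)
qed

lemma scalar_matrix_norm_le:
  assumes A: "\<And>i j. i \<in> {1..n} \<Longrightarrow> j \<in> {1..n} \<Longrightarrow> cmod (a i j) \<le> A"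
  shows "scalar_matrix_norm p n a \<le> lp {1..n} (\<lambda>i. of_real (real n * A))"
  unfolding scalar_matrix_norm_eq_Sup
proof (rule cSup_least, goal_cases)
  case 1
  then show ?case using scalar_matrix_norm_set(2)[of n a] by (metis (no_types, lifting) empty_iff)
next
  case (2 s)
  then obtain c where "lp {1..n} c \<le> 1" "s = lp {1..n} (\<lambda>i. \<Sum>j=1..n. a i j * c j)"
    by (elim CollectE exE conjE) (rule that)
  then show ?case using scalar_matrix_bound[where a=a, OF A] by simp
qed

lemma scalar_matrix_norm_attained:
  assumes "t < scalar_matrix_norm p n a"
  obtains c where "lp {1..n} c \<le> 1"
    "t < lp {1..n} (\<lambda>i. \<Sum>j=1..n. a i j * c j)"
proof -
  obtain s where "s \<in> {lp {1..n} (\<lambda>i. \<Sum>j=1..n. a i j * c j) | c. lp {1..n} c \<le> 1}" "t < s"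
    using less_cSupE[OF assms[unfolded scalar_matrix_norm_eq_Sup]] scalar_matrix_norm_set(2)[of n a] by (metis (no_types, lifting) empty_iff)
  then show thesis using that by (elim CollectE exE conjE) simp
qed

lemma scalar_matrix_norm_ge:
  "lp {1..n} (\<lambda>i. \<Sum>j=1..n. a i j * c j) \<le> scalar_matrix_norm p n a * lp {1..n} c"
proof (cases "lp {1..n} c = 0")
  case True
  then have "c j = 0" if "j \<in> {1..n}" for j
    using norm_le_Lp_norm_count_space[of "{1..n}" j c] that by simp
  then have "lp {1..n} (\<lambda>i. \<Sum>j=1..n. a i j * c j) = 0"
    by (simp add: Lp_norm_zero)
  then show ?thesis using True by simp
next
  case False
  let ?N = "lp {1..n}"
  let ?r = "complex_of_real (inverse (?N c))"
  have pos: "0 < ?N c" using False Lp_norm_nonneg[of "count_space {1..n}" c] by simp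
  have "?N (\<lambda>j. ?r * c j) \<le> 1" using pos by (subst Lp_norm_scale) (simp add: norm_inverse)
  then have "?N (\<lambda>i. \<Sum>j=1..n. a i j * (?r * c j)) \<le> scalar_matrix_norm p n a"
    unfolding scalar_matrix_norm_eq_Sup
    by (intro cSup_upper scalar_matrix_norm_set(1) CollectI exI[of _ "\<lambda>j. ?r * c j"] conjI refl)
  also have "(\<lambda>i. \<Sum>j=1..n. a i j * (?r * c j)) = (\<lambda>i. ?r * (\<Sum>j=1..n. a i j * c j))"
    by (simp add: sum_distrib_left mult.left_commute)
  also have "?N \<dots> = inverse (?N c) * ?N (\<lambda>i. \<Sum>j=1..n. a i j * c j)"
    using pos by (subst Lp_norm_scale) (simp add: norm_inverse)
  finally show ?thesis using pos by (simp add: field_simps)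
qed

end

context C_representation
begin

theorem matrix_norm_formula:
  assumes p2: "p \<noteq> 2" and sf: "sigma_finite_measure M" and a: "a \<in> matrices n (carr (C_algebra X))"
  shows "matrix_norm p M n (\<lambda>i j. \<pi> (a i j)) = sup0 ((\<lambda>x. scalar_matrix_norm p n (\<lambda>i j. a i j x)) ` topspace X)"
proof -
  let ?I = "{1..n}"
  let ?PM = "count_space ?I \<Otimes>\<^sub>M M"
  let ?N = "lp ?I"
  let ?S = "(\<lambda>x. scalar_matrix_norm p n (\<lambda>i j. a i j x)) ` topspace X"
  have aC: "a i j \<in> carr (C_algebra X)" if "i \<in> ?I" "j \<in> ?I" for i j using a that by (auto simp: matrices_def)
  have cont_a: "cont (a i j)" if "i \<in> ?I" "j \<in> ?I" for i j using aC[OF that] by (simp add: C_carr)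
  have act: "Lp_rep (\<pi> (a i j) (cls M \<xi>)) = action (a i j) \<xi>" if "i \<in> ?I" "j \<in> ?I" for i j \<xi>
    using aC[OF that] by (simp add: action_def C_carr extensional_restrict)
  define \<Phi> where "\<Phi> F = (\<lambda>(i, y). \<Sum>j=1..n. Lp_rep (\<pi> (a i j) (cls M (\<lambda>z. F (j, z)))) y)" for F
  have \<Phi>_eq: "(\<lambda>y. \<Phi> F (i, y)) = (\<lambda>y. \<Sum>j=1..n. action (a i j) (\<lambda>z. F (j, z)) y)" if "i \<in> ?I" for F i
    using that by (simp add: \<Phi>_def act)
  note fun_prod = Lp_fun_product[OF sf finite_atLeastAtMost[of 1 n]]
    and norm_prod = Lp_norm_product[OF sf finite_atLeastAtMost[of 1 n]]
  have \<Phi>L: "\<Phi> F \<in> Lp ?PM" if F: "F \<in> Lp ?PM" for F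
    using F unfolding fun_prod by (auto simp: \<Phi>_eq intro!: Lp_fun_sum action_in cont_a)
  have norm\<Phi>: "nrm ?PM (\<Phi> F) = column_norm M ?I (\<lambda>i y. \<Sum>j=1..n. action (a i j) (\<lambda>z. F (j, z)) y)"
    if F: "F \<in> Lp ?PM" for F
    unfolding norm_prod[OF \<Phi>L[OF F]] by (rule column_norm_cong) (auto simp: \<Phi>_eq)
  have eq: "matrix_norm p M n (\<lambda>i j. \<pi> (a i j)) = Sup {nrm ?PM (\<Phi> F) | F. F \<in> Lp ?PM \<and> nrm ?PM F \<le> 1}"
  proof -
    have op: "matrix_operator p M n (\<lambda>i j. \<pi> (a i j)) = (\<lambda>\<xi>\<in>carr (Lp_space p ?PM). cls ?PM (\<Phi> (Lp_rep \<xi>)))"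
      by (simp add: matrix_operator_def \<Phi>_def)
    have cong: "nrm ?PM (\<Phi> F) = nrm ?PM (\<Phi> G)"
      if F: "F \<in> Lp ?PM" and G: "G \<in> Lp ?PM" and FG: "AE z in ?PM. F z = G z" for F G
      unfolding norm\<Phi>[OF F] norm\<Phi>[OF G]
    proof (rule column_norm_cong)
      fix i assume i: "i \<in> ?I"
      have "action (a i j) (\<lambda>z. F (j, z)) = action (a i j) (\<lambda>z. G (j, z))" if j: "j \<in> ?I" for j
        by (intro action_cong_AE fun_prod[THEN iffD1, rule_format, OF F j] fun_prod[THEN iffD1, rule_format, OF G j]
            AE_product[OF sf finite_atLeastAtMost FG j])
      then show "(\<lambda>y. \<Sum>j=1..n. action (a i j) (\<lambda>z. F (j, z)) y) = (\<lambda>y. \<Sum>j=1..n. action (a i j) (\<lambda>z. G (j, z)) y)"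
        by simp
    qed simp
    show ?thesis
      unfolding matrix_norm_def op by (rule operator_norm_of_function_map) (fact \<Phi>L cong)+
  qed
  have bdd: "bdd_above ?S"
  proof -
    have "\<exists>B. \<forall>x\<in>topspace X. \<forall>i\<in>?I. \<forall>j\<in>?I. cmod (a i j x) \<le> B"
    proof (intro exI ballI)
      fix x i j assume *: "x \<in> topspace X" "i \<in> ?I" "j \<in> ?I"
      show "cmod (a i j x) \<le> (\<Sum>i\<in>?I. \<Sum>j\<in>?I. norm_of (C_algebra X) (a i j))"
        by (rule order_trans[OF C_norm_ge[OF compact cont_a[OF *(2,3)] *(1)]
          member_le_double_sum[where f="\<lambda>i j. norm_of (C_algebra X) (a i j)", OF _ _ *(2,3)]])
          (auto simp del: One_nat_def intro: C_norm_nonneg[OF compact cont_a])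
    qed
    then obtain B where "\<And>x i j. x \<in> topspace X \<Longrightarrow> i \<in> ?I \<Longrightarrow> j \<in> ?I \<Longrightarrow> cmod (a i j x) \<le> B" by blast
    then show ?thesis
      by (intro bdd_aboveI2[of _ _ "?N (\<lambda>i. of_real (real n * B))"] scalar_matrix_norm_le)
  qed
  define K where "K = sup0 ?S"
  have K0: "0 \<le> K" unfolding K_def by (rule sup0_nonneg[OF bdd])
  have Kx: "scalar_matrix_norm p n (\<lambda>i j. a i j x) \<le> K" if "x \<in> topspace X" for x
    unfolding K_def by (rule sup0_ge[OF bdd]) (use that in blast)
  let ?T = "{nrm ?PM (\<Phi> F) | F. F \<in> Lp ?PM \<and> nrm ?PM F \<le> 1}"
  have upper: "s \<le> K" if s: "s \<in> ?T" for s
  proof -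
    obtain F where F: "F \<in> Lp ?PM" "nrm ?PM F \<le> 1" "s = nrm ?PM (\<Phi> F)" using s by blast
    have "s \<le> K * column_norm M ?I (\<lambda>j z. F (j, z))"
      unfolding F(3) norm\<Phi>[OF F(1)]
    proof (rule matrix_action_upper[OF p2 _ cont_a K0])
      fix x and c :: "nat \<Rightarrow> complex" assume x: "x \<in> topspace X"
      have "?N (\<lambda>i. \<Sum>j=1..n. a i j x * c j) \<le> scalar_matrix_norm p n (\<lambda>i j. a i j x) * ?N c"
        by (rule scalar_matrix_norm_ge)
      also have "\<dots> \<le> K * ?N c" by (intro mult_right_mono Kx x Lp_norm_nonneg)
      finally have "?N (\<lambda>i. \<Sum>j=1..n. a i j x * c j) powr p \<le> (K * ?N c) powr p"
        using p_pos by (intro powr_mono2 Lp_norm_nonneg) auto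
      then show "(\<Sum>i=1..n. cmod (\<Sum>j=1..n. a i j x * c j) powr p) \<le> K powr p * (\<Sum>j=1..n. cmod (c j) powr p)"
        using K0 by (simp add: powr_mult Lp_norm_nonneg Lp_norm_count_space_powr)
    qed (use fun_prod[THEN iffD1, OF F(1)] in \<open>blast\<close>)+
    also have "\<dots> \<le> K * 1" using F(2) K0 unfolding norm_prod[OF F(1)] by (intro mult_left_mono)
    finally show ?thesis by simp
  qed
  have bddT: "bdd_above ?T" using upper by (rule bdd_aboveI)
  have T_mem: "nrm ?PM (\<Phi> (\<lambda>z. 0)) \<in> ?T"
    by (intro CollectI exI[of _ "\<lambda>z. 0"] conjI refl Lp_fun_zero) (simp add: Lp_norm_zero)
  have T0: "0 \<le> Sup ?T"
  proof -
    show ?thesis by (rule order_trans[OF Lp_norm_nonneg cSup_upper[OF T_mem bddT]])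
  qed
  have lower: "scalar_matrix_norm p n (\<lambda>i j. a i j x) \<le> Sup ?T" if x: "x \<in> topspace X" for x
  proof (rule dense_le)
    fix t assume "t < scalar_matrix_norm p n (\<lambda>i j. a i j x)"
    then obtain c where c: "?N c \<le> 1" "t < ?N (\<lambda>i. \<Sum>j=1..n. a i j x * c j)" by (rule scalar_matrix_norm_attained)
    have "\<exists>\<xi>. (\<forall>j. \<xi> j \<in> Lp M) \<and> column_norm M ?I \<xi> \<le> 1 \<and>
        t < column_norm M ?I (\<lambda>i y. \<Sum>j=1..n. action (a i j) (\<xi> j) y)"
      by (rule matrix_action_lower[OF finite_atLeastAtMost cont_a x c])
    then obtain \<xi> where \<xi>: "\<forall>j. \<xi> j \<in> Lp M" "column_norm M ?I \<xi> \<le> 1"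
      "t < column_norm M ?I (\<lambda>i y. \<Sum>j=1..n. action (a i j) (\<xi> j) y)"
      by (elim exE conjE) (rule that)
    define F where "F = (\<lambda>(j, y). \<xi> j y)"
    have F: "F \<in> Lp ?PM" unfolding fun_prod F_def prod.case using \<xi>(1) by blast
    have F1: "nrm ?PM F \<le> 1" using \<xi>(2) unfolding norm_prod[OF F] unfolding F_def prod.case .
    have "t < nrm ?PM (\<Phi> F)" using \<xi>(3) unfolding norm\<Phi>[OF F] unfolding F_def prod.case .
    also have "nrm ?PM (\<Phi> F) \<le> Sup ?T"
      by (intro cSup_upper[OF _ bddT] CollectI exI[of _ F] conjI refl F F1)
    finally show "t \<le> Sup ?T" by (rule less_imp_le)
  qed
  have "Sup ?T \<le> K"
    by (rule cSup_least[OF _ upper]) (rule notI, use T_mem in \<open>simp only: empty_iff\<close>)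
  moreover have "K \<le> Sup ?T" unfolding K_def 
  proof (rule sup0_le[OF T0])
    fix s assume "s \<in> ?S"
    then obtain x where x: "x \<in> topspace X" and s: "s = scalar_matrix_norm p n (\<lambda>i j. a i j x)" by blast
    show "s \<le> Sup ?T" unfolding s by (rule lower[OF x])
  qed
  ultimately show ?thesis unfolding eq K_def by (rule antisym)
qed

end

lemma Lp_class_cong:
  assumes "\<And>z. z \<in> space N \<Longrightarrow> F z = G z"
  shows "Lp_class p N F = Lp_class p N G"
proof -
  have "F \<in> borel_measurable N \<longleftrightarrow> G \<in> borel_measurable N" by (rule measurable_cong) (rule assms)
  moreover have "integrable N (\<lambda>z. cmod (F z) powr p) \<longleftrightarrow> integrable N (\<lambda>z. cmod (G z) powr p)"
    using assms by (intro Bochner_Integration.integrable_cong) auto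
  moreover have "(AE z in N. F z = H z) \<longleftrightarrow> (AE z in N. G z = H z)" for H
    using assms by (intro AE_cong) auto
  ultimately show ?thesis by (auto simp: Lp_class_def Lp_rel_def Lp_fun_def)
qed

lemma matrix_norm_cong:
  assumes "\<And>i j. i \<in> {1..n} \<Longrightarrow> j \<in> {1..n} \<Longrightarrow> S i j = T i j"
  shows "matrix_norm p M n S = matrix_norm p M n T"
proof -
  have "matrix_operator p M n S = matrix_operator p M n T"
    unfolding matrix_operator_def
    by (intro restrict_ext Lp_class_cong) (auto simp: space_pair_measure assms)
  then show ?thesis by (simp add: matrix_norm_def)
qed

context Lp_exponent
begin

section \<open>Multiplication operators on sequence spaces\<close>

lemma Lp_norm_single:
  fixes S :: "nat set"
  assumes "countable S"
  shows "(\<lambda>k. if k = i then c else 0) \<in> Lp (count_space S)"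
    and "nrm (count_space S) (\<lambda>k. if k = i then c else 0) = (if i \<in> S then cmod c else 0)"
proof -
  let ?f = "\<lambda>k. cmod (if k = i then c else 0) powr p"
  have eq: "{k \<in> S. ?f k \<noteq> 0} \<subseteq> {i}" by auto
  then have fin: "finite {k \<in> S. ?f k \<noteq> 0}" by (rule finite_subset) simp
  show "(\<lambda>k. if k = i then c else 0) \<in> Lp (count_space S)"
  proof -
    have "integrable (count_space S) ?f"
    proof (rule Bochner_Integration.integrable_cong[THEN iffD1, OF refl])
      show "integrable (count_space S) (\<lambda>k. cmod c powr p * indicat_real ({i} \<inter> S) k)"
        by (intro integrable_mult_right integrable_real_indicator) (auto simp: emeasure_count_space_finite of_nat_less_top)
    qed (auto simp: indicator_def)
    then show ?thesis by (simp add: Lp_fun_def)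
  qed
  have "(\<integral>k. ?f k \<partial>count_space S) = (\<Sum>k | k \<in> S \<and> ?f k \<noteq> 0. ?f k)"
    by (rule lebesgue_integral_count_space_finite_support[OF fin])
  also have "\<dots> = (if i \<in> S then cmod c powr p else 0)"
  proof (cases "i \<in> S \<and> c \<noteq> 0")
    case True
    then have "{k. k \<in> S \<and> ?f k \<noteq> 0} = {i}" by auto
    then show ?thesis using True by simp
  next
    case False
    then have "{k. k \<in> S \<and> ?f k \<noteq> 0} = {}" by auto
    then show ?thesis using False by auto
  qed
  finally show "nrm (count_space S) (\<lambda>k. if k = i then c else 0) = (if i \<in> S then cmod c else 0)"
    using p_pos by (simp add: Lp_norm_def powr_powr)
qed

lemma tail_tendsto_zero:
  fixes S :: "nat set"
  assumes g: "g \<in> Lp (count_space S)"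
  shows "(\<lambda>N. nrm (count_space S) (\<lambda>k. if k < N then 0 else g k)) \<longlonglongrightarrow> 0"
proof -
  have "(\<lambda>N. \<integral>k. cmod (if k < N then 0 else g k) powr p \<partial>count_space S) \<longlonglongrightarrow> (\<integral>k. 0 \<partial>count_space S)"
  proof (rule integral_dominated_convergence)
    show "integrable (count_space S) (\<lambda>k. cmod (g k) powr p)" using Lp_funD(2)[OF g] .
    show "AE k in count_space S. (\<lambda>N. cmod (if k < N then 0 else g k) powr p) \<longlonglongrightarrow> 0"
    proof (rule AE_I2)
      fix k :: nat
      have "\<forall>\<^sub>F N in sequentially. cmod (if k < N then 0 else g k) powr p = 0"
        using eventually_gt_at_top[of k] by eventually_elim simp
      then show "(\<lambda>N. cmod (if k < N then 0 else g k) powr p) \<longlonglongrightarrow> 0" by (rule tendsto_eventually)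
    qed
  qed (auto intro!: AE_I2)
  then have "(\<lambda>N. (\<integral>k. cmod (if k < N then 0 else g k) powr p \<partial>count_space S) powr (1 / p)) \<longlonglongrightarrow> 0 powr (1 / p)"
    using p_pos by (intro tendsto_powr') (auto intro!: always_eventually)
  then show ?thesis by (simp add: Lp_norm_def)
qed

text \<open>The finite sequences with entries in a countable dense subset of the complex numbers are dense.\<close>

lemma separable_Lp_count_space:
  fixes S :: "nat set"
  assumes S: "countable S"
  shows "separable (Lp_space p (count_space S))"
proof -
  let ?M = "count_space S" and ?E = "Lp_space p (count_space S)"
  obtain Q :: "complex set" where Q: "countable Q" "\<And>U. open U \<Longrightarrow> U \<noteq> {} \<Longrightarrow> \<exists>q\<in>Q. q \<in> U"
    using countable_dense_setE by blast
  define fin_seq where "fin_seq l k = (if k < length l then l ! k else 0)" for l :: "complex list" and k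
  have fin_L: "fin_seq l \<in> Lp ?M" for l
  proof -
    have "fin_seq l k = (\<Sum>i<length l. if k = i then l ! i else 0)" for k by (simp add: fin_seq_def)
    then have "fin_seq l = (\<lambda>k. \<Sum>i<length l. if k = i then l ! i else 0)" by (rule ext)
    then show ?thesis using Lp_fun_sum[of "{..<length l}" "\<lambda>i k. if k = i then l ! i else 0" ?M] Lp_norm_single(1)[OF S] by simp
  qed
  define D where "D = (\<lambda>l. cls ?M (fin_seq l)) ` lists Q"
  have "countable D" unfolding D_def using Q(1) by (intro countable_image countable_lists)
  moreover have "D \<subseteq> carr ?E" unfolding D_def using fin_L by (auto intro: Lp_class_in)
  moreover have "\<exists>d\<in>D. dist_of ?E x d < e" if x: "x \<in> carr ?E" and e: "0 < e" for x e
  proof -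
    obtain g where g: "g \<in> Lp ?M" "x = cls ?M g" using carr_LpE[OF x] .
    have "\<forall>\<^sub>F N in sequentially. nrm ?M (\<lambda>k. if k < N then 0 else g k) < e / 2"
      using order_tendstoD(2)[OF tail_tendsto_zero[OF g(1)], of "e / 2"] e by simp
    then obtain N where N: "nrm ?M (\<lambda>k. if k < N then 0 else g k) < e / 2"
      by (auto simp: eventually_sequentially)
    define r where "r = e / 2 / (real N + 1)"
    have r: "0 < r" using e by (simp add: r_def)
    have "\<exists>q. q \<in> Q \<and> cmod (g k - q) < r" for k
    proof -
      have "g k \<in> ball (g k) r" using r by simp
      then obtain q where "q \<in> Q" "q \<in> ball (g k) r" using Q(2)[OF open_ball, of "g k" r] by blast
      then show ?thesis by (auto simp: dist_norm)
    qed
    then obtain q where q: "\<And>k. q k \<in> Q" "\<And>k. cmod (g k - q k) < r" by metis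
    let ?l = "map q [0..<N]"
    have "?l \<in> lists Q" using q by auto
    let ?tail = "\<lambda>k. if k < N then 0 else g k" and ?head = "\<lambda>k. \<Sum>i<N. if k = i then g i - q i else 0"
    have tL: "?tail \<in> Lp ?M" by (rule Lp_fun_dominated[OF _ g(1)]) auto
    have hL: "?head \<in> Lp ?M" using Lp_norm_single(1)[OF S] by (intro Lp_fun_sum)
    have eq: "g k + (-1) * fin_seq ?l k = ?tail k + ?head k" for k by (simp add: fin_seq_def)
    have "dist_of ?E x (cls ?M (fin_seq ?l)) = nrm ?M (\<lambda>k. ?tail k + ?head k)"
      unfolding dist_of_def g(2) eq[symmetric] using g(1) fin_L[of ?l]
      by (simp only: scale_of_Lp_class add_of_Lp_class norm_of_Lp_class Lp_fun_add Lp_fun_scale)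
    also have "\<dots> \<le> nrm ?M ?tail + nrm ?M ?head" by (rule Lp_norm_triangle[OF tL hL])
    also have "nrm ?M ?head \<le> (\<Sum>i<N. nrm ?M (\<lambda>k. if k = i then g i - q i else 0))"
      by (intro Lp_norm_sum_le Lp_norm_single(1) S) simp
    also have "\<dots> \<le> (\<Sum>i<N. r)"
      using q(2) r unfolding Lp_norm_single(2)[OF S] by (intro sum_mono) (auto intro: less_imp_le)
    also have "\<dots> < e / 2"
    proof -
      have "(\<Sum>i<N. r) = real N * r" by simp
      also have "\<dots> < (real N + 1) * r" using r by simp
      also have "\<dots> = e / 2" unfolding r_def by (rule nonzero_mult_div_cancel_left[THEN trans[OF times_divide_eq_right]]) linarith
      finally show ?thesis .
    qed
    finally have "dist_of ?E x (cls ?M (fin_seq ?l)) < e" using N by simp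
    moreover have "cls ?M (fin_seq ?l) \<in> D" using \<open>?l \<in> lists Q\<close> by (auto simp: D_def)
    ultimately show ?thesis by blast
  qed
  ultimately show ?thesis unfolding separable_def by blast
qed

definition evaluation_rep ::
  "nat set \<Rightarrow> (nat \<Rightarrow> 'x) \<Rightarrow> ('x \<Rightarrow> complex) \<Rightarrow> (nat \<Rightarrow> complex) set \<Rightarrow> (nat \<Rightarrow> complex) set" where
  "evaluation_rep S s f = (\<lambda>\<xi>\<in>carr (Lp_space p (count_space S)). cls (count_space S) (\<lambda>k. f (s k) * Lp_rep \<xi> k))"

text \<open>The unit vector at \<open>k\<close> shows that the norm of the operator is at least \<open>\<bar>f (s k)\<bar>\<close>, and the
  points \<open>s k\<close> are dense.\<close>

lemma isometric_evaluation_rep: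
  fixes X :: "'x topology" and S :: "nat set"
  assumes X: "compact_space X" and S: "countable S" and s: "s ` S \<subseteq> topspace X" and dense: "X closure_of (s ` S) = topspace X"
  shows "isometric_rep p (count_space S) (C_algebra X) (evaluation_rep S s)"
proof -
  let ?M = "count_space S" and ?E = "Lp_space p (count_space S)" and ?A = "C_algebra X"
  let ?\<pi> = "evaluation_rep S s" and ?B = "Lp_operators p (count_space S)"
  interpret E: complex_normed_space ?E by (rule complex_normed_space_Lp)
  have sk: "s k \<in> topspace X" if "k \<in> S" for k using s that by blast
  have dom: "cmod (f (s k) * g k) \<le> norm_of ?A f * cmod (g k)" if "f \<in> carr ?A" "k \<in> S" for f g k
    using C_norm_ge[OF X _ sk[OF that(2)], of f] that(1) by (simp add: C_carr norm_mult mult_right_mono)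
  have nn: "0 \<le> norm_of ?A f" if "f \<in> carr ?A" for f using C_norm_nonneg[OF X] that by (simp add: C_carr)
  have mL: "(\<lambda>k. f (s k) * g k) \<in> Lp ?M" if "f \<in> carr ?A" "g \<in> Lp ?M" for f g
    by (rule Lp_fun_dominated[OF _ Lp_fun_scale[OF that(2), of "of_real (norm_of ?A f)"]])
      (use dom that nn in \<open>auto simp: norm_mult\<close>)
  have cls: "?\<pi> f (cls ?M g) = cls ?M (\<lambda>k. f (s k) * g k)" if "f \<in> carr ?A" "g \<in> Lp ?M" for f g
  proof -
    have "AE k in ?M. f (s k) * Lp_rep (cls ?M g) k = f (s k) * g k"
      using Lp_class_rep_AE[OF that(2)] by eventually_elim simp
    then show ?thesis unfolding evaluation_rep_def
      by (simp add: Lp_class_in that Lp_class_eq_iff mL Lp_class_rep)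
  qed
  have ext: "?\<pi> f \<in> extensional (carr ?E)" for f unfolding evaluation_rep_def by simp
  have le: "norm_of ?E (?\<pi> f x) \<le> norm_of ?A f * norm_of ?E x" if f: "f \<in> carr ?A" and x: "x \<in> carr ?E" for f x
  proof -
    obtain g where g: "g \<in> Lp ?M" "x = cls ?M g" using carr_LpE[OF x] .
    have "nrm ?M (\<lambda>k. f (s k) * g k) \<le> nrm ?M (\<lambda>k. of_real (norm_of ?A f) * g k)"
      by (rule Lp_norm_mono) (use dom[OF f] nn[OF f] in \<open>auto simp: norm_mult AE_count_space Lp_fun_scale g\<close>)
    then show ?thesis unfolding g(2) using nn[OF f] by (simp add: cls f g mL norm_of_Lp_class Lp_norm_scale)
  qed
  have B: "?\<pi> f \<in> carr ?B" if f: "f \<in> carr ?A" for f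
    unfolding E.op_carr
  proof (intro conjI ballI allI exI[of _ "norm_of ?A f"] le[OF f])
    show "?\<pi> f \<in> carr ?E \<rightarrow>\<^sub>E carr ?E"
      using ext f by (auto simp: PiE_def elim!: carr_LpE simp: cls mL Lp_class_in)
    show "?\<pi> f (add_of ?E x y) = add_of ?E (?\<pi> f x) (?\<pi> f y)" if "x \<in> carr ?E" "y \<in> carr ?E" for x y
      using that f by (auto elim!: carr_LpE simp: cls mL add_of_Lp_class Lp_fun_add distrib_left)
    show "?\<pi> f (scale_of ?E c x) = scale_of ?E c (?\<pi> f x)" if "x \<in> carr ?E" for x c
      using that f by (auto elim!: carr_LpE simp: cls mL scale_of_Lp_class Lp_fun_scale mult.left_commute)
  qed
  have eqI: "T = U" if "T \<in> extensional (carr ?E)" "U \<in> extensional (carr ?E)"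
    "\<And>g. g \<in> Lp ?M \<Longrightarrow> T (cls ?M g) = U (cls ?M g)" for T U
    by (rule extensionalityI[OF that(1,2)]) (use that(3) in \<open>auto elim!: carr_LpE\<close>)
  have class_eq: "cls ?M g = cls ?M h" if "g \<in> Lp ?M" "h \<in> Lp ?M" "\<And>k. k \<in> S \<Longrightarrow> g k = h k" for g h
    using that by (simp add: Lp_class_eq_iff AE_count_space)
  interpret A: complex_banach_algebra ?A by (rule complex_banach_algebra_C[OF X])
  show ?thesis unfolding isometric_hom_def
  proof (intro conjI ballI allI funcsetI)
    show "?\<pi> f \<in> carr ?B" if "f \<in> carr ?A" for f using B[OF that] .
    fix f assume f: "f \<in> carr ?A"
    show "?\<pi> (add_of ?A f h) = add_of ?B (?\<pi> f) (?\<pi> h)" if h: "h \<in> carr ?A" for h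
    proof (rule eqI[OF ext])
      show "add_of ?B (?\<pi> f) (?\<pi> h) \<in> extensional (carr ?E)" by (simp add: bounded_operators_def)
      fix g assume g: "g \<in> Lp ?M"
      have "?\<pi> (add_of ?A f h) (cls ?M g) = cls ?M (\<lambda>k. f (s k) * g k + h (s k) * g k)"
        unfolding cls[OF A.add_closed[OF f h] g]
        by (rule class_eq[OF mL[OF A.add_closed[OF f h] g] Lp_fun_add[OF mL[OF f g] mL[OF h g]]])
          (simp add: C_ops sk distrib_right)
      then show "?\<pi> (add_of ?A f h) (cls ?M g) = add_of ?B (?\<pi> f) (?\<pi> h) (cls ?M g)"
        by (simp add: bounded_operators_def Lp_class_in g cls f h add_of_Lp_class mL)
    qed
    show "?\<pi> (scale_of ?A c f) = scale_of ?B c (?\<pi> f)" for c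
    proof (rule eqI[OF ext])
      show "scale_of ?B c (?\<pi> f) \<in> extensional (carr ?E)" by (simp add: bounded_operators_def)
      fix g assume g: "g \<in> Lp ?M"
      have "?\<pi> (scale_of ?A c f) (cls ?M g) = cls ?M (\<lambda>k. c * (f (s k) * g k))"
        unfolding cls[OF A.scale_closed[OF f] g]
        by (rule class_eq[OF mL[OF A.scale_closed[OF f] g] Lp_fun_scale[OF mL[OF f g]]]) (simp add: C_ops sk)
      then show "?\<pi> (scale_of ?A c f) (cls ?M g) = scale_of ?B c (?\<pi> f) (cls ?M g)"
        by (simp add: bounded_operators_def Lp_class_in g cls f scale_of_Lp_class mL)
    qed
    show "?\<pi> (mult_of ?A f h) = mult_of ?B (?\<pi> f) (?\<pi> h)" if h: "h \<in> carr ?A" for h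
    proof (rule eqI[OF ext])
      show "mult_of ?B (?\<pi> f) (?\<pi> h) \<in> extensional (carr ?E)" by (simp add: bounded_operators_def)
      fix g assume g: "g \<in> Lp ?M"
      have "?\<pi> (mult_of ?A f h) (cls ?M g) = cls ?M (\<lambda>k. f (s k) * (h (s k) * g k))"
        unfolding cls[OF A.mult_closed[OF f h] g]
        by (rule class_eq[OF mL[OF A.mult_closed[OF f h] g] mL[OF f mL[OF h g]]]) (simp add: C_ops sk)
      then show "?\<pi> (mult_of ?A f h) (cls ?M g) = mult_of ?B (?\<pi> f) (?\<pi> h) (cls ?M g)"
        by (simp add: bounded_operators_def Lp_class_in g cls f h mL)
    qed
    show "norm_of ?B (?\<pi> f) = norm_of ?A f"
    proof (rule antisym)
      show "norm_of ?B (?\<pi> f) \<le> norm_of ?A f"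
      proof (rule E.op_norm_le)
        fix x assume x: "x \<in> carr ?E" "norm_of ?E x \<le> 1"
        show "norm_of ?E (?\<pi> f x) \<le> norm_of ?A f"
          using le[OF f x(1)] mult_left_mono[OF x(2) nn[OF f]] by simp
      qed
      let ?c = "norm_of ?B (?\<pi> f)"
      have pt: "cmod (f (s k)) \<le> ?c" if k: "k \<in> S" for k
      proof -
        let ?e = "\<lambda>j. if j = k then 1 else 0 :: complex"
        have e: "?e \<in> Lp ?M" by (rule Lp_norm_single(1)[OF S])
        have e1: "nrm ?M ?e = 1" using Lp_norm_single(2)[OF S, of k 1] k by simp
        have "norm_of ?E (?\<pi> f (cls ?M ?e)) \<le> ?c * 1"
          using E.op_norm_ge[OF B[OF f] Lp_class_in[OF e]] by (simp add: norm_of_Lp_class[OF e] e1)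
        moreover have "(\<lambda>j. f (s j) * ?e j) = (\<lambda>j. if j = k then f (s k) else 0)" by auto
        ultimately show ?thesis
          using Lp_norm_single(2)[OF S, of k "f (s k)"] k mL[OF f e] by (simp add: cls[OF f e] norm_of_Lp_class)
      qed
      show "norm_of ?A f \<le> ?c"
      proof (rule C_norm_le[OF E.op_norm_nonneg[OF B[OF f]]])
        fix x assume x: "x \<in> topspace X"
        have "closedin X {x \<in> topspace X. f x \<in> cball 0 ?c}"
          using f by (intro closedin_continuous_map_preimage[of X euclidean]) (auto simp: C_carr)
        moreover have "s ` S \<subseteq> {x \<in> topspace X. f x \<in> cball 0 ?c}" using pt sk by auto
        ultimately have "X closure_of (s ` S) \<subseteq> {x \<in> topspace X. f x \<in> cball 0 ?c}" by (intro closure_of_minimal)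
        then show "cmod (f x) \<le> ?c" using x dense by auto
      qed
    qed
  qed
qed

text \<open>Indexing by the codes of the points of the dense set, instead of by a sequence that enumerates it,
  covers the empty space too.\<close>

lemma exists_isometric_rep_on_nat:
  fixes X :: "'x topology"
  assumes X: "compact_space X" "metrizable_space X"
  shows "\<exists>(M :: nat measure) \<pi>. separable_sigma_finite p M \<and> isometric_rep p M (C_algebra X) \<pi>"
proof -
  obtain C where C: "countable C" "C \<subseteq> topspace X" "X closure_of C = topspace X"
    using second_countable_imp_separable_space[OF second_countable_compact_metrizable[OF X]]
    unfolding separable_space_def by blast
  let ?S = "to_nat_on C ` C" and ?s = "from_nat_into C"
  have sS: "?s ` ?S = C" using C(1) by (force simp: image_image from_nat_into_to_nat_on)
  have cS: "countable ?S" using C(1) by simp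
  have "separable_sigma_finite p (count_space ?S)"
    unfolding separable_sigma_finite_def
    by (intro conjI sigma_finite_measure_count_space_countable cS separable_Lp_count_space)
  moreover have "isometric_rep p (count_space ?S) (C_algebra X) (evaluation_rep ?S ?s)"
    by (rule isometric_evaluation_rep[OF X(1) cS]) (use sS C in auto)
  ultimately show ?thesis by blast
qed

end

section \<open>Uniqueness of the matrix norms\<close>

lemma matrix_norm_isometric_rep_C:
  fixes X :: "'x topology" and M :: "'m measure"
  assumes "compact_space X" "metrizable_space X" "1 \<le> p" "p \<noteq> 2"
    and "separable_sigma_finite p M" "isometric_rep p M (C_algebra X) \<pi>"
    and "a \<in> matrices n (carr (C_algebra X))"
  shows "matrix_norm p M n (\<lambda>i j. \<pi> (a i j)) = sup0 ((\<lambda>x. scalar_matrix_norm p n (\<lambda>i j. a i j x)) ` topspace X)"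
proof -
  interpret C_representation p X M \<pi> by unfold_locales (use assms in auto)
  show ?thesis using assms by (intro matrix_norm_formula) (auto simp: separable_sigma_finite_def)
qed

lemma unique_Lp_matrix_norms_C:
  fixes X :: "'x topology"
  assumes X: "compact_space X" "metrizable_space X" and p: "1 \<le> p" "p \<noteq> 2"
  shows "unique_Lp_matrix_norms TYPE('m) TYPE('k) p (C_algebra X)"
  unfolding unique_Lp_matrix_norms_def completely_isometric_def
proof (intro allI impI ballI; elim conjE)
  fix M :: "'m measure" and N :: "'k measure" and \<pi> \<sigma> n d
  let ?A = "C_algebra X"
  assume M: "separable_sigma_finite p M" "isometric_rep p M ?A \<pi>"
    and N: "separable_sigma_finite p N" "isometric_rep p N ?A \<sigma>"
    and d: "d \<in> matrices n (\<pi> ` carr ?A)"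
  define a where "a i j = inv_into (carr ?A) \<pi> (d i j)" for i j
  have a: "a \<in> matrices n (carr ?A)" and \<pi>a: "\<And>i j. i \<in> {1..n} \<Longrightarrow> j \<in> {1..n} \<Longrightarrow> \<pi> (a i j) = d i j"
    using d by (auto simp: matrices_def a_def inv_into_into f_inv_into_f)
  have "matrix_norm p N n (\<lambda>i j. (\<sigma> \<circ> inv_into (carr ?A) \<pi>) (d i j)) = matrix_norm p N n (\<lambda>i j. \<sigma> (a i j))"
    by (simp add: a_def)
  also have "\<dots> = matrix_norm p M n (\<lambda>i j. \<pi> (a i j))"
    unfolding matrix_norm_isometric_rep_C[OF X p M a] matrix_norm_isometric_rep_C[OF X p N a] ..
  also have "\<dots> = matrix_norm p M n d" by (rule matrix_norm_cong) (rule \<pi>a)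
  finally show "matrix_norm p N n (\<lambda>i j. (\<sigma> \<circ> inv_into (carr ?A) \<pi>) (d i j)) = matrix_norm p M n d" .
qed

theorem proposition4p6:
  fixes X :: "'x topology" and p :: real
  assumes "compact_space X" and "metrizable_space X"
    and "1 \<le> p" and "p \<noteq> 2"
  shows "separable (C_algebra X) \<and> Lp_operator_algebra TYPE(nat) p (C_algebra X)
    \<and> unique_Lp_matrix_norms TYPE('m) TYPE('k) p (C_algebra X)
    \<and> (\<exists>(M :: nat measure) \<pi>. separable_sigma_finite p M \<and> isometric_rep p M (C_algebra X) \<pi>)
    \<and> (\<forall>(M :: 'm measure) \<pi>. separable_sigma_finite p M \<and> isometric_rep p M (C_algebra X) \<pi> \<longrightarrow>
         (\<forall>n>0. \<forall>a\<in>matrices n (carr (C_algebra X)).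
            matrix_norm p M n (\<lambda>i j. \<pi> (a i j)) =
            sup0 ((\<lambda>x. scalar_matrix_norm p n (\<lambda>i j. a i j x)) ` topspace X)))"
proof -
  interpret Lp_exponent p by unfold_locales fact
  note X = assms(1,2) and p = assms(3,4)
  have nat_rep: "\<exists>(M :: nat measure) \<pi>. separable_sigma_finite p M \<and> isometric_rep p M (C_algebra X) \<pi>"
    by (rule exists_isometric_rep_on_nat[OF X])
  then obtain M :: "nat measure" and \<pi> where \<pi>: "isometric_rep p M (C_algebra X) \<pi>" by blast
  have "closed_subalgebra (\<pi> ` carr (C_algebra X)) (Lp_operators p M)"
    by (rule closed_subalgebra_isometric_image[OF complex_banach_algebra_C[OF X(1)] _ \<pi>])
      (rule complex_normed_space.complex_normed_space_bounded_operators[OF complex_normed_space_Lp])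
  with \<pi> have "Lp_operator_algebra TYPE(nat) p (C_algebra X)"
    unfolding Lp_operator_algebra_def using complex_banach_algebra_C[OF X(1)] by blast
  then show ?thesis
    using separable_C[OF X] unique_Lp_matrix_norms_C[OF X p] nat_rep matrix_norm_isometric_rep_C[OF X p] by blast
qed

end
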